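(* Let $A,B,C$ be complex vector spaces of dimensions $2,3,4$ respectively and let $X=Seg(\mathbb P A^*\times\mathbb P B^*\times\mathbb P C^* )=Seg(\mathbb P^1\times\mathbb P^2\times\mathbb P^3)\subset\mathbb P(A^*\otimes B^*\otimes C^* )$. Then $$I_4(\sigma_3(X))=S_{31}A\otimes S_{211}B\otimes S_{1111}C\;\oplus\;S_{22}A\otimes S_{22}B\otimes S_{1111}C$$ is of dimension $6$ and generates the ideal $I(\sigma_3(X))$. Also, $\sigma_4(X)=\mathbb P(A^*\otimes B^*\otimes C^* )$.
   Context: Work over $\mathbb C$. The Segre variety $Seg$ is the set of classes of decomposable tensors. $\sigma_r(X)$ is the Zariski closure of the union of the linear spans of $r$-tuples of points of $X$. $I(Z)$ is the homogeneous ideal of $Z$ and $I_d(Z)\subset S^d(A\otimes B\otimes C)$ is its degree $d$ part. $S_\pi$ is the Schur functor of the partition $\pi$; the equality is of $GL(A)\times GL(B)\times GL(C)$-submodules of $S^4(A\otimes B\otimes C)$, which is multiplicity free.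
   Formalization: The English says I_4(σ_3(X)) is of dimension 6, but the displayed sum has dimension 3·3·1 + 1·6·1 = 15; the formal statement asserts dimension 15 for I_4 and dimension 6 for the second summand S_22A⊗S_22B⊗S_1111C only. *)

theory Defs
  imports
    Complex_Main
    "HOL-Library.Function_Algebras"
    "HOL-Combinatorics.Permutations"
begin

section \<open>Spaces of complex-valued functions\<close>

text \<open>
  Tensors and polynomials are represented by complex-valued functions; addition and
  multiplication are the pointwise ones of \<^theory>\<open>HOL-Library.Function_Algebras\<close>.
\<close>

definition fscale :: "complex \<Rightarrow> ('x \<Rightarrow> complex) \<Rightarrow> 'x \<Rightarrow> complex"
  where "fscale k f = (\<lambda>x. k * f x)"

interpretation fun_space: vector_space fscale
  by unfold_locales (auto simp: fscale_def fun_eq_iff algebra_simps)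

definition dual :: "(complex \<Rightarrow> 'v \<Rightarrow> 'v::ab_group_add) \<Rightarrow> ('v \<Rightarrow> complex) set"
  where "dual s = {\<phi>. Vector_Spaces.linear s (*) \<phi>}"

definition GL :: "(complex \<Rightarrow> 'v \<Rightarrow> 'v::ab_group_add) \<Rightarrow> ('v \<Rightarrow> 'v) set"
  where "GL s = {g. Vector_Spaces.linear s s g \<and> bij g}"

text \<open>
  For function spaces the tensor product is canonically the span of the external products,
  as a space of functions on the product of the domains.
\<close>

definition tprod ::
    "('x \<Rightarrow> complex) \<Rightarrow> ('y \<Rightarrow> complex) \<Rightarrow> ('z \<Rightarrow> complex) \<Rightarrow> 'x \<times> 'y \<times> 'z \<Rightarrow> complex"
  where "tprod f g h = (\<lambda>(x, y, z). f x * g y * h z)"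

definition tensor3 ::
    "('x \<Rightarrow> complex) set \<Rightarrow> ('y \<Rightarrow> complex) set \<Rightarrow> ('z \<Rightarrow> complex) set
      \<Rightarrow> ('x \<times> 'y \<times> 'z \<Rightarrow> complex) set"
  where "tensor3 X Y Z = fun_space.span {tprod f g h | f g h. f \<in> X \<and> g \<in> Y \<and> h \<in> Z}"

section \<open>Projective geometry in a space of functions\<close>

text \<open>
  Let \<open>V\<close> be a finite-dimensional space of functions on \<open>'x\<close>. The evaluations at the points
  of \<open>'x\<close> span the dual of \<open>V\<close>, so that the products of \<open>d\<close> evaluations span the \<open>d\<close>-th
  symmetric power of that dual, seen as the space of polynomial functions on \<open>V\<close>, homogeneous of
  degree \<open>d\<close>. The functions are set to 0 outside \<open>V\<close>, so that they are determined by their values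
  on \<open>V\<close>.

  For \<open>V = tensor3 (dual sA) (dual sB) (dual sC)\<close>, the evaluation at \<open>(a, b, c)\<close> is the element
  \<open>a \<otimes> b \<otimes> c\<close> of \<open>A \<otimes> B \<otimes> C\<close>, and \<open>sym_power V d\<close> is the \<open>d\<close>-th symmetric power of
  \<open>A \<otimes> B \<otimes> C\<close>.
\<close>

definition sym_power :: "('x \<Rightarrow> complex) set \<Rightarrow> nat \<Rightarrow> (('x \<Rightarrow> complex) \<Rightarrow> complex) set"
  where "sym_power V d =
    fun_space.span (range (\<lambda>(x :: nat \<Rightarrow> 'x) T. if T \<in> V then \<Prod>i<d. T (x i) else 0))"

definition sym_algebra :: "('x \<Rightarrow> complex) set \<Rightarrow> (('x \<Rightarrow> complex) \<Rightarrow> complex) set"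
  where "sym_algebra V = fun_space.span (\<Union>d. sym_power V d)"

text \<open>A point of projective space is a one-dimensional subspace, containing 0.\<close>

definition proj :: "('x \<Rightarrow> complex) set \<Rightarrow> ('x \<Rightarrow> complex) set set"
  where "proj V = {fun_space.span {v} | v. v \<in> V \<and> v \<noteq> 0}"

definition proj_span :: "('x \<Rightarrow> complex) set set \<Rightarrow> ('x \<Rightarrow> complex) set set"
  where "proj_span S = proj (fun_space.span (\<Union>S))"

definition vanishes_on :: "(('x \<Rightarrow> complex) \<Rightarrow> complex) \<Rightarrow> ('x \<Rightarrow> complex) set set \<Rightarrow> bool"
  where "vanishes_on f Z \<longleftrightarrow> (\<forall>p\<in>Z. \<forall>T\<in>p. f T = 0)"

definition zariski_closed :: "('x \<Rightarrow> complex) set \<Rightarrow> ('x \<Rightarrow> complex) set set \<Rightarrow> bool"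
  where "zariski_closed V Y \<longleftrightarrow>
    (\<exists>F \<subseteq> (\<Union>d. sym_power V d). Y = {p \<in> proj V. \<forall>f\<in>F. vanishes_on f {p}})"

definition secant_variety ::
    "('x \<Rightarrow> complex) set \<Rightarrow> nat \<Rightarrow> ('x \<Rightarrow> complex) set set \<Rightarrow> ('x \<Rightarrow> complex) set set"
  where "secant_variety V r X =
    zariski_closed V hull (\<Union>{proj_span (set ps) | ps. length ps = r \<and> set ps \<subseteq> X})"

definition ideal_part ::
    "('x \<Rightarrow> complex) set \<Rightarrow> ('x \<Rightarrow> complex) set set \<Rightarrow> nat \<Rightarrow> (('x \<Rightarrow> complex) \<Rightarrow> complex) set"
  where "ideal_part V Z d = {f \<in> sym_power V d. vanishes_on f Z}"

definition homogeneous_ideal ::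
    "('x \<Rightarrow> complex) set \<Rightarrow> ('x \<Rightarrow> complex) set set \<Rightarrow> (('x \<Rightarrow> complex) \<Rightarrow> complex) set"
  where "homogeneous_ideal V Z = fun_space.span (\<Union>d. ideal_part V Z d)"

definition generated_ideal ::
    "('x \<Rightarrow> complex) set \<Rightarrow> (('x \<Rightarrow> complex) \<Rightarrow> complex) set \<Rightarrow> (('x \<Rightarrow> complex) \<Rightarrow> complex) set"
  where "generated_ideal V F = fun_space.span {g * f | g f. g \<in> sym_algebra V \<and> f \<in> F}"

section \<open>The Segre variety\<close>

definition tensor_space ::
    "(complex \<Rightarrow> 'a \<Rightarrow> 'a::ab_group_add) \<Rightarrow> (complex \<Rightarrow> 'b \<Rightarrow> 'b::ab_group_add)
      \<Rightarrow> (complex \<Rightarrow> 'c \<Rightarrow> 'c::ab_group_add) \<Rightarrow> ('a \<times> 'b \<times> 'c \<Rightarrow> complex) set"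
  where "tensor_space sA sB sC = tensor3 (dual sA) (dual sB) (dual sC)"

definition segre ::
    "(complex \<Rightarrow> 'a \<Rightarrow> 'a::ab_group_add) \<Rightarrow> (complex \<Rightarrow> 'b \<Rightarrow> 'b::ab_group_add)
      \<Rightarrow> (complex \<Rightarrow> 'c \<Rightarrow> 'c::ab_group_add) \<Rightarrow> ('a \<times> 'b \<times> 'c \<Rightarrow> complex) set set"
  where "segre sA sB sC =
    {fun_space.span {tprod \<alpha> \<beta> \<gamma>} | \<alpha> \<beta> \<gamma>.
       \<alpha> \<in> dual sA - {0} \<and> \<beta> \<in> dual sB - {0} \<and> \<gamma> \<in> dual sC - {0}}"

section \<open>Schur functors\<close>

text \<open>
  The tensor power of a vector space is embedded in the space of functions on \<open>d\<close>-tuples of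
  linear forms: \<open>v\<^sub>0 \<otimes> \<dots> \<otimes> v\<^bsub>d-1\<^esub>\<close> is the function mapping \<open>\<phi>\<close> to the product
  of the \<open>\<phi> i (v i)\<close>.
\<close>

definition tensor_power ::
    "(complex \<Rightarrow> 'v \<Rightarrow> 'v::ab_group_add) \<Rightarrow> nat \<Rightarrow> ((nat \<Rightarrow> 'v \<Rightarrow> complex) \<Rightarrow> complex) set"
  where "tensor_power s d =
    fun_space.span (range (\<lambda>(v :: nat \<Rightarrow> 'v) \<phi>.
      if \<forall>i<d. \<phi> i \<in> dual s then \<Prod>i<d. \<phi> i (v i) else 0))"

text \<open>
  A partition is the list of its parts. In its canonical tableau the numbers
  \<open>0, 1, 2, \<dots>\<close> are entered row by row.
\<close>

definition row_of :: "nat list \<Rightarrow> nat \<Rightarrow> nat"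
  where "row_of \<pi> i = (LEAST r. i < sum_list (take (Suc r) \<pi>))"

definition col_of :: "nat list \<Rightarrow> nat \<Rightarrow> nat"
  where "col_of \<pi> i = i - sum_list (take (row_of \<pi> i) \<pi>)"

definition row_group :: "nat list \<Rightarrow> (nat \<Rightarrow> nat) set"
  where "row_group \<pi> = {p. p permutes {..<sum_list \<pi>} \<and> (\<forall>i<sum_list \<pi>. row_of \<pi> (p i) = row_of \<pi> i)}"

definition col_group :: "nat list \<Rightarrow> (nat \<Rightarrow> nat) set"
  where "col_group \<pi> = {q. q permutes {..<sum_list \<pi>} \<and> (\<forall>i<sum_list \<pi>. col_of \<pi> (q i) = col_of \<pi> i)}"

text \<open>
  The place permutation by \<open>\<sigma>\<close> is the left action sending a tensor \<open>t\<close> to the function mapping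
  \<open>\<phi>\<close> to \<open>t (\<phi> \<circ> \<sigma>)\<close>: the vector at place \<open>i\<close> moves to place \<open>\<sigma> i\<close>.
\<close>

definition young_symmetrizer ::
    "nat list \<Rightarrow> ((nat \<Rightarrow> 'v \<Rightarrow> complex) \<Rightarrow> complex) \<Rightarrow> (nat \<Rightarrow> 'v \<Rightarrow> complex) \<Rightarrow> complex"
  where "young_symmetrizer \<pi> t =
    (\<lambda>\<phi>. \<Sum>p\<in>row_group \<pi>. \<Sum>q\<in>col_group \<pi>. of_int (sign q) * t (\<phi> \<circ> (p \<circ> q)))"

definition schur ::
    "nat list \<Rightarrow> (complex \<Rightarrow> 'v \<Rightarrow> 'v::ab_group_add) \<Rightarrow> ((nat \<Rightarrow> 'v \<Rightarrow> complex) \<Rightarrow> complex) set"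
  where "schur \<pi> s = young_symmetrizer \<pi> ` tensor_power s (sum_list \<pi>)"

section \<open>Submodules of the symmetric powers\<close>

definition GL3 ::
    "(complex \<Rightarrow> 'a \<Rightarrow> 'a::ab_group_add) \<Rightarrow> (complex \<Rightarrow> 'b \<Rightarrow> 'b::ab_group_add)
      \<Rightarrow> (complex \<Rightarrow> 'c \<Rightarrow> 'c::ab_group_add) \<Rightarrow> (('a \<Rightarrow> 'a) \<times> ('b \<Rightarrow> 'b) \<times> ('c \<Rightarrow> 'c)) set"
  where "GL3 sA sB sC = GL sA \<times> GL sB \<times> GL sC"

text \<open>
  Both actions are induced by the tautological actions on \<open>A\<close>, \<open>B\<close>, \<open>C\<close>. The first one maps
  the product of the \<open>a\<^sub>i \<otimes> b\<^sub>i \<otimes> c\<^sub>i\<close> to the product of the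
  \<open>g a\<^sub>i \<otimes> h b\<^sub>i \<otimes> k c\<^sub>i\<close>, and the second one applies \<open>g\<close>, \<open>h\<close>, \<open>k\<close> to the
  factors of the tensor powers of \<open>A\<close>, \<open>B\<close>, \<open>C\<close>.
\<close>

definition act_sym ::
    "('a \<Rightarrow> 'a) \<times> ('b \<Rightarrow> 'b) \<times> ('c \<Rightarrow> 'c) \<Rightarrow> (('a \<times> 'b \<times> 'c \<Rightarrow> complex) \<Rightarrow> complex)
      \<Rightarrow> ('a \<times> 'b \<times> 'c \<Rightarrow> complex) \<Rightarrow> complex"
  where "act_sym = (\<lambda>(g, h, k) f T. f (\<lambda>(a, b, c). T (g a, h b, k c)))"

definition act_tensor ::
    "('a \<Rightarrow> 'a) \<times> ('b \<Rightarrow> 'b) \<times> ('c \<Rightarrow> 'c)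
      \<Rightarrow> ((nat \<Rightarrow> 'a \<Rightarrow> complex) \<times> (nat \<Rightarrow> 'b \<Rightarrow> complex) \<times> (nat \<Rightarrow> 'c \<Rightarrow> complex) \<Rightarrow> complex)
      \<Rightarrow> (nat \<Rightarrow> 'a \<Rightarrow> complex) \<times> (nat \<Rightarrow> 'b \<Rightarrow> complex) \<times> (nat \<Rightarrow> 'c \<Rightarrow> complex) \<Rightarrow> complex"
  where "act_tensor =
    (\<lambda>(g, h, k) t (\<phi>, \<psi>, \<chi>). t (\<lambda>i. \<phi> i \<circ> g, \<lambda>i. \<psi> i \<circ> h, \<lambda>i. \<chi> i \<circ> k))"

definition equivariant_iso ::
    "'g set \<Rightarrow> ('g \<Rightarrow> ('x \<Rightarrow> complex) \<Rightarrow> 'x \<Rightarrow> complex) \<Rightarrow> ('x \<Rightarrow> complex) set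
      \<Rightarrow> ('g \<Rightarrow> ('y \<Rightarrow> complex) \<Rightarrow> 'y \<Rightarrow> complex) \<Rightarrow> ('y \<Rightarrow> complex) set
      \<Rightarrow> (('x \<Rightarrow> complex) \<Rightarrow> 'y \<Rightarrow> complex) \<Rightarrow> bool"
  where "equivariant_iso G \<rho> N \<rho>' M \<Phi> \<longleftrightarrow>
    bij_betw \<Phi> N M \<and>
    (\<forall>x\<in>N. \<forall>y\<in>N. \<Phi> (x + y) = \<Phi> x + \<Phi> y) \<and>
    (\<forall>k. \<forall>x\<in>N. \<Phi> (fscale k x) = fscale k (\<Phi> x)) \<and>
    (\<forall>g\<in>G. \<forall>x\<in>N. \<Phi> (\<rho> g x) = \<rho>' g (\<Phi> x))"

text \<open>
  \<open>M\<close> is a submodule of the \<open>d\<close>-th symmetric power of \<open>A \<otimes> B \<otimes> C\<close> which is isomorphic,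
  as a module over \<open>GL(A) \<times> GL(B) \<times> GL(C)\<close>, to the tensor product of the three Schur modules.
  If the symmetric power is multiplicity free, there is at most one such \<open>M\<close>, and it is this
  submodule that the expression \<open>S\<^sub>\<pi> A \<otimes> S\<^sub>\<mu> B \<otimes> S\<^sub>\<nu> C\<close> denotes.
\<close>

definition is_schur_submodule ::
    "(complex \<Rightarrow> 'a \<Rightarrow> 'a::ab_group_add) \<Rightarrow> (complex \<Rightarrow> 'b \<Rightarrow> 'b::ab_group_add)
      \<Rightarrow> (complex \<Rightarrow> 'c \<Rightarrow> 'c::ab_group_add) \<Rightarrow> nat \<Rightarrow> nat list \<Rightarrow> nat list \<Rightarrow> nat list
      \<Rightarrow> (('a \<times> 'b \<times> 'c \<Rightarrow> complex) \<Rightarrow> complex) set \<Rightarrow> bool"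
  where "is_schur_submodule sA sB sC d \<pi> \<mu> \<nu> M \<longleftrightarrow>
    fun_space.subspace M \<and>
    M \<subseteq> sym_power (tensor_space sA sB sC) d \<and>
    (\<forall>g\<in>GL3 sA sB sC. act_sym g ` M \<subseteq> M) \<and>
    (\<exists>\<Phi>. equivariant_iso (GL3 sA sB sC)
       act_tensor (tensor3 (schur \<pi> sA) (schur \<mu> sB) (schur \<nu> sC)) act_sym M \<Phi>)"

definition is_direct_sum ::
    "('x \<Rightarrow> complex) set \<Rightarrow> ('x \<Rightarrow> complex) set \<Rightarrow> ('x \<Rightarrow> complex) set \<Rightarrow> bool"
  where "is_direct_sum N M\<^sub>1 M\<^sub>2 \<longleftrightarrow> N = {x + y | x y. x \<in> M\<^sub>1 \<and> y \<in> M\<^sub>2} \<and> M\<^sub>1 \<inter> M\<^sub>2 = {0}"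

end

theory Submission
  imports Defs "HOL-Library.FuncSet" "HOL-Library.Multiset"
    "Jordan_Normal_Form.Jordan_Normal_Form_Existence" "Jordan_Normal_Form.Spectral_Radius"
begin

text \<open>
  In coordinates a tensor is a 4 by 6 matrix, the flattening \<open>C \<rightarrow> A\<^sup>* \<otimes> B\<^sup>*\<close>. A generic pencil of
  square matrices is diagonalizable, so the sums of \<open>n\<close> decomposable tensors are dense in the
  2 by \<open>n\<close> by \<open>n\<close> tensors; with \<open>n = 3\<close> this identifies the cone over \<open>\<sigma>\<^sub>3(X)\<close> with the matrices of
  rank at most 3, and with \<open>n = 4\<close> it shows that \<open>\<sigma>\<^sub>4(X)\<close> is the whole space.

  A polynomial vanishing on the matrices of rank at most 3 lies in the ideal of the maximal minors.
  For a diagonal term order this follows by induction on the leading monomial, once it is known to be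
  divisible by the leading monomial of a minor. Otherwise its variables avoid every diagonal, and
  there is a curve \<open>x(s)\<close> of matrices of rank at most 3 such that \<open>x\<^sub>p(s) / s^w(p)\<close>, for the weights
  \<open>w\<close> defining the term order, tends to 1 on these variables as \<open>s\<close> tends to infinity;
  along it the leading term cannot be cancelled by the others.

  So the degree 4 part of the ideal is the span of the 15 minors, that is
  \<open>\<Lambda>\<^sup>4(A \<otimes> B) \<otimes> \<Lambda>\<^sup>4 C\<close>. The tensor products of Schur modules are spanned by 9 and by 6
  elements. Their images under one equivariant contraction span the 15 minors, so the contraction
  is injective on both modules and the sum of the images is direct.
\<close>

section \<open>Linear algebra in spaces of functions\<close>

text \<open>The count is 3 * 3 * 1 + 1 * 6 * 1 = 9 + 6 = 15, the number of 4-element sets of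
  columns; the dimension 6 is attached to the second summand, and 15 to the whole degree 4 part. The
  obstacle is that two convenient sets are only dense in the rank locus. A 2 by 3 by 3 tensor need
  not be a sum of three decomposable tensors, because a pencil may have a nontrivial Jordan block,
  and low rank does not force row 3 to depend on rows 0 to 2. The first gap is closed by continuity
  along complex lines. The second does not arise, because the degenerating curve stays in the chart
  where row 3 depends on the others. Testing polynomials on such curves stands in for the primality
  of the determinantal ideal: it shows directly that the minors are a Groebner basis of the
  vanishing ideal. The Schur modules are treated without characters or highest weights: only upper
  bounds for spanning sets are proved, and the independence of the 15 minors makes them
  exact.\<close>

abbreviation lspan :: "('x \<Rightarrow> complex) set \<Rightarrow> ('x \<Rightarrow> complex) set"
  where "lspan \<equiv> fun_space.span"

lemma sum_fun_apply: "(\<Sum>i\<in>A. F i) x = (\<Sum>i\<in>A. F i x)"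
  by (induction A rule: infinite_finite_induct) auto

lemma fscale_apply: "fscale k f x = k * f x"
  by (simp add: fscale_def)

lemma span_mult:
  fixes S S' :: "('x \<Rightarrow> complex) set"
  assumes "f \<in> lspan S" and "g \<in> lspan S'"
    and "\<And>x y. x \<in> S \<Longrightarrow> y \<in> S' \<Longrightarrow> x * y \<in> lspan R"
  shows "f * g \<in> lspan R"
  using assms(1)
proof (induction rule: fun_space.span_induct_alt)
  case base
  have "(0 :: 'x \<Rightarrow> complex) * g = 0" by (simp add: fun_eq_iff)
  then show ?case using fun_space.span_zero by metis
next
  case (step c x y)
  have "x * g \<in> lspan R"
    using assms(2)
  proof (induction rule: fun_space.span_induct_alt)
    case base
    have "x * (0 :: 'x \<Rightarrow> complex) = 0" by (simp add: fun_eq_iff)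
    then show ?case using fun_space.span_zero by metis
  next
    case (step c' x' y')
    have "x * (fscale c' x' + y') = fscale c' (x * x') + x * y'"
      by (simp add: fun_eq_iff fscale_apply algebra_simps)
    moreover have "x * x' \<in> lspan R" using assms(3) \<open>x \<in> S\<close> \<open>x' \<in> S'\<close> .
    ultimately show ?case
      using fun_space.span_add fun_space.span_scale step.IH by metis
  qed
  moreover have "(fscale c x + y) * g = fscale c (x * g) + y * g"
    by (simp add: fun_eq_iff fscale_apply algebra_simps)
  ultimately show ?case
    using fun_space.span_add fun_space.span_scale step.IH by metis
qed

text \<open>If some \<open>x\<close> in \<open>S\<close> were redundant, \<open>S - {x}\<close>
  would span a space containing the larger independent set \<open>B\<close>, against the exchange
  bound. This transfers the independence of the minors to the contracted tensors.\<close>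

lemma independent_if_span_contains:
  fixes S B :: "('x \<Rightarrow> complex) set"
  assumes "finite S" and "fun_space.independent B" and "B \<subseteq> lspan S"
    and "card S \<le> card B"
  shows "fun_space.independent S"
proof (rule ccontr)
  assume "\<not> fun_space.independent S"
  then obtain x where x: "x \<in> S" "x \<in> lspan (S - {x})"
    unfolding fun_space.dependent_def by auto
  then have "lspan S = lspan (S - {x})"
    by (metis fun_space.span_redundant insert_Diff)
  then have "card B \<le> card (S - {x})"
    using fun_space.independent_span_bound[of "S - {x}" B] assms by auto
  moreover have "card (S - {x}) < card S"
    using x(1) assms(1) by (rule card_Diff1_less[rotated])
  ultimately show False using assms(4) by simp
qed

text \<open>A common vector has an expansion over each set; their difference is a relation on the
  union, so all coefficients vanish.\<close>

lemma span_Int_of_independent_Un: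
  fixes E E' :: "('x \<Rightarrow> complex) set"
  assumes "finite E" "finite E'" and ind: "fun_space.independent (E \<union> E')" and "E \<inter> E' = {}"
  shows "lspan E \<inter> lspan E' = {0}"
proof -
  have "x = 0" if x: "x \<in> lspan E" "x \<in> lspan E'" for x
  proof -
    obtain u where u: "x = (\<Sum>v\<in>E. fscale (u v) v)"
      using x(1) fun_space.span_finite[OF assms(1)] by auto
    obtain w where w: "x = (\<Sum>v\<in>E'. fscale (w v) v)"
      using x(2) fun_space.span_finite[OF assms(2)] by auto
    define z where "z v = (if v \<in> E then u v else - w v)" for v
    have "(\<Sum>v\<in>E \<union> E'. fscale (z v) v) = (\<Sum>v\<in>E. fscale (z v) v) + (\<Sum>v\<in>E'. fscale (z v) v)"
      using assms by (intro sum.union_disjoint) auto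
    also have "(\<Sum>v\<in>E. fscale (z v) v) = x"
      unfolding u by (intro sum.cong) (auto simp: z_def)
    also have "(\<Sum>v\<in>E'. fscale (z v) v) = (\<Sum>v\<in>E'. - fscale (w v) v)"
      using assms(4) by (intro sum.cong) (auto simp: z_def fun_eq_iff fscale_apply)
    also have "\<dots> = - x"
      unfolding w by (simp add: sum_negf)
    finally have "(\<Sum>v\<in>E \<union> E'. fscale (z v) v) = 0" unfolding add.right_inverse .
    then have z0: "z v = 0" if "v \<in> E \<union> E'" for v
      using fun_space.independentD[OF ind, of "E \<union> E'" z v] assms that by auto
    have "u v = 0" if "v \<in> E" for v
    proof -
      have "z v = 0" using z0 that by blast
      then show ?thesis using that by (simp add: z_def)
    qed
    then show "x = 0"
      unfolding u by (simp add: fun_eq_iff fscale_apply sum_fun_apply)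
  qed
  then show ?thesis by (auto simp: fun_space.span_zero)
qed

section \<open>Coordinates\<close>

text \<open>A basis with its dual basis; \<open>e\<close> and \<open>\<epsilon>\<close> are total
  functions on \<open>nat\<close>, constrained only below \<open>n\<close>.\<close>

locale coord_space =
  fixes s :: "complex \<Rightarrow> 'v \<Rightarrow> 'v::ab_group_add" and n :: nat
    and e :: "nat \<Rightarrow> 'v" and \<epsilon> :: "nat \<Rightarrow> 'v \<Rightarrow> complex"
  assumes vs: "vector_space s"
    and coord_dual: "i < n \<Longrightarrow> \<epsilon> i \<in> dual s"
    and coord_basis: "i < n \<Longrightarrow> j < n \<Longrightarrow> \<epsilon> i (e j) = (if i = j then 1 else 0)"
    and expansion: "v = (\<Sum>i<n. s (\<epsilon> i v) (e i))"

lemma coord_space_exists: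
  fixes s :: "complex \<Rightarrow> 'v \<Rightarrow> 'v::ab_group_add"
  assumes "vector_space s" and "vector_space.dim s (UNIV :: 'v set) = n" and "n > 0"
  shows "\<exists>e \<epsilon>. coord_space s n e \<epsilon>"
proof -
  interpret vector_space s by fact
  interpret p: vector_space_pair s "(*) :: complex \<Rightarrow> complex \<Rightarrow> complex"
    by unfold_locales (auto simp: algebra_simps)
  obtain B where B: "independent B" "UNIV \<subseteq> span B" "card B = n"
    using basis_exists[of "UNIV :: 'v set"] assms(2) by metis
  \<comment> \<open>An infinite \<open>B\<close> would have \<open>card B = 0\<close>, so
    \<open>n > 0\<close> makes it finite.\<close>
  then have fin: "finite B" using assms(3) by (meson card_gt_0_iff)
  then obtain e where e: "bij_betw e {..<n} B"
    using B(3) ex_bij_betw_nat_finite[of B] by (auto simp: atLeast0LessThan)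
  define \<epsilon> where "\<epsilon> i = p.construct B (\<lambda>b. if b = e i then 1 else 0)" for i
  have eB: "e i \<in> B" if "i < n" for i using e that by (auto simp: bij_betw_def)
  have inj: "e i = e j \<longleftrightarrow> i = j" if "i < n" "j < n" for i j
    using e that by (auto simp: bij_betw_def inj_on_def)
  have dual: "Vector_Spaces.linear s (*) (\<epsilon> i)" for i
    unfolding \<epsilon>_def by (rule p.linear_construct[OF B(1)])
  have basis: "\<epsilon> i (e j) = (if i = j then 1 else 0)" if "i < n" "j < n" for i j
    using inj[OF that(2,1)] eB[OF that(2)] by (simp add: \<epsilon>_def p.construct_basis[OF B(1)] eq_commute)
  have "v = (\<Sum>i<n. s (\<epsilon> i v) (e i))" for v
  proof -
    have "v \<in> span B" using B(2) by auto
    then obtain u where u: "v = (\<Sum>b\<in>B. s (u b) b)"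
      using span_finite[OF fin] by auto
    then have v: "v = (\<Sum>j<n. s (u (e j)) (e j))"
      using sum.reindex_bij_betw[OF e, of "\<lambda>b. s (u b) b"] by simp
    have "\<epsilon> i v = u (e i)" if "i < n" for i
    proof -
      interpret l: Vector_Spaces.linear s "(*)" "\<epsilon> i" by (rule dual)
      have "\<epsilon> i v = (\<Sum>j<n. u (e j) * \<epsilon> i (e j))"
        unfolding v by (simp add: l.sum l.scale)
      also have "\<dots> = (\<Sum>j<n. if j = i then u (e j) else 0)"
        using that by (intro sum.cong) (auto simp: basis)
      finally show ?thesis using that by simp
    qed
    then have "(\<Sum>i<n. s (\<epsilon> i v) (e i)) = (\<Sum>i<n. s (u (e i)) (e i))"
      by (intro sum.cong) auto
    then show ?thesis by (rule trans[OF v sym])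
  qed
  then have "coord_space s n e \<epsilon>"
    using assms(1) dual basis by unfold_locales (auto simp: dual_def)
  then show ?thesis by blast
qed

lemma dual_linear: "\<phi> \<in> dual s \<Longrightarrow> Vector_Spaces.linear s (*) \<phi>"
  by (simp add: dual_def)

lemma dual_add: "\<phi> \<in> dual s \<Longrightarrow> \<phi> (u + v) = \<phi> u + \<phi> v"
  using Vector_Spaces.linear.axioms(3)[OF dual_linear] module_hom.add by blast

lemma dual_scale: "\<phi> \<in> dual s \<Longrightarrow> \<phi> (s k v) = k * \<phi> v"
  using Vector_Spaces.linear.axioms(3)[OF dual_linear] module_hom.scale by blast

lemma dual_sum: "\<phi> \<in> dual s \<Longrightarrow> \<phi> (\<Sum>i\<in>A. f i) = (\<Sum>i\<in>A. \<phi> (f i))"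
  using Vector_Spaces.linear.axioms(3)[OF dual_linear] module_hom.sum by blast

lemma dualI:
  assumes "vector_space s" and "\<And>u v. \<phi> (u + v) = \<phi> u + \<phi> v" and "\<And>k v. \<phi> (s k v) = k * \<phi> v"
  shows "\<phi> \<in> dual s"
proof -
  have "vector_space ((*) :: complex \<Rightarrow> complex \<Rightarrow> complex)"
    by unfold_locales (auto simp: algebra_simps)
  then show ?thesis
    using assms by (simp add: dual_def Vector_Spaces.linear_iff)
qed

lemma subspace_dual:
  assumes "vector_space s"
  shows "fun_space.subspace (dual s)"
  using assms unfolding fun_space.subspace_def
  by (auto intro!: dualI simp: dual_add dual_scale fscale_apply algebra_simps)

lemma (in coord_space) dual_expansion:
  "\<phi> \<in> dual s \<Longrightarrow> \<phi> v = (\<Sum>i<n. \<epsilon> i v * \<phi> (e i))"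
  by (subst expansion[of v]) (simp add: dual_sum dual_scale)

definition box :: "(nat \<times> nat) set"
  where "box = {..<4} \<times> {..<6}"

lemma finite_box [simp]: "finite box"
  by (simp add: box_def)

lemma sum_div_mod_3:
  fixes F :: "nat \<Rightarrow> nat \<Rightarrow> complex"
  shows "(\<Sum>j<6. F (j div 3) (j mod 3)) = (\<Sum>i<2. \<Sum>j<3. F i j)"
proof -
  have "{..<6} = {0, 1, 2, 3, 4, 5::nat}" "{..<3} = {0, 1, 2::nat}" "{..<2} = {0, 1::nat}" by auto
  then show ?thesis by (simp add: numeral_2_eq_2)
qed

text \<open>
  In coordinates, a tensor is a 4 by 6 matrix whose rows are indexed by the basis of \<open>C\<close> and whose
  columns \<open>j\<close> are indexed by the basis elements \<open>a\<^bsub>j div 3\<^esub> \<otimes> b\<^bsub>j mod 3\<^esub>\<close> of \<open>A \<otimes> B\<close>.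
\<close>

locale tensor_coords =
  A: coord_space sA 2 a \<alpha> + B: coord_space sB 3 b \<beta> + C: coord_space sC 4 c \<gamma>
  for sA :: "complex \<Rightarrow> 'a \<Rightarrow> 'a::ab_group_add" and a \<alpha>
    and sB :: "complex \<Rightarrow> 'b \<Rightarrow> 'b::ab_group_add" and b \<beta>
    and sC :: "complex \<Rightarrow> 'c \<Rightarrow> 'c::ab_group_add" and c \<gamma>
begin

abbreviation V :: "('a \<times> 'b \<times> 'c \<Rightarrow> complex) set"
  where "V \<equiv> tensor_space sA sB sC"

definition crd :: "('a \<times> 'b \<times> 'c \<Rightarrow> complex) \<Rightarrow> nat \<times> nat \<Rightarrow> complex"
  where "crd T p = T (a (snd p div 3), b (snd p mod 3), c (fst p))"

definition basis_tensor :: "nat \<times> nat \<Rightarrow> 'a \<times> 'b \<times> 'c \<Rightarrow> complex"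
  where "basis_tensor p = tprod (\<alpha> (snd p div 3)) (\<beta> (snd p mod 3)) (\<gamma> (fst p))"

definition tens :: "(nat \<times> nat \<Rightarrow> complex) \<Rightarrow> 'a \<times> 'b \<times> 'c \<Rightarrow> complex"
  where "tens x = (\<Sum>p\<in>box. fscale (x p) (basis_tensor p))"

lemma subspace_V: "fun_space.subspace V"
  by (simp add: tensor_space_def tensor3_def fun_space.subspace_span)

lemma tprod_in_V: "\<phi> \<in> dual sA \<Longrightarrow> \<psi> \<in> dual sB \<Longrightarrow> \<chi> \<in> dual sC \<Longrightarrow> tprod \<phi> \<psi> \<chi> \<in> V"
  unfolding tensor_space_def tensor3_def by (intro fun_space.span_base) blast

lemma basis_tensor_in_V: "p \<in> box \<Longrightarrow> basis_tensor p \<in> V"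
  unfolding basis_tensor_def by (intro tprod_in_V A.coord_dual B.coord_dual C.coord_dual)
    (auto simp: box_def)

lemma tens_in_V [simp]: "tens x \<in> V"
  unfolding tens_def using subspace_V basis_tensor_in_V
  by (auto intro!: fun_space.subspace_sum fun_space.subspace_scale)

lemma crd_basis_tensor:
  assumes "p \<in> box" "q \<in> box"
  shows "crd (basis_tensor p) q = (if p = q then 1 else 0)"
proof -
  have "snd p = snd q" if "snd p div 3 = snd q div 3" "snd p mod 3 = snd q mod 3"
    using that by (metis div_mult_mod_eq)
  then show ?thesis
    using assms by (auto simp: crd_def basis_tensor_def tprod_def box_def
        A.coord_basis B.coord_basis C.coord_basis prod_eq_iff less_mult_imp_div_less)
qed

lemma crd_add: "crd (S + T) p = crd S p + crd T p"
  and crd_fscale: "crd (fscale k T) p = k * crd T p"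
  and crd_zero: "crd 0 p = 0"
  by (simp_all add: crd_def fscale_apply)

lemma crd_sum: "crd (\<Sum>i\<in>I. F i) p = (\<Sum>i\<in>I. crd (F i) p)"
  by (simp add: crd_def sum_fun_apply)

lemma crd_tens: "p \<in> box \<Longrightarrow> crd (tens x) p = x p"
  by (simp add: tens_def crd_sum crd_fscale crd_basis_tensor if_distrib cong: if_cong)

text \<open>Both sides are linear in \<open>T\<close>, so decomposable \<open>T\<close> suffices;
  there the sum over the matrix entries splits into the dual basis expansions of the three
  factors.\<close>

lemma tens_crd:
  assumes "T \<in> V"
  shows "tens (crd T) = T"
  using assms unfolding tensor_space_def tensor3_def
proof (induction rule: fun_space.span_induct_alt)
  case base
  show ?case unfolding tens_def crd_zero by (simp add: fun_eq_iff fscale_apply sum_fun_apply)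
next
  case (step k T S)
  then obtain \<phi> \<psi> \<chi> where T: "T = tprod \<phi> \<psi> \<chi>" "\<phi> \<in> dual sA" "\<psi> \<in> dual sB" "\<chi> \<in> dual sC"
    by blast
  have "tens (crd T) (u, v, w) = T (u, v, w)" for u v w
  proof -
    define F where "F i j = \<alpha> i u * \<phi> (a i) * (\<beta> j v * \<psi> (b j))" for i j
    have "tens (crd T) (u, v, w) = (\<Sum>k<4. \<Sum>j<6. \<gamma> k w * \<chi> (c k) * F (j div 3) (j mod 3))"
      by (simp add: tens_def sum_fun_apply fscale_apply box_def sum.cartesian_product T(1) crd_def
          tprod_def basis_tensor_def F_def mult_ac split_beta)
    also have "\<dots> = (\<Sum>k<4. \<gamma> k w * \<chi> (c k)) * (\<Sum>j<6. F (j div 3) (j mod 3))"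
      by (simp only: sum_product)
    also have "(\<Sum>j<6. F (j div 3) (j mod 3)) = \<phi> u * \<psi> v"
      unfolding sum_div_mod_3[of F] unfolding F_def A.dual_expansion[OF T(2), of u] B.dual_expansion[OF T(3), of v]
      by (simp only: sum_product)
    also have "(\<Sum>k<4. \<gamma> k w * \<chi> (c k)) = \<chi> w"
      by (rule C.dual_expansion[OF T(4), symmetric])
    finally show ?thesis by (simp add: T(1) tprod_def)
  qed
  then have "tens (crd T) = T" by (simp add: fun_eq_iff)
  moreover have "tens (crd (fscale k T + S)) = fscale k (tens (crd T)) + tens (crd S)"
    by (simp add: tens_def crd_add crd_fscale fun_eq_iff sum_fun_apply fscale_apply algebra_simps
        sum.distrib sum_distrib_left)
  ultimately show ?case using step.IH by (simp only:)
qed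

lemma V_eqI: "S \<in> V \<Longrightarrow> T \<in> V \<Longrightarrow> (\<And>p. p \<in> box \<Longrightarrow> crd S p = crd T p) \<Longrightarrow> S = T"
  by (subst (1 2) tens_crd[symmetric]) (auto simp: tens_def intro!: sum.cong)

text \<open>Multisets turn the product of monomials into a sum of indices. The value 0 outside
  \<open>V\<close> follows the convention of \<open>sym_power\<close>.\<close>

definition mono :: "(nat \<times> nat) multiset \<Rightarrow> ('a \<times> 'b \<times> 'c \<Rightarrow> complex) \<Rightarrow> complex"
  where "mono \<mu> T = (if T \<in> V then \<Prod>p\<in>#\<mu>. crd T p else 0)"

lemma mono_mult: "mono \<mu> * mono \<nu> = mono (\<mu> + \<nu>)"
  by (simp add: mono_def fun_eq_iff)

text \<open>Evaluation at any point is a linear form in the matrix entries, with the values of the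
  basis tensors as coefficients; a product of \<open>d\<close> such forms expands over all choice
  functions \<open>g\<close>.\<close>

lemma sym_power_eq: "sym_power V d = lspan {mono \<mu> |\<mu>. size \<mu> = d \<and> set_mset \<mu> \<subseteq> box}"
  (is "_ = lspan ?M")
proof
  have "mono \<mu> \<in> sym_power V d" if "size \<mu> = d" "set_mset \<mu> \<subseteq> box" for \<mu>
  proof -
    obtain ps where ps: "mset ps = \<mu>" using ex_mset by blast
    then have len: "length ps = d" using that(1) by auto
    define x where "x i = (a (snd (ps ! i) div 3), b (snd (ps ! i) mod 3), c (fst (ps ! i)))" for i
    have "(\<Prod>p\<in>#\<mu>. crd T p) = (\<Prod>i<d. T (x i))" for T
    proof -
      have "(\<Prod>p\<in>#\<mu>. crd T p) = prod_list (map (crd T) ps)"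
        unfolding ps[symmetric] by (simp flip: prod_mset_prod_list mset_map)
      also have "\<dots> = (\<Prod>i<d. crd T (ps ! i))"
        by (simp add: prod.list_conv_set_nth len atLeast0LessThan)
      finally show ?thesis by (simp add: crd_def x_def)
    qed
    then have "mono \<mu> = (\<lambda>T. if T \<in> V then \<Prod>i<d. T (x i) else 0)"
      by (simp add: mono_def fun_eq_iff)
    then show ?thesis
      unfolding sym_power_def by (intro fun_space.span_base) blast
  qed
  then show "lspan ?M \<subseteq> sym_power V d"
    unfolding sym_power_def by (intro fun_space.span_minimal) auto
next
  have "(\<lambda>T. if T \<in> V then \<Prod>i<d. T (x i) else 0) \<in> lspan ?M" for x :: "nat \<Rightarrow> 'a \<times> 'b \<times> 'c"
  proof -
    let ?G = "PiE {..<d} (\<lambda>_. box)"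
    have "(if T \<in> V then \<Prod>i<d. T (x i) else 0) =
      (\<Sum>g\<in>?G. fscale (\<Prod>i<d. basis_tensor (g i) (x i)) (mono (image_mset g (mset_set {..<d})))) T" for T
    proof (cases "T \<in> V")
      case True
      have "T y = (\<Sum>p\<in>box. basis_tensor p y * crd T p)" for y
        by (subst tens_crd[OF True, symmetric]) (simp add: tens_def sum_fun_apply fscale_apply mult.commute)
      then have "(\<Prod>i<d. T (x i)) = (\<Prod>i<d. \<Sum>p\<in>box. basis_tensor p (x i) * crd T p)"
        by (intro prod.cong) auto
      also have "\<dots> = (\<Sum>g\<in>?G. \<Prod>i<d. basis_tensor (g i) (x i) * crd T (g i))"
        by (subst prod_sum_PiE) auto
      also have "\<dots> = (\<Sum>g\<in>?G. (\<Prod>i<d. basis_tensor (g i) (x i)) * (\<Prod>i<d. crd T (g i)))"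
        by (simp add: prod.distrib)
      finally show ?thesis
        using True by (simp add: sum_fun_apply fscale_apply mono_def prod_unfold_prod_mset image_mset.compositionality comp_def)
    qed (simp add: sum_fun_apply fscale_apply mono_def)
    then have eq: "(\<lambda>T. if T \<in> V then \<Prod>i<d. T (x i) else 0) =
      (\<Sum>g\<in>?G. fscale (\<Prod>i<d. basis_tensor (g i) (x i)) (mono (image_mset g (mset_set {..<d}))))"
      by (rule ext)
    have "mono (image_mset g (mset_set {..<d})) \<in> ?M" if "g \<in> ?G" for g
    proof -
      have "set_mset (image_mset g (mset_set {..<d})) \<subseteq> box"
        using that by (auto simp: PiE_def Pi_def)
      then show ?thesis by (intro CollectI exI[of _ "image_mset g (mset_set {..<d})"]) simp
    qed
    then show ?thesis
      unfolding eq by (intro fun_space.span_sum fun_space.span_scale fun_space.span_base)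
  qed
  then show "sym_power V d \<subseteq> lspan ?M"
    unfolding sym_power_def by (intro fun_space.span_minimal) auto
qed

lemma mono_in_sym_power: "set_mset \<mu> \<subseteq> box \<Longrightarrow> mono \<mu> \<in> sym_power V (size \<mu>)"
  unfolding sym_power_eq by (intro fun_space.span_base) auto

lemma subspace_sym_power: "fun_space.subspace (sym_power V d)"
  by (simp add: sym_power_def fun_space.subspace_span)

lemma sym_algebra_eq: "sym_algebra V = lspan {mono \<mu> |\<mu>. set_mset \<mu> \<subseteq> box}"
proof
  have "sym_power V d \<subseteq> lspan {mono \<mu> |\<mu>. set_mset \<mu> \<subseteq> box}" for d
    unfolding sym_power_eq by (rule fun_space.span_mono) auto
  then show "sym_algebra V \<subseteq> lspan {mono \<mu> |\<mu>. set_mset \<mu> \<subseteq> box}"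
    unfolding sym_algebra_def by (intro fun_space.span_minimal) (auto simp: fun_space.subspace_span)
  show "lspan {mono \<mu> |\<mu>. set_mset \<mu> \<subseteq> box} \<subseteq> sym_algebra V"
    unfolding sym_algebra_def using mono_in_sym_power by (intro fun_space.span_mono) blast
qed

lemma sym_power_outside: "f \<in> sym_power V d \<Longrightarrow> T \<notin> V \<Longrightarrow> f T = 0"
  unfolding sym_power_eq
  by (induction rule: fun_space.span_induct_alt) (auto simp: mono_def fscale_apply)

end

section \<open>A diagonal weight on matrix entries\<close>

text \<open>Comparison of base \<open>B\<close> digits: fewer than \<open>B\<close> powers, all of
  exponent below \<open>m\<close>, cannot reach \<open>B ^ m\<close>.\<close>

lemma sum_mset_power_less:
  fixes \<mu> :: "nat multiset"
  assumes "\<And>n. n \<in># \<mu> \<Longrightarrow> n < m" and "size \<mu> < B"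
  shows "(\<Sum>n\<in>#\<mu>. B ^ n) < B ^ m"
proof (cases m)
  case 0
  then have "\<mu> = {#}" using assms(1) by (auto intro: multiset_eqI simp: multiset_nonemptyE)
  then show ?thesis using 0 by simp
next
  case (Suc l)
  have "(\<Sum>n\<in>#\<mu>. B ^ n) \<le> size \<mu> * B ^ l"
    using assms(1) unfolding Suc
  proof (induction \<mu>)
    case (add n \<mu>)
    have "B ^ n \<le> B ^ l" using add.prems[of n] assms(2) by (intro power_increasing) auto
    then show ?case using add by fastforce
  qed simp
  also have "\<dots> < B ^ m" using assms(2) by (auto simp: Suc)
  finally show ?thesis .
qed

text \<open>Uniqueness of base \<open>B\<close> expansions, the digits being multiplicities less
  than \<open>B\<close>. After cancelling the common part, the largest remaining exponent occurs on
  one side only, and that side is larger by \<open>sum_mset_power_less\<close>.\<close>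

lemma sum_mset_power_inject:
  fixes \<mu> \<nu> :: "nat multiset"
  assumes "size \<mu> < B" and "size \<nu> < B" and "(\<Sum>n\<in>#\<mu>. B ^ n) = (\<Sum>n\<in>#\<nu>. B ^ n)"
  shows "\<mu> = \<nu>"
proof (rule ccontr)
  assume neq: "\<mu> \<noteq> \<nu>"
  define \<rho> where "\<rho> = \<mu> - \<nu>"
  define \<tau> where "\<tau> = \<nu> - \<mu>"
  have split: "\<mu> = \<rho> + (\<mu> \<inter># \<nu>)" "\<nu> = \<tau> + (\<mu> \<inter># \<nu>)"
    by (auto simp: \<rho>_def \<tau>_def multiset_eq_iff min_def)
  have eq: "(\<Sum>n\<in>#\<rho>. B ^ n) = (\<Sum>n\<in>#\<tau>. B ^ n)"
    using assms(3) by (subst (asm) split(1), subst (asm) split(2)) simp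
  have size: "size \<rho> < B" "size \<tau> < B"
    using assms(1,2) size_mset_mono[of \<rho> \<mu>] size_mset_mono[of \<tau> \<nu>]
    by (auto simp: \<rho>_def \<tau>_def)
  have disj: "n \<in># \<rho> \<Longrightarrow> n \<notin># \<tau>" for n
    by (auto simp: \<rho>_def \<tau>_def in_diff_count)
  have less: False if "m \<in># \<rho>'" "\<And>n. n \<in># \<tau>' \<Longrightarrow> n < m" "size \<tau>' < B"
    "(\<Sum>n\<in>#\<rho>'. B ^ n) = (\<Sum>n\<in>#\<tau>'. B ^ n)" for \<rho>' \<tau>' m
  proof -
    have "(\<Sum>n\<in>#\<tau>'. B ^ n) < B ^ m" using that by (intro sum_mset_power_less)
    also have "B ^ m \<le> (\<Sum>n\<in>#\<rho>'. B ^ n)"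
      using multi_member_split[OF that(1)] by auto
    finally show False using that(4) by simp
  qed
  have "set_mset (\<rho> + \<tau>) \<noteq> {}" using neq split by auto
  define m where "m = Max (set_mset (\<rho> + \<tau>))"
  have m: "m \<in># \<rho> + \<tau>" "\<And>n. n \<in># \<rho> + \<tau> \<Longrightarrow> n \<le> m"
    using Max_in[OF _ \<open>set_mset (\<rho> + \<tau>) \<noteq> {}\<close>] by (auto simp: m_def simp del: set_mset_union)
  show False
  proof (cases "m \<in># \<rho>")
    case True
    moreover have "n < m" if "n \<in># \<tau>" for n
      using m(2)[of n] that True disj[of m] by (auto simp: le_less)
    ultimately show False using less[of m \<rho> \<tau>] size eq by auto
  next
    case False
    then have "m \<in># \<tau>" using m(1) by simp
    moreover have "n < m" if "n \<in># \<rho>" for n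
      using m(2)[of n] that False by (auto simp: le_less)
    ultimately show False using less[of m \<tau> \<rho>] size eq by auto
  qed
qed

text \<open>
  On monomials of degree less than \<open>B\<close>, the order by weight is the lexicographic order for the
  entries read row by row. Columns up to 8 occur because the transversal columns found below may
  lie to the right of the 6 columns of the matrix.
\<close>

definition weight :: "nat \<Rightarrow> nat \<times> nat \<Rightarrow> nat"
  where "weight B p = B ^ (9 * (3 - fst p) + (8 - snd p))"

text \<open>Moving weakly down and to the right, but not staying in place, lowers the exponent by at
  least one.\<close>

lemma weight_dominates:
  assumes "B > 0" "r \<le> r'" "r' < 4" "j \<le> j'" "j' < 9" "(r, j) \<noteq> (r', j')"
  shows "B * weight B (r', j') \<le> weight B (r, j)"
proof -
  have "Suc (9 * (3 - r') + (8 - j')) \<le> 9 * (3 - r) + (8 - j)"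
    using assms(2-) by auto
  then have "B ^ Suc (9 * (3 - r') + (8 - j')) \<le> B ^ (9 * (3 - r) + (8 - j))"
    using assms(1) by (intro power_increasing) auto
  then show ?thesis by (simp add: weight_def)
qed

text \<open>The upper left entry outweighs each off-diagonal one by the factor \<open>B\<close>,
  hence both together. This strict inequality for 2 by 2 exchanges is all that the degeneration uses
  of the weight.\<close>

lemma weight_exchange:
  assumes "B > 2" "r < r'" "r' < 4" "j < j'" "j' < 9"
  shows "weight B (r, j') + weight B (r', j) < weight B (r, j) + weight B (r', j')"
proof -
  have "3 * weight B (r, j') \<le> B * weight B (r, j')" "3 * weight B (r', j) \<le> B * weight B (r', j)"
    using assms(1) by auto
  moreover have "B * weight B (r, j') \<le> weight B (r, j)" "B * weight B (r', j) \<le> weight B (r, j)"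
    using assms by (auto intro!: weight_dominates)
  moreover have "weight B (r', j') > 0" using assms(1) by (simp add: weight_def)
  ultimately show ?thesis by linarith
qed

abbreviation wt :: "nat \<Rightarrow> (nat \<times> nat) multiset \<Rightarrow> nat"
  where "wt B \<mu> \<equiv> \<Sum>p\<in>#\<mu>. weight B p"

text \<open>The term order has no ties: the exponent is a number \<open>9 * x + z\<close> with
  \<open>z \<le> 8\<close>, so it determines the entry, and base \<open>B\<close> expansions are
  unique.\<close>

lemma wt_inject:
  assumes "size \<mu> < B" "size \<nu> < B" "set_mset \<mu> \<subseteq> box" "set_mset \<nu> \<subseteq> box" "wt B \<mu> = wt B \<nu>"
  shows "\<mu> = \<nu>"
proof -
  let ?p = "\<lambda>p :: nat \<times> nat. 9 * (3 - fst p) + (8 - snd p)"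
  have *: "x = x' \<and> z = z'" if "9 * x + z = 9 * x' + z'" "z \<le> 8" "z' \<le> 8" for x x' z z' :: nat
    using that by (cases x x' rule: linorder_cases) simp_all
  have inj: "inj_on ?p box"
    unfolding inj_on_def
  proof (intro ballI impI)
    fix p q assume "p \<in> box" "q \<in> box" "?p p = ?p q"
    then show "p = q"
      using *[of "3 - fst p" "8 - snd p" "3 - fst q" "8 - snd q"] by (auto simp: box_def)
  qed
  have "image_mset ?p \<mu> = image_mset ?p \<nu>"
    using assms by (intro sum_mset_power_inject[of _ B]) (auto simp: weight_def image_mset.compositionality comp_def)
  then show ?thesis
    using assms(3,4) inj by (intro multiset.inj_map_strong[of \<mu> \<nu> ?p]) (auto simp: inj_on_def)
qed

text \<open>This makes the diagonal the leading term of a minor. At the first row \<open>r\<close>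
  that \<open>\<sigma>\<close> moves, the diagonal entry outweighs by the factor \<open>B\<close>
  each of the at most four entries \<open>(i, y (\<sigma> i))\<close> with \<open>i \<ge> r\<close>,
  and \<open>B > 4\<close>.\<close>

lemma wt_diagonal_less:
  assumes "B > 4" and y: "\<And>i j. i < j \<Longrightarrow> j < 4 \<Longrightarrow> y i < y j" "\<And>i. i < 4 \<Longrightarrow> y i < 9"
    and \<sigma>: "\<sigma> permutes {..<4}" "\<sigma> \<noteq> id"
  shows "(\<Sum>r<4. weight B (r, y (\<sigma> r))) < (\<Sum>r<4. weight B (r, y r))"
proof -
  obtain r where r: "\<sigma> r \<noteq> r" "\<And>i. i < r \<Longrightarrow> \<sigma> i = i"
  proof -
    have "\<exists>r. \<sigma> r \<noteq> r" using \<sigma>(2) by (auto simp: fun_eq_iff)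
    then show thesis
      using that[of "LEAST r. \<sigma> r \<noteq> r"] LeastI_ex[of "\<lambda>r. \<sigma> r \<noteq> r"] not_less_Least by blast
  qed
  have "r < 4" using r(1) \<sigma>(1) permutes_not_in[of \<sigma> "{..<4}" r] by auto
  \<comment> \<open>The values below \<open>r\<close> are taken by the indices below
    \<open>r\<close>, so \<open>\<sigma> i \<ge> r\<close> for all others.\<close>
  have big: "\<sigma> i > r" if "i \<ge> r" "i < 4" "i \<noteq> r \<longrightarrow> \<sigma> i \<noteq> r" for i
  proof -
    have "\<sigma> i \<noteq> j" if "j < r" for j
      using r(2)[OF that] \<sigma>(1) that \<open>i \<ge> r\<close> by (metis permutes_inj inj_eq not_le)
    then show ?thesis using that r(1) by (metis linorder_neqE_nat)
  qed
  have \<sigma>4: "\<sigma> i < 4" if "i < 4" for i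
    using permutes_in_image[OF \<sigma>(1), of i] that by simp
  have "B * weight B (i, y (\<sigma> i)) \<le> weight B (r, y r)" if "i \<in> {r..<4}" for i
  proof (cases "\<sigma> i = r")
    case True
    then have "i \<noteq> r" using r(1) by auto
    then show ?thesis using that True assms(1) y(2)[OF \<open>r < 4\<close>] by (intro weight_dominates) auto
  next
    case False
    then have "\<sigma> i > r" using big that by auto
    then have "y r < y (\<sigma> i)" using y(1) \<sigma>4 that by auto
    then show ?thesis using that \<sigma>4 assms(1) y(2) by (intro weight_dominates) auto
  qed
  then have "(\<Sum>i=r..<4. B * weight B (i, y (\<sigma> i))) \<le> (\<Sum>i=r..<4. weight B (r, y r))"
    by (intro sum_mono)
  also have "\<dots> \<le> 4 * weight B (r, y r)" by simp
  also have "\<dots> < B * weight B (r, y r)" using assms(1) by (simp add: weight_def)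
  also have "(\<Sum>i=r..<4. B * weight B (i, y (\<sigma> i))) = B * (\<Sum>i=r..<4. weight B (i, y (\<sigma> i)))"
    by (simp add: sum_distrib_left)
  finally have "(\<Sum>i=r..<4. weight B (i, y (\<sigma> i))) < weight B (r, y r)" by simp
  also have "\<dots> \<le> (\<Sum>i=r..<4. weight B (i, y i))"
    using \<open>r < 4\<close> by (intro member_le_sum) auto
  finally have "(\<Sum>i=r..<4. weight B (i, y (\<sigma> i))) < (\<Sum>i=r..<4. weight B (i, y i))" .
  moreover have "(\<Sum>i<r. weight B (i, y (\<sigma> i))) = (\<Sum>i<r. weight B (i, y i))"
    using r(2) by (intro sum.cong) auto
  moreover have "{..<4} = {..<r} \<union> {r..<4}" using \<open>r < 4\<close> by auto
  ultimately show ?thesis by (simp add: sum.union_disjoint ivl_disj_int)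
qed

section \<open>A degeneration of the matrices of rank at most 3\<close>

lemma tendsto_power_ratio_0:
  assumes "m < n"
  shows "((\<lambda>s. complex_of_real s ^ m / complex_of_real s ^ n) \<longlongrightarrow> 0) at_top"
proof -
  have "((\<lambda>s. of_real (inverse s) ^ (n - m) :: complex) \<longlongrightarrow> of_real 0 ^ (n - m)) at_top"
    by (intro tendsto_intros tendsto_inverse_0_at_top filterlim_ident)
  moreover have "eventually (\<lambda>s. of_real (inverse s) ^ (n - m) = complex_of_real s ^ m / complex_of_real s ^ n) at_top"
    using eventually_gt_at_top[of 0]
  proof eventually_elim
    case (elim s)
    then show ?case
      using assms by (simp add: power_diff field_simps)
  qed
  ultimately show ?thesis
    using assms by (simp add: zero_power tendsto_cong)
qed

text \<open>The Leibniz terms are powers of \<open>s\<close>; the exchange inequalities make the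
  diagonal exponent strictly the largest, so the other five terms vanish in the limit.\<close>

lemma minor3_asymptotics:
  fixes u :: "nat \<Rightarrow> nat \<Rightarrow> nat" and r :: "nat \<Rightarrow> nat"
  defines "t \<equiv> \<lambda>s i l. complex_of_real s ^ u (r i) l"
  assumes "\<And>i i' l l'. i < i' \<Longrightarrow> i' < 3 \<Longrightarrow> l < l' \<Longrightarrow> l' < 3 \<Longrightarrow> u (r i) l' + u (r i') l < u (r i) l + u (r i') l'"
  shows "((\<lambda>s. (t s 0 0 * (t s 1 1 * t s 2 2 - t s 1 2 * t s 2 1)
      - t s 0 1 * (t s 1 0 * t s 2 2 - t s 1 2 * t s 2 0)
      + t s 0 2 * (t s 1 0 * t s 2 1 - t s 1 1 * t s 2 0))
      / complex_of_real s ^ (u (r 0) 0 + u (r 1) 1 + u (r 2) 2)) \<longlongrightarrow> 1) at_top"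
proof -
  let ?N = "u (r 0) 0 + u (r 1) 1 + u (r 2) 2"
  let ?R = "\<lambda>n s. complex_of_real s ^ n / complex_of_real s ^ ?N"
  note a = assms(2)[of 0 1 0 1] assms(2)[of 0 1 1 2] assms(2)[of 1 2 0 1] assms(2)[of 1 2 1 2]
    assms(2)[of 0 2 0 2] assms(2)[of 0 1 0 2] assms(2)[of 1 2 0 2] assms(2)[of 0 2 0 1] assms(2)[of 0 2 1 2]
  have "u (r 0) 0 + u (r 1) 2 + u (r 2) 1 < ?N" "u (r 0) 1 + u (r 1) 0 + u (r 2) 2 < ?N"
    "u (r 0) 1 + u (r 1) 2 + u (r 2) 0 < ?N" "u (r 0) 2 + u (r 1) 0 + u (r 2) 1 < ?N"
    "u (r 0) 2 + u (r 1) 1 + u (r 2) 0 < ?N"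
    using a by simp_all
  note l = this[THEN tendsto_power_ratio_0]
  have "((\<lambda>s. 1 - ?R (u (r 0) 0 + u (r 1) 2 + u (r 2) 1) s - ?R (u (r 0) 1 + u (r 1) 0 + u (r 2) 2) s
     + ?R (u (r 0) 1 + u (r 1) 2 + u (r 2) 0) s + ?R (u (r 0) 2 + u (r 1) 0 + u (r 2) 1) s
     - ?R (u (r 0) 2 + u (r 1) 1 + u (r 2) 0) s) \<longlongrightarrow> 1 - 0 - 0 + 0 + 0 - 0) at_top"
    by (intro tendsto_intros l)
  moreover have "eventually (\<lambda>s. 1 - ?R (u (r 0) 0 + u (r 1) 2 + u (r 2) 1) s - ?R (u (r 0) 1 + u (r 1) 0 + u (r 2) 2) s
     + ?R (u (r 0) 1 + u (r 1) 2 + u (r 2) 0) s + ?R (u (r 0) 2 + u (r 1) 0 + u (r 2) 1) s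
     - ?R (u (r 0) 2 + u (r 1) 1 + u (r 2) 0) s = (t s 0 0 * (t s 1 1 * t s 2 2 - t s 1 2 * t s 2 1)
      - t s 0 1 * (t s 1 0 * t s 2 2 - t s 1 2 * t s 2 0)
      + t s 0 2 * (t s 1 0 * t s 2 1 - t s 1 1 * t s 2 0))
      / complex_of_real s ^ ?N) at_top"
    using eventually_gt_at_top[of 0]
  proof eventually_elim
    case (elim s)
    have "1 = ?R ?N s" using elim by simp
    then show ?case
      unfolding t_def by (simp only: power_add diff_divide_distrib add_divide_distrib algebra_simps)
  qed
  ultimately show ?thesis by (simp add: tendsto_cong)
qed

text \<open>Greedy choice: each \<open>g\<close> is the next column to the right that meets
  \<open>S\<close> in its row, with columns from 6 on as stand-ins when there is none. An entry of
  row 3 to the right of \<open>g2\<close> would complete a diagonal. Thus every column other than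
  these three has a row free of \<open>S\<close>: row 0 left of \<open>g0\<close>, row 1 or 2 in the
  gaps, row 3 right of \<open>g2\<close>.\<close>

lemma exists_transversal_columns:
  assumes "S \<subseteq> box"
    and nodiag: "\<And>y. (\<And>i j. i < j \<Longrightarrow> j < 4 \<Longrightarrow> y i < y j) \<Longrightarrow> \<exists>r<4. (r, y r) \<notin> S"
  obtains g0 g1 g2 where "g0 < g1" "g1 < g2" "g2 < (9 :: nat)"
    "\<And>j. (0, j) \<in> S \<Longrightarrow> g0 \<le> j" "\<And>j. (1, j) \<in> S \<Longrightarrow> j \<le> g0 \<or> g1 \<le> j"
    "\<And>j. (2, j) \<in> S \<Longrightarrow> j \<le> g1 \<or> g2 \<le> j" "\<And>j. (3, j) \<in> S \<Longrightarrow> j \<le> g2"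
proof -
  define P0 where "P0 j \<longleftrightarrow> (0, j) \<in> S \<or> 6 \<le> j" for j
  define g0 where "g0 = (LEAST j. P0 j)"
  define P1 where "P1 j \<longleftrightarrow> g0 < j \<and> ((1, j) \<in> S \<or> 6 \<le> j)" for j
  define g1 where "g1 = (LEAST j. P1 j)"
  define P2 where "P2 j \<longleftrightarrow> g1 < j \<and> ((2, j) \<in> S \<or> 6 \<le> j)" for j
  define g2 where "g2 = (LEAST j. P2 j)"
  have "P0 6" by (simp add: P0_def)
  then have g0: "P0 g0" "\<And>j. P0 j \<Longrightarrow> g0 \<le> j" "g0 \<le> 6"
    unfolding g0_def by (auto intro: LeastI[of P0] Least_le)
  have "P1 7" using g0(3) by (simp add: P1_def)
  then have g1: "P1 g1" "\<And>j. P1 j \<Longrightarrow> g1 \<le> j" "g1 \<le> 7"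
    unfolding g1_def by (auto intro: LeastI[of P1] Least_le)
  have "P2 8" using g1(3) by (simp add: P2_def)
  then have g2: "P2 g2" "\<And>j. P2 j \<Longrightarrow> g2 \<le> j" "g2 \<le> 8"
    unfolding g2_def by (auto intro: LeastI[of P2] Least_le)
  have "j \<le> g2" if "(3, j) \<in> S" for j
  proof (rule ccontr)
    assume "\<not> j \<le> g2"
    moreover have "j < 6" using that assms(1) by (auto simp: box_def)
    \<comment> \<open>Since \<open>g2 < j < 6\<close>, none of the three columns is a
      stand-in.\<close>
    ultimately have *: "(0, g0) \<in> S" "(1, g1) \<in> S" "(2, g2) \<in> S" "g0 < g1" "g1 < g2" "g2 < j"
      using g0(1) g1(1) g2(1) by (auto simp: P0_def P1_def P2_def)
    define y where "y i = [g0, g1, g2, j] ! i" for i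
    have "y i < y i'" if "i < i'" "i' < 4" for i i'
      using that * unfolding y_def by (auto simp: less_Suc_eq numeral_eq_Suc)
    moreover have "(r, y r) \<in> S" if "r < 4" for r
      using that * \<open>(3, j) \<in> S\<close> unfolding y_def by (auto simp: less_Suc_eq numeral_eq_Suc)
    ultimately show False using nodiag[of y] by blast
  qed
  moreover have "g0 < g1" "g1 < g2" using g1(1) g2(1) by (auto simp: P1_def P2_def)
  moreover have "g0 \<le> j" if "(0, j) \<in> S" for j using that by (intro g0) (simp add: P0_def)
  moreover have "j \<le> g0 \<or> g1 \<le> j" if "(1, j) \<in> S" for j
    using that g1(2)[of j] by (cases "g0 < j") (auto simp: P1_def)
  moreover have "j \<le> g1 \<or> g2 \<le> j" if "(2, j) \<in> S" for j
    using that g2(2)[of j] by (cases "g1 < j") (auto simp: P2_def)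
  ultimately show thesis using that[of g0 g1 g2] g2(3) by auto
qed


text \<open>
  The entries in three transversal columns and all but one entry of every other column are prescribed
  powers of \<open>s\<close>. The signed 3 by 3 minors of the transversal columns are the coefficients of a linear
  relation between the rows there, and the remaining entries are chosen to satisfy the same relation.
\<close>

lemma low_rank_degeneration:
  fixes w :: "nat \<times> nat \<Rightarrow> nat"
  assumes w: "\<And>r r' j j'. r < r' \<Longrightarrow> r' < 4 \<Longrightarrow> j < j' \<Longrightarrow> j' < 9 \<Longrightarrow>
      w (r, j') + w (r', j) < w (r, j) + w (r', j')"
    and "S \<subseteq> box"
    and nodiag: "\<And>y. (\<And>i j. i < j \<Longrightarrow> j < 4 \<Longrightarrow> y i < y j) \<Longrightarrow> \<exists>r<4. (r, y r) \<notin> S"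
  obtains x :: "real \<Rightarrow> nat \<times> nat \<Rightarrow> complex" and k :: "real \<Rightarrow> nat \<Rightarrow> complex" and q
  where "eventually (\<lambda>s. \<forall>j<6. x s (3, j) = (\<Sum>r<3. k s r * x s (r, j))) at_top"
    and "\<And>p. p \<in> box \<Longrightarrow> ((\<lambda>s. x s p / complex_of_real s ^ w p) \<longlongrightarrow> q p) at_top"
    and "\<And>p. p \<in> S \<Longrightarrow> q p = 1"
proof -
  obtain g0 g1 g2 where g: "g0 < g1" "g1 < g2" "g2 < 9"
    and S: "\<And>j. (0, j) \<in> S \<Longrightarrow> g0 \<le> j" "\<And>j. (1, j) \<in> S \<Longrightarrow> j \<le> g0 \<or> g1 \<le> j"
      "\<And>j. (2, j) \<in> S \<Longrightarrow> j \<le> g1 \<or> g2 \<le> j" "\<And>j. (3, j) \<in> S \<Longrightarrow> j \<le> g2"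
    using exists_transversal_columns[OF assms(2) nodiag] by metis
  define col where "col l = [g0, g1, g2] ! l" for l
  have col: "col 0 = g0" "col (Suc 0) = g1" "col 2 = g2" by (simp_all add: col_def)
  have col_less: "col l < col l'" "col l' < 9" if "l < l'" "l' < 3" for l l'
    using that g unfolding col_def by (auto simp: less_Suc_eq numeral_eq_Suc)
  define row where "row i m = (if m < i then m else Suc m)" for i m :: nat
  define u where "u r l = w (r, col l)" for r l
  define t where "t s r l = complex_of_real s ^ u r l" for s r l
  define D where "D i = u (row i 0) 0 + u (row i 1) 1 + u (row i 2) 2" for i
  \<comment> \<open>\<open>Cf i\<close> is the cofactor of row \<open>i\<close> for the three
    transversal columns, as \<open>row i\<close> lists the other rows in order; \<open>D i\<close>
    is the exponent of its diagonal term.\<close>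
  define Cf where "Cf i s = (- 1) ^ i *
      (t s (row i 0) 0 * (t s (row i 1) 1 * t s (row i 2) 2 - t s (row i 1) 2 * t s (row i 2) 1)
      - t s (row i 0) 1 * (t s (row i 1) 0 * t s (row i 2) 2 - t s (row i 1) 2 * t s (row i 2) 0)
      + t s (row i 0) 2 * (t s (row i 1) 0 * t s (row i 2) 1 - t s (row i 1) 1 * t s (row i 2) 0))"
    for i s
  have Cf_lim: "((\<lambda>s. Cf i s / complex_of_real s ^ D i) \<longlongrightarrow> (- 1) ^ i) at_top" if "i < 4" for i
  proof -
    have "((\<lambda>s. (- 1) ^ i * ((t s (row i 0) 0 * (t s (row i 1) 1 * t s (row i 2) 2 - t s (row i 1) 2 * t s (row i 2) 1)
      - t s (row i 0) 1 * (t s (row i 1) 0 * t s (row i 2) 2 - t s (row i 1) 2 * t s (row i 2) 0)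
      + t s (row i 0) 2 * (t s (row i 1) 0 * t s (row i 2) 1 - t s (row i 1) 1 * t s (row i 2) 0))
        / complex_of_real s ^ D i)) \<longlongrightarrow> (- 1) ^ i * 1) at_top"
      unfolding D_def t_def
      by (intro tendsto_mult tendsto_const minor3_asymptotics, unfold u_def, rule w)
        (use col_less that in \<open>auto simp: row_def\<close>)
    then show ?thesis by (simp add: Cf_def)
  qed
  have Cf_nz: "eventually (\<lambda>s. Cf i s \<noteq> 0) at_top" if "i < 4" for i
    using tendsto_imp_eventually_ne[OF Cf_lim[OF that], of 0] by (auto elim: eventually_mono)
  have four: "{..<4} = {0, 1, 2, 3 :: nat}" "{..<3} = {0, 1, 2 :: nat}" by auto
  have lessThan_insert: "{..<4} = insert 3 {..<3 :: nat}" by auto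
  \<comment> \<open>Laplace expansion of a 4 by 4 determinant in which the transversal column
    \<open>l\<close> occurs twice.\<close>
  have relation: "(\<Sum>i<4. Cf i s * t s i l) = 0" if "l < 3" for l s
  proof -
    have "l = 0 \<or> l = 1 \<or> l = 2" using that by auto
    then show ?thesis
      by (elim disjE) (simp_all add: four Cf_def row_def numeral_2_eq_2 numeral_3_eq_3 algebra_simps)
  qed
  \<comment> \<open>The row whose entry in a non-transversal column \<open>j\<close> is solved for;
    by the choice of the columns that entry lies outside \<open>S\<close>.\<close>
  define \<rho> where "\<rho> j = (if j < g0 then 0 else if j < g1 then 1 else if j < g2 then 2 else 3 :: nat)" for j
  have \<rho>4: "\<rho> j < 4" for j by (simp add: \<rho>_def)
  define free where "free r j \<longleftrightarrow> j \<in> {g0, g1, g2} \<or> r \<noteq> \<rho> j" for r j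
  define x where "x s p = (if free (fst p) (snd p) then complex_of_real s ^ w p
     else - (\<Sum>i\<in>{..<4} - {\<rho> (snd p)}. Cf i s * complex_of_real s ^ w (i, snd p)) / Cf (\<rho> (snd p)) s)" for s p
  have adjacent: "w (0, c1) + w (1, c0) < w (0, c0) + w (1, c1)" "w (0, c2) + w (1, c1) < w (0, c1) + w (1, c2)"
      "w (0, c3) + w (1, c2) < w (0, c2) + w (1, c3)" "w (1, c1) + w (2, c0) < w (1, c0) + w (2, c1)"
      "w (1, c2) + w (2, c1) < w (1, c1) + w (2, c2)" "w (1, c3) + w (2, c2) < w (1, c2) + w (2, c3)"
      "w (2, c1) + w (3, c0) < w (2, c0) + w (3, c1)" "w (2, c2) + w (3, c1) < w (2, c1) + w (3, c2)"
      "w (2, c3) + w (3, c2) < w (2, c2) + w (3, c3)"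
      if "c0 < c1" "c1 < c2" "c2 < c3" "c3 < 9" for c0 c1 c2 c3
    using that by (auto intro!: w)
  \<comment> \<open>Inserting a further column among the transversal ones gives columns
    \<open>c0\<close> to \<open>c3\<close>. The right sides are the weight of the main diagonal of
    this 4 by 4 submatrix, the left sides are weights of other permutations, compared by adding
    adjacent exchanges.\<close>
  have chain: "w (0, c1) + w (2, c2) + w (3, c3) + w (1, c0) < w (1, c1) + w (2, c2) + w (3, c3) + w (0, c0)"
      "w (0, c1) + w (1, c2) + w (3, c3) + w (2, c0) < w (1, c1) + w (2, c2) + w (3, c3) + w (0, c0)"
      "w (0, c1) + w (1, c2) + w (2, c3) + w (3, c0) < w (1, c1) + w (2, c2) + w (3, c3) + w (0, c0)"
      "w (1, c0) + w (2, c2) + w (3, c3) + w (0, c1) < w (0, c0) + w (2, c2) + w (3, c3) + w (1, c1)"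
      "w (0, c0) + w (1, c2) + w (3, c3) + w (2, c1) < w (0, c0) + w (2, c2) + w (3, c3) + w (1, c1)"
      "w (0, c0) + w (1, c2) + w (2, c3) + w (3, c1) < w (0, c0) + w (2, c2) + w (3, c3) + w (1, c1)"
      "w (1, c0) + w (2, c1) + w (3, c3) + w (0, c2) < w (0, c0) + w (1, c1) + w (3, c3) + w (2, c2)"
      "w (0, c0) + w (2, c1) + w (3, c3) + w (1, c2) < w (0, c0) + w (1, c1) + w (3, c3) + w (2, c2)"
      "w (0, c0) + w (1, c1) + w (2, c3) + w (3, c2) < w (0, c0) + w (1, c1) + w (3, c3) + w (2, c2)"
      "w (1, c0) + w (2, c1) + w (3, c2) + w (0, c3) < w (0, c0) + w (1, c1) + w (2, c2) + w (3, c3)"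
      "w (0, c0) + w (2, c1) + w (3, c2) + w (1, c3) < w (0, c0) + w (1, c1) + w (2, c2) + w (3, c3)"
      "w (0, c0) + w (1, c1) + w (3, c2) + w (2, c3) < w (0, c0) + w (1, c1) + w (2, c2) + w (3, c3)"
      if "c0 < c1" "c1 < c2" "c2 < c3" "c3 < 9" for c0 c1 c2 c3
    using adjacent[OF that] by linarith+
  have D: "D 0 = w (1, g0) + w (2, g1) + w (3, g2)" "D (Suc 0) = w (0, g0) + w (2, g1) + w (3, g2)"
    "D 2 = w (0, g0) + w (1, g1) + w (3, g2)" "D 3 = w (0, g0) + w (1, g1) + w (2, g2)"
    by (simp_all add: D_def u_def row_def col flip: numeral_2_eq_2)
  \<comment> \<open>A cofactor times a prescribed entry of column \<open>j\<close> has smaller order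
    than \<open>s ^ (D (\<rho> j) + w (\<rho> j, j))\<close>, so the solved entry is negligible
    against its own weight.\<close>
  have less: "D i + w (i, j) < D (\<rho> j) + w (\<rho> j, j)"
    if "j < 9" "j \<notin> {g0, g1, g2}" "i < 4" "i \<noteq> \<rho> j" for i j
  proof -
    have i: "i = 0 \<or> i = 1 \<or> i = 2 \<or> i = 3" using \<open>i < 4\<close> by auto
    consider "j < g0" | "g0 < j" "j < g1" | "g1 < j" "j < g2" | "g2 < j"
      using \<open>j \<notin> {g0, g1, g2}\<close> by force
    then show ?thesis
    proof cases
      case 1
      then have "\<rho> j = 0" by (simp add: \<rho>_def)
      then show ?thesis using 1 g i \<open>i \<noteq> \<rho> j\<close> chain[of j g0 g1 g2] by (elim disjE) (simp_all add: D)
    next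
      case 2
      then have "\<rho> j = 1" by (simp add: \<rho>_def)
      then show ?thesis using 2 g i \<open>i \<noteq> \<rho> j\<close> chain[of g0 j g1 g2] by (elim disjE) (simp_all add: D)
    next
      case 3
      then have "\<rho> j = 2" using g by (simp add: \<rho>_def)
      then show ?thesis using 3 g i \<open>i \<noteq> \<rho> j\<close> chain[of g0 g1 j g2] by (elim disjE) (simp_all add: D)
    next
      case 4
      then have "\<rho> j = 3" using g by (simp add: \<rho>_def)
      then show ?thesis using 4 g i \<open>i \<noteq> \<rho> j\<close> \<open>j < 9\<close> chain[of g0 g1 g2 j] by (elim disjE) (simp_all add: D)
    qed
  qed
  show thesis
  \<comment> \<open>The multipliers come from dividing the cofactor relation by the coefficient of
    row 3. The limits are 1 at prescribed entries and 0 at solved ones.\<close>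
  proof (rule that[of x "\<lambda>s r. - Cf r s / Cf 3 s" "\<lambda>p. if free (fst p) (snd p) then 1 else 0"])
    have "eventually (\<lambda>s. \<forall>i\<in>{0, 1, 2, 3}. Cf i s \<noteq> 0) at_top"
      using Cf_nz by (intro eventually_ball_finite) auto
    then show "eventually (\<lambda>s. \<forall>j<6. x s (3, j) = (\<Sum>r<3. (- Cf r s / Cf 3 s) * x s (r, j))) at_top"
    proof (eventually_elim, intro allI impI)
      fix s and j :: nat
      assume nz: "\<forall>i\<in>{0, 1, 2, 3}. Cf i s \<noteq> 0" and "j < 6"
      have "(\<Sum>i<4. Cf i s * x s (i, j)) = 0"
      proof (cases "j \<in> {g0, g1, g2}")
        case True
        have that_l: "0 < (3 :: nat)" "Suc 0 < 3" "2 < (3 :: nat)" by auto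
        from True obtain l where "l < 3" "j = col l" using col that_l by blast
        then show ?thesis using relation[of l s] True by (simp add: x_def free_def t_def u_def)
      next
        case False
        have "Cf (\<rho> j) s \<noteq> 0" using nz by (auto simp: \<rho>_def)
        have "(\<Sum>i<4. Cf i s * x s (i, j)) = Cf (\<rho> j) s * x s (\<rho> j, j) + (\<Sum>i\<in>{..<4} - {\<rho> j}. Cf i s * x s (i, j))"
          using \<rho>4 by (intro sum.remove) auto
        also have "(\<Sum>i\<in>{..<4} - {\<rho> j}. Cf i s * x s (i, j)) = (\<Sum>i\<in>{..<4} - {\<rho> j}. Cf i s * complex_of_real s ^ w (i, j))"
          by (intro sum.cong) (auto simp: x_def free_def)
        also have "Cf (\<rho> j) s * x s (\<rho> j, j) = - \<dots>"
          using False \<open>Cf (\<rho> j) s \<noteq> 0\<close> by (simp add: x_def free_def)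
        finally show ?thesis by simp
      qed
      then have "Cf 3 s * x s (3, j) = - (\<Sum>r<3. Cf r s * x s (r, j))"
        unfolding lessThan_insert by (simp add: eq_neg_iff_add_eq_0)
      then have "x s (3, j) = - (\<Sum>r<3. Cf r s * x s (r, j)) / Cf 3 s"
        using nz by (metis insertCI nonzero_mult_div_cancel_left)
      then show "x s (3, j) = (\<Sum>r<3. (- Cf r s / Cf 3 s) * x s (r, j))"
        by (simp add: sum_divide_distrib sum_negf)
    qed
  next
    fix p :: "nat \<times> nat" assume "p \<in> box"
    obtain r j where p: "p = (r, j)" "r < 4" "j < 6" using \<open>p \<in> box\<close> by (auto simp: box_def)
    show "((\<lambda>s. x s p / complex_of_real s ^ w p) \<longlongrightarrow> (if free (fst p) (snd p) then 1 else 0)) at_top"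
    proof (cases "free r j")
      case True
      have "eventually (\<lambda>s. x s p / complex_of_real s ^ w p = 1) at_top"
        using eventually_gt_at_top[of 0] by eventually_elim (simp add: x_def p True)
      then show ?thesis using True p by (simp add: tendsto_eventually)
    next
      case False
      then have r: "r = \<rho> j" "j \<notin> {g0, g1, g2}" by (auto simp: free_def)
      have "((\<lambda>s. - (\<Sum>i\<in>{..<4} - {\<rho> j}. Cf i s / complex_of_real s ^ D i *
         (complex_of_real s ^ (D i + w (i, j)) / complex_of_real s ^ (D (\<rho> j) + w (\<rho> j, j))))
         / (Cf (\<rho> j) s / complex_of_real s ^ D (\<rho> j))) \<longlongrightarrow> - (\<Sum>i\<in>{..<4} - {\<rho> j}. (- 1) ^ i * 0) / (- 1) ^ \<rho> j) at_top"
        using less[of j] r p \<rho>4 by (intro tendsto_intros Cf_lim tendsto_power_ratio_0) auto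
      moreover have "eventually (\<lambda>s. - (\<Sum>i\<in>{..<4} - {\<rho> j}. Cf i s / complex_of_real s ^ D i *
         (complex_of_real s ^ (D i + w (i, j)) / complex_of_real s ^ (D (\<rho> j) + w (\<rho> j, j))))
         / (Cf (\<rho> j) s / complex_of_real s ^ D (\<rho> j)) = x s p / complex_of_real s ^ w p) at_top"
        using eventually_gt_at_top[of 0] Cf_nz[OF \<rho>4[of j]]
      proof eventually_elim
        case (elim s)
        have "(\<Sum>i\<in>{..<4} - {\<rho> j}. Cf i s / complex_of_real s ^ D i *
         (complex_of_real s ^ (D i + w (i, j)) / complex_of_real s ^ (D (\<rho> j) + w (\<rho> j, j)))) =
          (\<Sum>i\<in>{..<4} - {\<rho> j}. Cf i s * complex_of_real s ^ w (i, j)) / complex_of_real s ^ (D (\<rho> j) + w (\<rho> j, j))"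
          unfolding sum_divide_distrib using elim by (intro sum.cong) (simp_all add: power_add)
        then show ?case
          using elim False by (simp add: x_def p(1) r(1) power_add)
      qed
      ultimately show ?thesis using False p by (simp add: tendsto_cong)
    qed
  next
    fix p assume "p \<in> S"
    obtain r j where p: "p = (r, j)" by force
    then have "r = 0 \<or> r = 1 \<or> r = 2 \<or> r = 3" using \<open>p \<in> S\<close> assms(2) by (auto simp: box_def)
    then have "free r j"
      using S[of j] g \<open>p \<in> S\<close> unfolding free_def \<rho>_def p by (elim disjE) auto
    then have "free (fst p) (snd p)" by (simp add: p)
    then show "(if free (fst p) (snd p) then 1 else 0 :: complex) = 1" by simp
  qed
qed

section \<open>The ideal of the matrices of rank at most 3\<close>

lemma tendsto_prod_mset:
  fixes f :: "'i \<Rightarrow> 's \<Rightarrow> complex"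
  assumes "\<And>i. i \<in># M \<Longrightarrow> ((\<lambda>s. f i s) \<longlongrightarrow> l i) F"
  shows "((\<lambda>s. \<Prod>i\<in>#M. f i s) \<longlongrightarrow> (\<Prod>i\<in>#M. l i)) F"
  using assms by (induction M) (auto intro!: tendsto_mult)

lemma permutes_less_4: "\<sigma> permutes {..<4} \<Longrightarrow> i < 4 \<Longrightarrow> \<sigma> i < (4 :: nat)"
  using permutes_in_image[of \<sigma> "{..<4}" i] by simp

text \<open>A chart of the matrices of rank at most 3, easy to parametrize; vanishing on it already
  forces membership in the ideal of the minors.\<close>

definition low_rank :: "(nat \<times> nat \<Rightarrow> complex) \<Rightarrow> bool"
  where "low_rank x \<longleftrightarrow> (\<exists>k. \<forall>j<6. x (3, j) = (\<Sum>r<3. k r * x (r, j)))"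

definition increasing :: "(nat \<Rightarrow> nat) \<Rightarrow> bool"
  where "increasing y \<longleftrightarrow> (\<forall>i j. i < j \<longrightarrow> j < 4 \<longrightarrow> y i < y j) \<and> (\<forall>i<4. y i < 6)"

context tensor_coords
begin

section \<open>Maximal minors and division by them\<close>

definition minor :: "(nat \<Rightarrow> nat) \<Rightarrow> ('a \<times> 'b \<times> 'c \<Rightarrow> complex) \<Rightarrow> complex"
  where "minor y T = (if T \<in> V then
    \<Sum>\<sigma> | \<sigma> permutes {..<4}. of_int (sign \<sigma>) * (\<Prod>r<4. crd T (r, y (\<sigma> r))) else 0)"

definition entries :: "(nat \<Rightarrow> nat) \<Rightarrow> (nat \<times> nat) multiset"
  where "entries y = image_mset (\<lambda>r. (r, y r)) (mset_set {..<4})"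

lemma minor_eq_sum_mono:
  "minor y = (\<Sum>\<sigma> | \<sigma> permutes {..<4}. fscale (of_int (sign \<sigma>)) (mono (entries (y \<circ> \<sigma>))))"
  by (simp add: fun_eq_iff minor_def sum_fun_apply fscale_apply mono_def entries_def
      prod_unfold_prod_mset image_mset.compositionality comp_def)

lemma entries_in_box: "(\<And>i. i < 4 \<Longrightarrow> y i < 6) \<Longrightarrow> set_mset (entries y) \<subseteq> box"
  by (auto simp: entries_def box_def)

lemma size_entries [simp]: "size (entries y) = 4"
  by (simp add: entries_def)

lemma mono_mult_minor:
  "mono \<nu> * minor y = (\<Sum>\<sigma> | \<sigma> permutes {..<4}. fscale (of_int (sign \<sigma>)) (mono (\<nu> + entries (y \<circ> \<sigma>))))"
  unfolding minor_eq_sum_mono mono_mult[symmetric]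
  by (simp add: fun_eq_iff sum_fun_apply fscale_apply sum_distrib_left algebra_simps)

lemma mono_mult_minor_in_sym_power:
  assumes "set_mset \<nu> \<subseteq> box" "\<And>i. i < 4 \<Longrightarrow> y i < 6"
  shows "mono \<nu> * minor y \<in> sym_power V (size \<nu> + 4)"
  unfolding mono_mult_minor
proof (intro fun_space.subspace_sum[OF subspace_sym_power] fun_space.subspace_scale[OF subspace_sym_power])
  fix \<sigma> :: "nat \<Rightarrow> nat" assume "\<sigma> \<in> {\<sigma>. \<sigma> permutes {..<4}}"
  then have "set_mset (\<nu> + entries (y \<circ> \<sigma>)) \<subseteq> box"
    using assms entries_in_box[of "y \<circ> \<sigma>"] permutes_less_4 by auto
  then show "mono (\<nu> + entries (y \<circ> \<sigma>)) \<in> sym_power V (size \<nu> + 4)"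
    using mono_in_sym_power[of "\<nu> + entries (y \<circ> \<sigma>)"] by simp
qed

text \<open>A nonzero linear relation \<open>v\<close> between the rows lies in the kernel of the
  transposed 4 by 4 submatrix, so the determinant is 0.\<close>

lemma minor_tens_eq_0:
  assumes "\<And>i. i < 4 \<Longrightarrow> y i < 6" "r0 < 4" "v r0 \<noteq> 0" "\<And>j. j < 6 \<Longrightarrow> (\<Sum>r<4. v r * x (r, j)) = 0"
  shows "minor y (tens x) = 0"
proof -
  define M where "M = mat 4 4 (\<lambda>(i, r). x (r, y i))"
  have M: "M \<in> carrier_mat 4 4" by (simp add: M_def)
  have "vec 4 v \<noteq> 0\<^sub>v 4"
    using assms(2,3) by (metis index_vec index_zero_vec(1))
  moreover have "M *\<^sub>v vec 4 v = 0\<^sub>v 4"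
  proof (rule eq_vecI)
    fix i assume "i < dim_vec (0\<^sub>v 4 :: complex vec)"
    then have "i < 4" by simp
    have "(\<Sum>r<4. x (r, y i) * v r) = 0"
      using assms(4)[OF assms(1)[OF \<open>i < 4\<close>]] by (simp only: mult.commute)
    then show "(M *\<^sub>v vec 4 v) $ i = 0\<^sub>v 4 $ i"
      using \<open>i < 4\<close> by (simp add: M_def scalar_prod_def atLeast0LessThan)
  qed (simp add: M_def)
  ultimately have "det M = 0"
    using det_0_iff_vec_prod_zero[OF M] by (metis vec_carrier)
  then have "det M\<^sup>T = 0" using det_transpose[OF M] by simp
  then have "(\<Sum>p | p permutes {0..<4}. signof p * (\<Prod>i = 0..<4. M\<^sup>T $$ (i, p i))) = 0"
    by (simp add: det_def M_def)
  also have "(\<Sum>p | p permutes {0..<4}. signof p * (\<Prod>i = 0..<4. M\<^sup>T $$ (i, p i)))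
    = (\<Sum>\<sigma> | \<sigma> permutes {..<4}. of_int (sign \<sigma>) * (\<Prod>r<4. crd (tens x) (r, y (\<sigma> r))))"
    unfolding atLeast0LessThan
  proof (intro sum.cong refl arg_cong2[of _ _ _ _ "(*)"] prod.cong)
    fix p r assume p: "p \<in> {p. p permutes {..<4 :: nat}}" and r: "r \<in> {..<4 :: nat}"
    then have "p r < 4" using permutes_less_4 by auto
    then show "M\<^sup>T $$ (r, p r) = crd (tens x) (r, y (p r))"
      using r assms(1) by (simp add: M_def crd_tens box_def)
  qed
  finally show ?thesis by (simp add: minor_def)
qed

lemma minor_low_rank:
  assumes "\<And>i. i < 4 \<Longrightarrow> y i < 6" "low_rank x"
  shows "minor y (tens x) = 0"
proof -
  obtain k where k: "\<forall>j<6. x (3, j) = (\<Sum>r<3. k r * x (r, j))"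
    using assms(2) by (auto simp: low_rank_def)
  have "{..<4} = insert 3 {..<3 :: nat}" by auto
  then have "(\<Sum>r<4. (k (3 := - 1)) r * x (r, j)) = 0" if "j < 6" for j
    using k that by simp
  then show ?thesis using minor_tens_eq_0[of y 3 "k (3 := - 1)" x] assms(1) by simp
qed

text \<open>Degree \<open>d\<close> piece of the ideal of maximal minors; for \<open>d < 4\<close>
  no multiplier has the right size and the span is 0.\<close>

definition minor_ideal :: "nat \<Rightarrow> (('a \<times> 'b \<times> 'c \<Rightarrow> complex) \<Rightarrow> complex) set"
  where "minor_ideal d = lspan {mono \<nu> * minor y |\<nu> y. size \<nu> + 4 = d \<and> set_mset \<nu> \<subseteq> box \<and> increasing y}"

text \<open>Filtration by weight. The base \<open>d + 5\<close> exceeds the degree, which excludes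
  ties between monomials, and exceeds 4, which makes the diagonal of a minor its leading
  term.\<close>

definition below :: "nat \<Rightarrow> nat \<Rightarrow> (('a \<times> 'b \<times> 'c \<Rightarrow> complex) \<Rightarrow> complex) set"
  where "below d N = lspan {mono \<mu> |\<mu>. size \<mu> = d \<and> set_mset \<mu> \<subseteq> box \<and> wt (d + 5) \<mu> < N}"

lemma leading_monomial_contains_diagonal:
  assumes \<mu>: "size \<mu> = d" "set_mset \<mu> \<subseteq> box" and h: "h \<in> below d (wt (d + 5) \<mu>)" and "k \<noteq> 0"
    and vanish: "\<And>x. low_rank x \<Longrightarrow> (fscale k (mono \<mu>) + h) (tens x) = 0"
  shows "\<exists>y. (\<forall>i j. i < j \<longrightarrow> j < 4 \<longrightarrow> y i < y j) \<and> (\<forall>r<4. (r, y r) \<in># \<mu>)"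
proof (rule ccontr)
  assume nodiag: "\<not> ?thesis"
  let ?w = "weight (d + 5)"
  let ?q = "\<lambda>\<nu> s. complex_of_real s ^ wt (d + 5) \<nu>"
  obtain x :: "real \<Rightarrow> nat \<times> nat \<Rightarrow> complex" and k' :: "real \<Rightarrow> nat \<Rightarrow> complex" and q
    where x: "eventually (\<lambda>s. \<forall>j<6. x s (3, j) = (\<Sum>r<3. k' s r * x s (r, j))) at_top"
      "\<And>p. p \<in> box \<Longrightarrow> ((\<lambda>s. x s p / complex_of_real s ^ ?w p) \<longlongrightarrow> q p) at_top"
      "\<And>p. p \<in># \<mu> \<Longrightarrow> q p = 1"
  proof (rule low_rank_degeneration[of ?w "set_mset \<mu>"])
    show "?w (r, j') + ?w (r', j) < ?w (r, j) + ?w (r', j')"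
      if "r < r'" "r' < 4" "j < j'" "j' < 9" for r r' j j'
      using that by (intro weight_exchange) auto
    show "\<exists>r<4. (r, y r) \<notin># \<mu>" if "\<And>i j. i < j \<Longrightarrow> j < 4 \<Longrightarrow> y i < y j" for y
      using nodiag that by blast
  qed (use \<mu>(2) in blast)+
  have mono_lim: "((\<lambda>s. mono \<nu> (tens (x s)) / ?q \<nu> s) \<longlongrightarrow> (\<Prod>p\<in>#\<nu>. q p)) at_top"
    if "set_mset \<nu> \<subseteq> box" for \<nu>
  proof -
    have "mono \<nu> (tens (x s)) / ?q \<nu> s = (\<Prod>p\<in>#\<nu>. x s p / complex_of_real s ^ ?w p)" for s
    proof -
      have "mono \<nu> (tens (x s)) = (\<Prod>p\<in>#\<nu>. x s p)"
        using that by (auto simp: mono_def crd_tens intro!: arg_cong[where f = prod_mset] image_mset_cong)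
      moreover have "(\<Prod>p\<in>#\<nu>. x s p) / ?q \<nu> s = (\<Prod>p\<in>#\<nu>. x s p / complex_of_real s ^ ?w p)"
      proof (induction \<nu>)
        case (add p \<nu>)
        show ?case by (simp add: power_add flip: add.IH)
      qed simp
      ultimately show ?thesis by simp
    qed
    then show ?thesis using that x(2) by (auto intro!: tendsto_prod_mset)
  qed
  \<comment> \<open>Every entry, prescribed or solved, has a finite limit relative to its weight, so
    a monomial of lower weight contributes 0.\<close>
  have h_lim: "((\<lambda>s. h (tens (x s)) / ?q \<mu> s) \<longlongrightarrow> 0) at_top"
    using h unfolding below_def
  proof (induction rule: fun_space.span_induct_alt)
    case (step c f g)
    then obtain \<nu> where \<nu>: "f = mono \<nu>" "set_mset \<nu> \<subseteq> box" "wt (d + 5) \<nu> < wt (d + 5) \<mu>" by blast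
    have "((\<lambda>s. c * ((mono \<nu> (tens (x s)) / ?q \<nu> s) *
        (?q \<nu> s / ?q \<mu> s))
        + g (tens (x s)) / ?q \<mu> s) \<longlongrightarrow> c * ((\<Prod>p\<in>#\<nu>. q p) * 0) + 0) at_top"
      using \<nu> step.IH by (intro tendsto_intros mono_lim tendsto_power_ratio_0)
    moreover have "eventually (\<lambda>s. c * ((mono \<nu> (tens (x s)) / ?q \<nu> s) *
        (?q \<nu> s / ?q \<mu> s))
        + g (tens (x s)) / ?q \<mu> s
        = (fscale c f + g) (tens (x s)) / ?q \<mu> s) at_top"
      using eventually_gt_at_top[of 0]
      by eventually_elim (simp add: \<nu>(1) fscale_apply add_divide_distrib)
    ultimately show ?case by (simp add: tendsto_cong)
  qed simp
  have "((\<lambda>s. k * (mono \<mu> (tens (x s)) / ?q \<mu> s)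
      + h (tens (x s)) / ?q \<mu> s) \<longlongrightarrow> k * (\<Prod>p\<in>#\<mu>. q p) + 0) at_top"
    by (intro tendsto_intros mono_lim h_lim \<mu>)
  moreover have "eventually (\<lambda>s. k * (mono \<mu> (tens (x s)) / ?q \<mu> s)
      + h (tens (x s)) / ?q \<mu> s = 0) at_top"
    using x(1)
  proof eventually_elim
    case (elim s)
    then have "(fscale k (mono \<mu>) + h) (tens (x s)) = 0"
      by (intro vanish) (auto simp: low_rank_def)
    then show ?case by (simp add: fscale_apply flip: add_divide_distrib)
  qed
  ultimately have "k * (\<Prod>p\<in>#\<mu>. q p) + 0 = 0"
    by (intro tendsto_unique[OF trivial_limit_at_top_linorder _ tendsto_eventually])
  moreover have "(\<Prod>p\<in>#\<mu>. q p) = 1" using x(3) by (auto intro!: prod_mset.neutral)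
  ultimately show False using \<open>k \<noteq> 0\<close> by simp
qed

text \<open>Division by the minors: the leading monomial contains the diagonal of some
  \<open>minor y\<close>, and subtracting \<open>k\<close> times \<open>mono \<nu> * minor y\<close>
  keeps the vanishing and lowers the weight bound.\<close>

lemma vanishing_below_in_minor_ideal:
  assumes "f \<in> below d N" and "\<And>x. low_rank x \<Longrightarrow> f (tens x) = 0"
  shows "f \<in> minor_ideal d"
  using assms
proof (induction N arbitrary: f)
  case 0
  then have f: "f = 0" by (simp add: below_def)
  show ?case unfolding minor_ideal_def f by (rule fun_space.span_zero)
next
  case (Suc N)
  let ?M = "\<lambda>N. {mono \<mu> |\<mu>. size \<mu> = d \<and> set_mset \<mu> \<subseteq> box \<and> wt (d + 5) \<mu> < N}"
  show ?case
  proof (cases "\<exists>\<mu>. size \<mu> = d \<and> set_mset \<mu> \<subseteq> box \<and> wt (d + 5) \<mu> = N")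
    case False
    then have "?M (Suc N) = ?M N" by (auto simp: less_Suc_eq)
    then have "f \<in> below d N" using Suc.prems(1) by (simp add: below_def)
    then show ?thesis using Suc by blast
  next
    case True
    then obtain \<mu> where \<mu>: "size \<mu> = d" "set_mset \<mu> \<subseteq> box" "wt (d + 5) \<mu> = N" by blast
    \<comment> \<open>No ties: at most one monomial has weight \<open>N\<close>.\<close>
    have "?M (Suc N) \<subseteq> insert (mono \<mu>) (?M N)"
    proof
      fix f' assume "f' \<in> ?M (Suc N)"
      then obtain \<mu>' where \<mu>': "f' = mono \<mu>'" "size \<mu>' = d" "set_mset \<mu>' \<subseteq> box" "wt (d + 5) \<mu>' < Suc N"
        by blast
      show "f' \<in> insert (mono \<mu>) (?M N)"
      proof (cases "wt (d + 5) \<mu>' = N")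
        case True
        then have "\<mu>' = \<mu>" using \<mu> \<mu>' by (intro wt_inject[of _ "d + 5"]) auto
        then show ?thesis using \<mu>' by simp
      next
        case False
        then have "wt (d + 5) \<mu>' < N" using \<mu>'(4) by simp
        then show ?thesis using \<mu>' by blast
      qed
    qed
    then have "f \<in> lspan (insert (mono \<mu>) (?M N))"
      using Suc.prems(1) fun_space.span_mono unfolding below_def by blast
    then obtain k where k: "f - fscale k (mono \<mu>) \<in> below d N"
      unfolding below_def fun_space.span_breakdown_eq by blast
    define h where "h = f - fscale k (mono \<mu>)"
    have f: "f = fscale k (mono \<mu>) + h" by (simp add: h_def)
    show ?thesis
    proof (cases "k = 0")
      case True
      then have "f \<in> below d N" using k by (simp add: fscale_def flip: zero_fun_def)
      then show ?thesis using Suc by blast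
    next
      case False
      then obtain y where y: "\<And>i j. i < j \<Longrightarrow> j < 4 \<Longrightarrow> y i < y j" "\<And>r. r < 4 \<Longrightarrow> (r, y r) \<in># \<mu>"
        using leading_monomial_contains_diagonal[OF \<mu>(1,2), of h k] k \<mu>(3) Suc.prems(2)
        unfolding f[symmetric] h_def[symmetric] by blast
      have y6: "y i < 6" if "i < 4" for i using y(2)[OF that] \<mu>(2) by (auto simp: box_def)
      have inc: "increasing y" using y(1) y6 by (auto simp: increasing_def)
      \<comment> \<open>The four diagonal entries lie in different rows, so each needs multiplicity
        one only.\<close>
      have "entries y \<subseteq># \<mu>"
      proof (rule mset_subset_eqI)
        fix p
        have "entries y = mset_set ((\<lambda>r. (r, y r)) ` {..<4})"
          unfolding entries_def by (intro image_mset_mset_set) (auto simp: inj_on_def)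
        then show "count (entries y) p \<le> count \<mu> p"
          using y(2) by (cases "p \<in> (\<lambda>r. (r, y r)) ` {..<4}") (auto simp: Suc_le_eq)
      qed
      then obtain \<nu> where \<nu>: "\<mu> = \<nu> + entries y" by (metis mset_subset_eq_exists_conv add.commute)
      have \<nu>': "set_mset \<nu> \<subseteq> box" "size \<nu> + 4 = d" using \<mu> \<nu> by auto
      let ?P = "{\<sigma>. \<sigma> permutes {..<4 :: nat}}"
      have "mono \<nu> * minor y = mono \<mu> + (\<Sum>\<sigma>\<in>?P - {id}. fscale (of_int (sign \<sigma>)) (mono (\<nu> + entries (y \<circ> \<sigma>))))"
        unfolding mono_mult_minor
        by (subst sum.remove[of _ id]) (simp_all add: finite_permutations permutes_id sign_id \<nu> fscale_def)
      moreover have "(\<Sum>\<sigma>\<in>?P - {id}. fscale (of_int (sign \<sigma>)) (mono (\<nu> + entries (y \<circ> \<sigma>)))) \<in> below d N"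
        unfolding below_def
      proof (intro fun_space.span_sum fun_space.span_scale fun_space.span_base CollectI exI conjI)
        fix \<sigma> assume \<sigma>: "\<sigma> \<in> ?P - {id}"
        show "size (\<nu> + entries (y \<circ> \<sigma>)) = d" using \<nu>' by simp
        show "set_mset (\<nu> + entries (y \<circ> \<sigma>)) \<subseteq> box"
          using \<nu>' entries_in_box[of "y \<circ> \<sigma>"] y6 permutes_less_4 \<sigma> by auto
        have wt_entries: "wt (d + 5) (entries z) = (\<Sum>r<4. weight (d + 5) (r, z r))" for z
          by (simp add: entries_def image_mset.compositionality comp_def sum_unfold_sum_mset)
        have "(\<Sum>r<4. weight (d + 5) (r, y (\<sigma> r))) < (\<Sum>r<4. weight (d + 5) (r, y r))"
          using \<sigma> y y6 by (intro wt_diagonal_less) fastforce+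
        then show "wt (d + 5) (\<nu> + entries (y \<circ> \<sigma>)) < N"
          unfolding \<mu>(3)[symmetric] \<nu> by (simp add: wt_entries)
      qed (rule refl)
      ultimately obtain g where g: "mono \<nu> * minor y = mono \<mu> + g" "g \<in> below d N" by blast
      define f' where "f' = h - fscale k g"
      have f': "f = f' + fscale k (mono \<nu> * minor y)"
        unfolding f f'_def g(1) by (simp add: fun_eq_iff fscale_apply algebra_simps)
      have "f' \<in> below d N"
        using k g(2) unfolding f'_def h_def[symmetric] below_def
        by (intro fun_space.span_diff fun_space.span_scale)
      moreover have "f' (tens x) = 0" if "low_rank x" for x
      proof -
        have "minor y (tens x) = 0" using minor_low_rank[OF y6 that] .
        then show ?thesis
          using Suc.prems(2)[OF that] unfolding f' by (simp add: fscale_apply)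
      qed
      ultimately have "f' \<in> minor_ideal d" using Suc.IH by blast
      moreover have "mono \<nu> * minor y \<in> minor_ideal d"
        unfolding minor_ideal_def using \<nu>' inc by (intro fun_space.span_base) blast
      ultimately show ?thesis
        unfolding f' minor_ideal_def by (intro fun_space.span_add fun_space.span_scale)
    qed
  qed
qed

lemma vanishing_in_minor_ideal:
  assumes "f \<in> sym_power V d" and "\<And>x. low_rank x \<Longrightarrow> f (tens x) = 0"
  shows "f \<in> minor_ideal d"
proof -
  \<comment> \<open>35 = 9 * 3 + 8 is the exponent of the heaviest entry \<open>(0, 0)\<close>, so
    the bound exceeds all weights in degree \<open>d\<close>.\<close>
  let ?N = "d * (d + 5) ^ 35 + 1"
  have "wt (d + 5) \<mu> < size \<mu> * (d + 5) ^ 35 + 1" for \<mu>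
  proof (induction \<mu>)
    case (add p \<mu>)
    have "weight (d + 5) p \<le> (d + 5) ^ 35"
      unfolding weight_def by (intro power_increasing) auto
    then show ?case using add by simp
  qed simp
  then have "{mono \<mu> |\<mu>. size \<mu> = d \<and> set_mset \<mu> \<subseteq> box} \<subseteq>
      {mono \<mu> |\<mu>. size \<mu> = d \<and> set_mset \<mu> \<subseteq> box \<and> wt (d + 5) \<mu> < ?N}" by blast
  then have "f \<in> below d ?N"
    using assms(1) fun_space.span_mono unfolding sym_power_eq below_def by blast
  then show ?thesis using assms(2) vanishing_below_in_minor_ideal by blast
qed

end

section \<open>Density of the pencils of diagonalizable type\<close>

lemma order_prod_linear_le_1:
  fixes as :: "complex list"
  assumes "distinct as"
  shows "order x (\<Prod>a\<leftarrow>as. [:- a, 1:]) \<le> (if x \<in> set as then 1 else 0)"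
  using assms
proof (induction as)
  case (Cons a as)
  have nz: "(\<Prod>a\<leftarrow>as. [:- a, 1:]) \<noteq> 0" for as :: "complex list" unfolding prod_list_zero_iff by auto
  have "order x ([:- a, 1:] * (\<Prod>a\<leftarrow>as. [:- a, 1:])) = order x [:- a, 1:] + order x (\<Prod>a\<leftarrow>as. [:- a, 1:])"
    using nz[of "a # as"] by (intro order_mult) simp
  moreover have "order x [:- a, 1:] = (if x = a then 1 else 0)"
    using order_power_n_n[of a 1] by (auto intro: order_0I)
  ultimately show ?case using Cons by (auto split: if_splits)
qed simp

lemma jordan_matrix_diagonal:
  assumes "\<And>m a. (m, a) \<in> set n_as \<Longrightarrow> m = 1" "i < length n_as" "j < length n_as" "i \<noteq> j"
  shows "jordan_matrix n_as $$ (i, j) = (0 :: complex)"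
  using assms
proof (induction n_as arbitrary: i j)
  case (Cons p n_as)
  obtain a where p: "p = (1, a)" using Cons.prems(1)[of "fst p" "snd p"] by (cases p) auto
  have "map fst n_as = replicate (length (map fst n_as)) 1"
  proof (intro replicate_length_same[symmetric] ballI)
    fix m assume "m \<in> set (map fst n_as)"
    then obtain a' where "(m, a') \<in> set n_as" by auto
    then show "m = 1" using Cons.prems(1)[of m a'] by simp
  qed
  then have len: "sum_list (map fst n_as) = length n_as" by (metis length_map mult.right_neutral sum_list_replicate nat_mult_1_right of_nat_id)
  have "jordan_matrix n_as $$ (i - 1, j - 1) = 0" if "i > 0" "j > 0"
    by (rule Cons.IH) (use Cons.prems that in auto)
  then show ?case
    using Cons.prems unfolding p jordan_matrix_Cons by (auto simp: len index_mat_four_block)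
qed simp

text \<open>Distinct diagonal entries are simple roots of the characteristic polynomial, which
  bounds every Jordan block by size 1; such a Jordan form is diagonal.\<close>

lemma upper_triangular_distinct_diagonalizable:
  fixes J :: "complex mat"
  assumes J: "J \<in> carrier_mat n n" "upper_triangular J" and "distinct (diag_mat J)"
  shows "\<exists>d S T. similar_mat_wit J (mat_diag n d) S T"
proof -
  have cp: "char_poly J = (\<Prod>a\<leftarrow>diag_mat J. [:- a, 1:])"
    by (rule char_poly_upper_triangular[OF J])
  obtain n_as where nf: "jordan_nf J n_as" using jordan_nf_exists[OF J(1) cp] by blast
  have one: "m = 1" if "(m, a) \<in> set n_as" for m a
  proof -
    have "m \<le> 1"
      using jordan_nf_block_size_order_bound[OF nf that] order_prod_linear_le_1[OF assms(3), of a]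
      by (simp add: cp split: if_splits)
    moreover have "m \<noteq> 0" using nf that by (force simp: jordan_nf_def)
    ultimately show ?thesis by simp
  qed
  obtain S T where wit: "similar_mat_wit J (jordan_matrix n_as) S T"
    using nf by (auto simp: jordan_nf_def similar_mat_def)
  then have "jordan_matrix n_as \<in> carrier_mat n n" using similar_mat_witD2[OF J(1)] by blast
  then have n: "sum_list (map fst n_as) = n" using jordan_matrix_carrier[of n_as] by auto
  have "map fst n_as = replicate (length (map fst n_as)) 1"
    using one by (intro replicate_length_same[symmetric]) auto
  then have len: "length n_as = n" using n by (metis length_map mult.right_neutral sum_list_replicate nat_mult_1_right of_nat_id)
  have "jordan_matrix n_as = mat_diag n (\<lambda>i. jordan_matrix n_as $$ (i, i))"
    using jordan_matrix_diagonal[OF one] n by (intro eq_matI) (auto simp: mat_diag_def len)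
  then show ?thesis using wit by metis
qed

lemma invertible_of_det:
  fixes A :: "complex mat"
  assumes "A \<in> carrier_mat n n" "det A \<noteq> 0"
  obtains B where "B \<in> carrier_mat n n" "A * B = 1\<^sub>m n" "B * A = 1\<^sub>m n"
  using det_non_zero_imp_unit[OF assms, of undefined] by (auto simp: Units_def ring_mat_def)

lemma isCont_eq_0:
  fixes f :: "complex \<Rightarrow> complex"
  assumes "isCont f 0" "eventually (\<lambda>\<delta>. f \<delta> = 0) (at 0)"
  shows "f 0 = 0"
proof -
  have "(f \<longlongrightarrow> f 0) (at 0)" using assms(1) by (simp add: isCont_def)
  moreover have "(f \<longlongrightarrow> 0) (at 0)" using assms(2) by (rule tendsto_eventually)
  ultimately show ?thesis by (intro tendsto_unique[OF _ _ \<open>(f \<longlongrightarrow> 0) (at 0)\<close>]) auto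
qed

text \<open>Two perturbations reduce to the case \<open>diag\<close>: \<open>P\<close> plus a scalar
  matrix is invertible for almost all scalars, and for invertible \<open>P\<close> with inverse
  \<open>U\<close> the triangular form of \<open>Q * U\<close> gets distinct eigenvalues after a
  small change of its diagonal. Both are undone by continuity along a complex line, the only
  regularity asked of \<open>F\<close>.\<close>

lemma matrix_pencil_density:
  fixes F :: "complex mat \<Rightarrow> complex mat \<Rightarrow> complex"
  assumes cont: "\<And>P Q P' Q'. {P, Q, P', Q'} \<subseteq> carrier_mat n n \<Longrightarrow>
      isCont (\<lambda>\<delta>. F (P + \<delta> \<cdot>\<^sub>m P') (Q + \<delta> \<cdot>\<^sub>m Q')) 0"
    and diag: "\<And>S R d. {S, R} \<subseteq> carrier_mat n n \<Longrightarrow> F (S * R) (S * mat_diag n d * R) = 0"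
    and PQ: "P \<in> carrier_mat n n" "Q \<in> carrier_mat n n"
  shows "F P Q = 0"
proof -
  have inv: "F P Q = 0" if P: "P \<in> carrier_mat n n" "det P \<noteq> 0" and Q: "Q \<in> carrier_mat n n" for P Q
  proof -
    obtain U where U: "U \<in> carrier_mat n n" "P * U = 1\<^sub>m n" "U * P = 1\<^sub>m n"
      using invertible_of_det[OF P] by blast
    have QU: "Q * U \<in> carrier_mat n n" using Q U by auto
    obtain es where "char_poly (Q * U) = (\<Prod>a\<leftarrow>es. [:- a, 1:])"
      using char_poly_factorized[OF QU] by blast
    then obtain J where J: "J \<in> carrier_mat n n" "upper_triangular J" "similar_mat (Q * U) J"
      using schur_decomposition_exists[OF QU] by blast
    then obtain S T where "similar_mat_wit (Q * U) J S T" by (auto simp: similar_mat_def)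
    note S = similar_mat_witD2[OF QU this]
    \<comment> \<open>Distinct numbers on the diagonal: for each pair of different indices, only one
      \<open>\<delta>\<close> makes the corresponding diagonal entries of
      \<open>J + \<delta> \<cdot>\<^sub>m D\<close> equal.\<close>
    define D where "D = mat_diag n (of_nat :: nat \<Rightarrow> complex)"
    have D: "D \<in> carrier_mat n n" by (simp add: D_def)
    have "eventually (\<lambda>\<delta>. \<forall>i\<in>{..<n}. \<forall>j\<in>{..<n}. i \<noteq> j \<longrightarrow> J $$ (i, i) + \<delta> * of_nat i \<noteq> J $$ (j, j) + \<delta> * of_nat j) (at 0)"
    proof (intro eventually_ball_finite ballI)
      fix i j :: nat
      have "eventually (\<lambda>\<delta>. \<delta> \<noteq> (J $$ (j, j) - J $$ (i, i)) / (of_nat i - of_nat j)) (at 0)"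
        by (rule eventually_neq_at_within)
      then show "eventually (\<lambda>\<delta>. i \<noteq> j \<longrightarrow> J $$ (i, i) + \<delta> * of_nat i \<noteq> J $$ (j, j) + \<delta> * of_nat j) (at 0)"
        by eventually_elim (auto simp: field_simps)
    qed auto
    then have "eventually (\<lambda>\<delta>. F (P + \<delta> \<cdot>\<^sub>m 0\<^sub>m n n) (Q + \<delta> \<cdot>\<^sub>m (S * D * T * P)) = 0) (at 0)"
    proof eventually_elim
      case (elim \<delta>)
      let ?J = "J + \<delta> \<cdot>\<^sub>m D"
      have carr: "?J \<in> carrier_mat n n" using J D by auto
      have "upper_triangular ?J" 
        using J(1,2) unfolding upper_triangular_def by (auto simp: D_def mat_diag_def)
      moreover have "distinct (diag_mat ?J)"
        using elim J(1) unfolding diag_mat_def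
        by (auto simp: distinct_map inj_on_def D_def mat_diag_def) (metis lessThan_iff)
      ultimately obtain d S' T' where "similar_mat_wit ?J (mat_diag n d) S' T'"
        using upper_triangular_distinct_diagonalizable carr by blast
      note S' = similar_mat_witD2[OF carr this]
      \<comment> \<open>With \<open>Q * U = S * J * T\<close> and the perturbed \<open>J\<close>
        equal to \<open>S' * mat_diag n d * T'\<close>, both matrices of the pencil get the outer
        factors \<open>S * S'\<close> and \<open>T' * (T * P)\<close>.\<close>
      have 1: "P + \<delta> \<cdot>\<^sub>m 0\<^sub>m n n = (S * S') * (T' * (T * P))"
      proof -
        have "S' * (T' * (T * P)) = (S' * T') * (T * P)"
          using S S' P by (intro assoc_mult_mat[symmetric]) auto
        then have "(S * S') * (T' * (T * P)) = S * (T * P)"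
          using S S' P by (simp add: assoc_mult_mat[of _ n n _ n _ n])
        also have "\<dots> = (S * T) * P"
          using S P by (intro assoc_mult_mat[symmetric]) auto
        finally show ?thesis using S(1) P by simp
      qed
      have 2: "Q + \<delta> \<cdot>\<^sub>m (S * D * T * P) = (S * S') * mat_diag n d * (T' * (T * P))"
      proof -
        have carr': "T * P \<in> carrier_mat n n" "T' * (T * P) \<in> carrier_mat n n"
          "mat_diag n d * T' \<in> carrier_mat n n" "mat_diag n d * (T' * (T * P)) \<in> carrier_mat n n"
          "J * (T * P) \<in> carrier_mat n n" "D * (T * P) \<in> carrier_mat n n" "D * T \<in> carrier_mat n n"
          "J * T \<in> carrier_mat n n" "\<delta> \<cdot>\<^sub>m (D * (T * P)) \<in> carrier_mat n n" "\<delta> \<cdot>\<^sub>m D \<in> carrier_mat n n"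
          "S' * (mat_diag n d * T') \<in> carrier_mat n n"
          using S S' P J D by (auto intro!: mult_carrier_mat[of _ n n _ n])
        note assoc = assoc_mult_mat[of _ n n _ n _ n]
        have "(S * S') * mat_diag n d * (T' * (T * P)) = S * ((S' * mat_diag n d * T') * (T * P))"
          using S S' P carr' by (simp add: assoc)
        also have "\<dots> = S * (?J * (T * P))" by (simp flip: S'(3))
        also have "?J * (T * P) = J * (T * P) + \<delta> \<cdot>\<^sub>m (D * (T * P))"
          using carr' J D by (simp add: add_mult_distrib_mat[of _ n n _ _ n] mult_smult_assoc_mat[of _ n n _ n])
        also have "S * \<dots> = S * (J * (T * P)) + \<delta> \<cdot>\<^sub>m (S * (D * (T * P)))"
          using S carr' by (simp add: mult_add_distrib_mat[of _ n n _ n] mult_smult_distrib[of _ n n _ n])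
        also have "S * (J * (T * P)) = Q"
        proof -
          have "S * (J * (T * P)) = S * J * T * P" using S J P carr' by (simp add: assoc)
          also have "\<dots> = Q * (U * P)" using U Q P by (simp flip: S(3) add: assoc)
          finally show ?thesis using U Q by simp
        qed
        also have "S * (D * (T * P)) = S * D * T * P" using S D P carr' by (simp add: assoc)
        finally show ?thesis by simp
      qed
      show ?case unfolding 1 2 using S S' P by (intro diag) auto
    qed
    moreover have "isCont (\<lambda>\<delta>. F (P + \<delta> \<cdot>\<^sub>m 0\<^sub>m n n) (Q + \<delta> \<cdot>\<^sub>m (S * D * T * P))) 0"
      using P Q S D by (intro cont) auto
    ultimately have "F (P + 0 \<cdot>\<^sub>m 0\<^sub>m n n) (Q + 0 \<cdot>\<^sub>m (S * D * T * P)) = 0"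
      by (intro isCont_eq_0[of "\<lambda>\<delta>. F (P + \<delta> \<cdot>\<^sub>m 0\<^sub>m n n) (Q + \<delta> \<cdot>\<^sub>m (S * D * T * P))"])
    moreover have "P + 0 \<cdot>\<^sub>m 0\<^sub>m n n = P" "Q + 0 \<cdot>\<^sub>m (S * D * T * P) = Q"
      using P Q S D by (auto intro!: eq_matI)
    ultimately show ?thesis by simp
  qed
  \<comment> \<open>The shift by \<open>\<delta>\<close> is singular only if
    \<open>- \<delta>\<close> is one of the finitely many eigenvalues.\<close>
  have "eventually (\<lambda>\<delta>. \<forall>e\<in>spectrum P. \<delta> \<noteq> - e) (at 0)"
    using card_finite_spectrum(1)[OF PQ(1)] eventually_neq_at_within
    by (intro eventually_ball_finite) auto
  then have "eventually (\<lambda>\<delta>. F (P + \<delta> \<cdot>\<^sub>m 1\<^sub>m n) (Q + \<delta> \<cdot>\<^sub>m 0\<^sub>m n n) = 0) (at 0)"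
  proof eventually_elim
    case (elim \<delta>)
    have "\<not> eigenvalue P (- \<delta>)" using elim by (auto simp: spectrum_def)
    then have "det (P + \<delta> \<cdot>\<^sub>m 1\<^sub>m n) \<noteq> 0"
      using PQ(1) by (auto simp: eigenvalue_det[OF PQ(1)] char_matrix_def)
    then show ?case using PQ by (intro inv) auto
  qed
  moreover have "isCont (\<lambda>\<delta>. F (P + \<delta> \<cdot>\<^sub>m 1\<^sub>m n) (Q + \<delta> \<cdot>\<^sub>m 0\<^sub>m n n)) 0"
    using PQ by (intro cont) auto
  ultimately have "F (P + 0 \<cdot>\<^sub>m 1\<^sub>m n) (Q + 0 \<cdot>\<^sub>m 0\<^sub>m n n) = 0"
    by (intro isCont_eq_0[of "\<lambda>\<delta>. F (P + \<delta> \<cdot>\<^sub>m 1\<^sub>m n) (Q + \<delta> \<cdot>\<^sub>m 0\<^sub>m n n)"])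
  moreover have "P + 0 \<cdot>\<^sub>m 1\<^sub>m n = P" "Q + 0 \<cdot>\<^sub>m 0\<^sub>m n n = Q"
    using PQ by (auto intro!: eq_matI)
  ultimately show ?thesis by simp
qed

section \<open>From matrix pencils to sums of decomposable tensors\<close>

context tensor_coords
begin

text \<open>Zero factors are allowed, so sums of fewer than \<open>n\<close> decomposable tensors
  are included.\<close>

definition vanishes_on_sums :: "nat \<Rightarrow> (('a \<times> 'b \<times> 'c \<Rightarrow> complex) \<Rightarrow> complex) \<Rightarrow> bool"
  where "vanishes_on_sums n f \<longleftrightarrow> (\<forall>\<phi> \<psi> \<chi>. (\<forall>l<n. \<phi> l \<in> dual sA \<and> \<psi> l \<in> dual sB \<and> \<chi> l \<in> dual sC)
      \<longrightarrow> f (\<Sum>l<n. tprod (\<phi> l) (\<psi> l) (\<chi> l)) = 0)"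

lemma isCont_sym_power:
  assumes "f \<in> sym_power V d" "S \<in> V" "T \<in> V"
  shows "isCont (\<lambda>\<delta>. f (S + fscale \<delta> T)) 0"
  using assms(1) unfolding sym_power_eq
proof (induction rule: fun_space.span_induct_alt)
  case (step k g h)
  then obtain \<mu> where \<mu>: "g = mono \<mu>" by blast
  have in_V: "S + fscale \<delta> T \<in> V" for \<delta>
    using assms(2,3) subspace_V by (intro fun_space.subspace_add fun_space.subspace_scale)
  have "isCont (\<lambda>\<delta>. \<Prod>p\<in>#\<mu>. crd S p + \<delta> * crd T p) 0"
    unfolding isCont_def by (intro tendsto_prod_mset tendsto_intros)
  then have "isCont (\<lambda>\<delta>. g (S + fscale \<delta> T)) 0"
  proof -
    assume "isCont (\<lambda>\<delta>. \<Prod>p\<in>#\<mu>. crd S p + \<delta> * crd T p) 0"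
    moreover have "crd (S + fscale \<delta> T) = (\<lambda>p. crd S p + \<delta> * crd T p)" for \<delta>
      by (simp add: fun_eq_iff crd_add crd_fscale)
    ultimately show ?thesis by (simp only: \<mu> mono_def in_V if_True)
  qed
  moreover have "(fscale k g + h) X = k * g X + h X" for X by (simp add: fscale_apply)
  ultimately show ?case using step.IH by (simp only:) (intro continuous_intros)
qed simp

text \<open>For \<open>P = S * R\<close> and \<open>Q = S * mat_diag n ev * R\<close>, the tensor
  with slices \<open>P\<close> and \<open>Q\<close> is a sum of \<open>n\<close> decomposable ones:
  the inner index \<open>l\<close> of the matrix products becomes the index of the summands. Other
  pencils follow by density.\<close>

lemma vanishes_on_pencils:
  assumes f: "f \<in> sym_power V d" "vanishes_on_sums n f"
    and duals: "\<phi> \<in> dual sA" "\<phi>' \<in> dual sA" "\<And>j. j < n \<Longrightarrow> \<psi> j \<in> dual sB" "\<And>r. r < n \<Longrightarrow> \<chi> r \<in> dual sC"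
    and PQ: "P \<in> carrier_mat n n" "Q \<in> carrier_mat n n"
  shows "f (\<Sum>j<n. \<Sum>r<n. fscale (P $$ (j, r)) (tprod \<phi> (\<psi> j) (\<chi> r)) +
      fscale (Q $$ (j, r)) (tprod \<phi>' (\<psi> j) (\<chi> r))) = 0"
proof -
  let ?T = "\<lambda>P Q. \<Sum>j<n. \<Sum>r<n. fscale (P $$ (j, r)) (tprod \<phi> (\<psi> j) (\<chi> r)) +
      fscale (Q $$ (j, r)) (tprod \<phi>' (\<psi> j) (\<chi> r))"
  have in_V: "?T P Q \<in> V" for P Q
    using duals subspace_V tprod_in_V
    by (auto intro!: fun_space.subspace_sum fun_space.subspace_add fun_space.subspace_scale)
  show ?thesis
  proof (rule matrix_pencil_density[of n "\<lambda>P Q. f (?T P Q)", OF _ _ PQ])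
    fix P Q P' Q' :: "complex mat" assume carr: "{P, Q, P', Q'} \<subseteq> carrier_mat n n"
    have "?T (P + \<delta> \<cdot>\<^sub>m P') (Q + \<delta> \<cdot>\<^sub>m Q') = ?T P Q + fscale \<delta> (?T P' Q')" for \<delta>
    proof -
      have "?T (P + \<delta> \<cdot>\<^sub>m P') (Q + \<delta> \<cdot>\<^sub>m Q') = (\<Sum>j<n. \<Sum>r<n. (fscale (P $$ (j, r)) (tprod \<phi> (\<psi> j) (\<chi> r)) +
          fscale (Q $$ (j, r)) (tprod \<phi>' (\<psi> j) (\<chi> r))) + fscale \<delta> (fscale (P' $$ (j, r)) (tprod \<phi> (\<psi> j) (\<chi> r)) +
          fscale (Q' $$ (j, r)) (tprod \<phi>' (\<psi> j) (\<chi> r))))"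
        using carr by (intro sum.cong refl) (auto simp: fun_eq_iff fscale_apply algebra_simps)
      then show ?thesis
        by (simp only: sum.distrib fun_space.scale_sum_right fun_space.scale_right_distrib)
    qed
    then show "isCont (\<lambda>\<delta>. f (?T (P + \<delta> \<cdot>\<^sub>m P') (Q + \<delta> \<cdot>\<^sub>m Q'))) 0"
      using isCont_sym_power[OF f(1) in_V in_V] by simp
  next
    fix S R :: "complex mat" and ev :: "nat \<Rightarrow> complex" assume carr: "{S, R} \<subseteq> carrier_mat n n"
    define \<phi>'' where "\<phi>'' l = \<phi> + fscale (ev l) \<phi>'" for l
    define \<psi>' where "\<psi>' l = (\<Sum>j<n. fscale (S $$ (j, l)) (\<psi> j))" for l
    define \<chi>' where "\<chi>' l = (\<Sum>r<n. fscale (R $$ (l, r)) (\<chi> r))" for l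
    have "\<phi>'' l \<in> dual sA" "\<psi>' l \<in> dual sB" "\<chi>' l \<in> dual sC" if "l < n" for l
      unfolding \<phi>''_def \<psi>'_def \<chi>'_def using duals subspace_dual[OF A.vs] subspace_dual[OF B.vs] subspace_dual[OF C.vs]
      by (auto intro!: fun_space.subspace_sum fun_space.subspace_add fun_space.subspace_scale)
    then have "f (\<Sum>l<n. tprod (\<phi>'' l) (\<psi>' l) (\<chi>' l)) = 0"
      using f(2) by (simp add: vanishes_on_sums_def)
    also have "(\<Sum>l<n. tprod (\<phi>'' l) (\<psi>' l) (\<chi>' l)) = ?T (S * R) (S * mat_diag n ev * R)"
    proof (rule ext, clarify)
      fix u v w
      have SR: "(S * R) $$ (j, r) = (\<Sum>l<n. S $$ (j, l) * R $$ (l, r))"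
        "(S * mat_diag n ev * R) $$ (j, r) = (\<Sum>l<n. S $$ (j, l) * ev l * R $$ (l, r))" if "j < n" "r < n" for j r
        using carr that mat_diag_mult_right[of S n n ev] by (auto simp: scalar_prod_def atLeast0LessThan)
      have "(\<Sum>l<n. tprod (\<phi>'' l) (\<psi>' l) (\<chi>' l)) (u, v, w) =
        (\<Sum>l<n. \<Sum>j<n. \<Sum>r<n. (\<phi> u + ev l * \<phi>' u) * (S $$ (j, l) * \<psi> j v) * (R $$ (l, r) * \<chi> r w))"
        by (simp add: sum_fun_apply tprod_def \<phi>''_def \<psi>'_def \<chi>'_def fscale_apply sum_distrib_left sum_distrib_right)
          (subst sum.swap, rule refl)
      also have "\<dots> = (\<Sum>j<n. \<Sum>l<n. \<Sum>r<n. (\<phi> u + ev l * \<phi>' u) * (S $$ (j, l) * \<psi> j v) * (R $$ (l, r) * \<chi> r w))"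
        by (rule sum.swap)
      also have "\<dots> = (\<Sum>j<n. \<Sum>r<n. \<Sum>l<n. (\<phi> u + ev l * \<phi>' u) * (S $$ (j, l) * \<psi> j v) * (R $$ (l, r) * \<chi> r w))"
        by (intro sum.cong refl sum.swap)
      also have "\<dots> = ?T (S * R) (S * mat_diag n ev * R) (u, v, w)"
        unfolding sum_fun_apply
      proof (intro sum.cong refl)
        fix j r assume "j \<in> {..<n}" "r \<in> {..<n}"
        then have "(fscale ((S * R) $$ (j, r)) (tprod \<phi> (\<psi> j) (\<chi> r)) +
            fscale ((S * mat_diag n ev * R) $$ (j, r)) (tprod \<phi>' (\<psi> j) (\<chi> r))) (u, v, w) =
          (\<Sum>l<n. S $$ (j, l) * R $$ (l, r) * (\<phi> u * \<psi> j v * \<chi> r w)) +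
          (\<Sum>l<n. S $$ (j, l) * ev l * R $$ (l, r) * (\<phi>' u * \<psi> j v * \<chi> r w))"
          by (simp add: SR fscale_apply tprod_def sum_distrib_right)
        also have "\<dots> = (\<Sum>l<n. (\<phi> u + ev l * \<phi>' u) * (S $$ (j, l) * \<psi> j v) * (R $$ (l, r) * \<chi> r w))"
          unfolding sum.distrib[symmetric] by (intro sum.cong refl) (simp add: algebra_simps)
        finally show "(\<Sum>l<n. (\<phi> u + ev l * \<phi>' u) * (S $$ (j, l) * \<psi> j v) * (R $$ (l, r) * \<chi> r w)) =
          (fscale ((S * R) $$ (j, r)) (tprod \<phi> (\<psi> j) (\<chi> r)) +
            fscale ((S * mat_diag n ev * R) $$ (j, r)) (tprod \<phi>' (\<psi> j) (\<chi> r))) (u, v, w)" by (rule sym)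
      qed
      finally show "(\<Sum>l<n. tprod (\<phi>'' l) (\<psi>' l) (\<chi>' l)) (u, v, w) = ?T (S * R) (S * mat_diag n ev * R) (u, v, w)" .
    qed
    finally show "f (?T (S * R) (S * mat_diag n ev * R)) = 0" .
  qed
qed

lemma crd_tprod: "crd (tprod \<phi> \<psi> \<chi>) p = \<phi> (a (snd p div 3)) * \<psi> (b (snd p mod 3)) * \<chi> (c (fst p))"
  by (simp add: crd_def tprod_def)

text \<open>The hypothesis on \<open>x\<close> places the tensor in the product of the dual of
  \<open>A\<close> with the spans of the \<open>n\<close> forms \<open>\<psi> j\<close> and of the
  \<open>n\<close> forms \<open>\<chi> r\<close>; its two slices along \<open>A\<close> form the
  pencil.\<close>

lemma vanishes_on_tens:
  assumes f: "f \<in> sym_power V d" "vanishes_on_sums n f"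
    and \<psi>: "\<And>j. j < n \<Longrightarrow> \<psi> j \<in> dual sB" and \<chi>: "\<And>r. r < n \<Longrightarrow> \<chi> r \<in> dual sC"
    and x: "\<And>i m l. i < 4 \<Longrightarrow> l < 2 \<Longrightarrow> m < 3 \<Longrightarrow>
      x (i, m + 3 * l) = (\<Sum>j<n. \<Sum>r<n. P l j r * (\<psi> j (b m) * \<chi> r (c i)))"
  shows "f (tens x) = 0"
proof -
  define P' where "P' l = mat n n (\<lambda>(j, r). P l j r)" for l
  let ?T = "\<Sum>j<n. \<Sum>r<n. fscale (P' 0 $$ (j, r)) (tprod (\<alpha> 0) (\<psi> j) (\<chi> r)) +
      fscale (P' 1 $$ (j, r)) (tprod (\<alpha> 1) (\<psi> j) (\<chi> r))"
  have "f ?T = 0"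
    by (intro vanishes_on_pencils[OF f] A.coord_dual \<psi> \<chi>) (auto simp: P'_def)
  moreover have "?T = tens x"
  proof (rule V_eqI)
    show "?T \<in> V"
      using subspace_V tprod_in_V \<psi> \<chi> A.coord_dual
      by (auto intro!: fun_space.subspace_sum fun_space.subspace_add fun_space.subspace_scale)
    fix p assume "p \<in> box"
    then obtain i j where p: "p = (i, j)" "i < 4" "j < 6" by (auto simp: box_def)
    obtain m l where m: "m < 3" "l = 0 \<or> l = 1" "j = m + 3 * l"
      using that[of j 0] that[of "j - 3" 1] p(3) by (cases "j < 3") auto
    have "crd ?T p = (\<Sum>j<n. \<Sum>r<n. P l j r * (\<psi> j (b m) * \<chi> r (c i)))"
      unfolding crd_sum crd_add crd_fscale crd_tprod
      using m by (intro sum.cong refl) (auto simp: P'_def p(1) A.coord_basis)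
    also have "\<dots> = x p" using x[of i l m] m p by auto
    finally show "crd ?T p = crd (tens x) p" using \<open>p \<in> box\<close> by (simp add: crd_tens)
  qed simp
  ultimately show ?thesis by simp
qed

lemma vanishes_on_low_rank:
  assumes "f \<in> sym_power V d" "vanishes_on_sums 3 f" "low_rank x"
  shows "f (tens x) = 0"
proof -
  obtain k where k: "\<And>j. j < 6 \<Longrightarrow> x (3, j) = (\<Sum>r<3. k r * x (r, j))"
    using assms(3) by (auto simp: low_rank_def)
  \<comment> \<open>The relation between the rows is absorbed into the forms:
    \<open>\<gamma> 3\<close> carries row 3, so three forms on \<open>C\<close> suffice and the
    pencil is 3 by 3.\<close>
  define \<chi> where "\<chi> r = \<gamma> r + fscale (k r) (\<gamma> 3)" for r
  show ?thesis
  proof (rule vanishes_on_tens[OF assms(1,2), of \<beta> \<chi> x "\<lambda>l j r. x (r, j + 3 * l)"])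
    show "\<chi> r \<in> dual sC" if "r < 3" for r
      unfolding \<chi>_def using that subspace_dual[OF C.vs]
      by (intro fun_space.subspace_add fun_space.subspace_scale C.coord_dual) auto
    fix i m l :: nat assume i: "i < 4" and "l < 2" and m: "m < 3"
    then have ml: "m + 3 * l < 6" by simp
    have \<chi>c: "\<chi> r (c i) = (if i = r then 1 else 0) + (if i = 3 then k r else 0)" if "r < 3" for r
      using that i by (simp add: \<chi>_def fscale_apply C.coord_basis)
    have "(\<Sum>j<3. \<Sum>r<3. x (r, j + 3 * l) * (\<beta> j (b m) * \<chi> r (c i))) =
        (\<Sum>j<3. if j = m then \<Sum>r<3. x (r, j + 3 * l) * \<chi> r (c i) else 0)"
      using m by (intro sum.cong refl) (auto simp: B.coord_basis)
    also have "\<dots> = (\<Sum>r<3. x (r, m + 3 * l) * \<chi> r (c i))" using m by simp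
    also have "\<dots> = (\<Sum>r<3. (if r = i then x (i, m + 3 * l) else 0) + (if i = 3 then k r * x (r, m + 3 * l) else 0))"
      by (intro sum.cong refl) (auto simp: \<chi>c)
    also have "\<dots> = x (i, m + 3 * l)"
    proof -
      have "i < 3 \<or> i = 3" using i by auto
      then show ?thesis using k[OF ml] by (auto simp: sum.distrib)
    qed
    finally show "x (i, m + 3 * l) = (\<Sum>j<3. \<Sum>r<3. x (r, j + 3 * l) * (\<beta> j (b m) * \<chi> r (c i)))" by (rule sym)
  qed (rule B.coord_dual)
qed

text \<open>A zero form pads the three forms on \<open>B\<close> to four, so that every tensor
  becomes a 4 by 4 pencil.\<close>

lemma vanishes_on_sums_4:
  assumes "f \<in> sym_power V d" "vanishes_on_sums 4 f"
  shows "f = 0"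
proof -
  have "f (tens x) = 0" for x
  proof (rule vanishes_on_tens[OF assms, of "\<lambda>j. if j = 3 then 0 else \<beta> j" \<gamma> x "\<lambda>l j r. x (r, j + 3 * l)"])
    show "(if j = 3 then 0 else \<beta> j) \<in> dual sB" if "j < 4" for j
      using that fun_space.subspace_0[OF subspace_dual[OF B.vs]] B.coord_dual by auto
    fix i m l :: nat assume i: "i < 4" and "l < 2" and m: "m < 3"
    have "(\<Sum>j<4. \<Sum>r<4. x (r, j + 3 * l) * ((if j = 3 then 0 else \<beta> j) (b m) * \<gamma> r (c i))) =
        (\<Sum>j<4. if j = m then \<Sum>r<4. if r = i then x (i, m + 3 * l) else 0 else 0)"
      using i m by (intro sum.cong refl) (auto simp: B.coord_basis C.coord_basis if_distrib cong: if_cong intro!: sum.neutral)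
    also have "\<dots> = x (i, m + 3 * l)" using i m by simp
    finally show "x (i, m + 3 * l) =
      (\<Sum>j<4. \<Sum>r<4. x (r, j + 3 * l) * ((if j = 3 then 0 else \<beta> j) (b m) * \<gamma> r (c i)))" by (rule sym)
  qed (rule C.coord_dual)
  then have "f T = 0" for T
    using tens_crd[of T] sym_power_outside[OF assms(1), of T] by metis
  then show ?thesis by (simp add: fun_eq_iff)
qed

end

section \<open>The secant varieties\<close>

text \<open>Evaluating a relation at \<open>t j\<close> isolates the coefficient of
  \<open>f j\<close>.\<close>

lemma independent_if_dual_points:
  fixes f :: "'i \<Rightarrow> 'x \<Rightarrow> complex"
  assumes "finite I" and "\<And>i j. i \<in> I \<Longrightarrow> j \<in> I \<Longrightarrow> f i (t j) = (if i = j then 1 else 0)"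
  shows "fun_space.independent (f ` I)" and "inj_on f I"
proof -
  show inj: "inj_on f I"
    using assms(2) by (intro inj_onI) (metis zero_neq_one)
  show "fun_space.independent (f ` I)"
  proof (rule fun_space.independent_if_scalars_zero)
    fix k v assume sum: "(\<Sum>v\<in>f ` I. fscale (k v) v) = 0" and "v \<in> f ` I"
    then obtain j where j: "j \<in> I" "v = f j" by auto
    have "0 = (\<Sum>v\<in>f ` I. fscale (k v) v) (t j)" unfolding sum by simp
    also have "\<dots> = (\<Sum>i\<in>I. k (f i) * f i (t j))"
      by (simp add: sum_fun_apply fscale_apply sum.reindex[OF inj])
    also have "\<dots> = (\<Sum>i\<in>I. if i = j then k (f i) else 0)"
      using assms(2) j(1) by (intro sum.cong) auto
    also have "\<dots> = k v" using assms(1) j by simp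
    finally show "k v = 0" by simp
  qed (use assms(1) in simp)
qed

lemma tprod_add: "tprod (f + f') g h = tprod f g h + tprod f' g h"
  "tprod f (g + g') h = tprod f g h + tprod f g' h" "tprod f g (h + h') = tprod f g h + tprod f g h'"
  and tprod_fscale: "tprod (fscale k f) g h = fscale k (tprod f g h)"
  "tprod f (fscale k g) h = fscale k (tprod f g h)" "tprod f g (fscale k h) = fscale k (tprod f g h)"
  by (simp_all add: tprod_def fscale_apply fun_eq_iff algebra_simps)

text \<open>Explicit index set for the maximal minors. Functions \<open>y\<close> that agree on 0 to
  3 give the same minor, whereas these lists are in bijection with the minors.\<close>

definition column_sets :: "nat list set"
  where "column_sets = {[0, 1, 2, 3], [0, 1, 2, 4], [0, 1, 2, 5], [0, 1, 3, 4], [0, 1, 3, 5],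
    [0, 1, 4, 5], [0, 2, 3, 4], [0, 2, 3, 5], [0, 2, 4, 5], [0, 3, 4, 5], [1, 2, 3, 4], [1, 2, 3, 5],
    [1, 2, 4, 5], [1, 3, 4, 5], [2, 3, 4, 5]}"

lemma card_column_sets: "card column_sets = 15"
  by (simp add: column_sets_def)

lemma column_sets_props:
  assumes "l \<in> column_sets"
  shows "length l = 4" "distinct l" "set l \<subseteq> {..<6}" "increasing ((!) l)"
  using assms by (auto simp: column_sets_def increasing_def less_Suc_eq numeral_eq_Suc)

lemma column_sets_separated: "l \<in> column_sets \<Longrightarrow> l' \<in> column_sets \<Longrightarrow> l \<noteq> l' \<Longrightarrow> \<not> set l \<subseteq> set l'"
  unfolding column_sets_def by (elim insertE emptyE; simp)

lemma increasing_column_set: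
  assumes "increasing y"
  shows "map y [0..<4] \<in> column_sets"
proof -
  have y: "y 0 < y 1" "y 1 < y 2" "y 2 < y 3" "y 3 < 6"
    using assms by (auto simp: increasing_def)
  have "y 0 \<in> {0, 1, 2}" "y 1 \<in> {1, 2, 3}" "y 2 \<in> {2, 3, 4}" "y 3 \<in> {3, 4, 5}"
    using y by auto
  moreover have "map y [0..<4] = [y 0, y 1, y 2, y 3]" by (simp add: upt_rec numeral_2_eq_2 numeral_3_eq_3)
  ultimately show ?thesis using y unfolding column_sets_def by (elim insertE emptyE; simp)
qed

section \<open>Secant varieties in terms of sums of decomposable tensors\<close>

context tensor_coords
begin

abbreviation X :: "('a \<times> 'b \<times> 'c \<Rightarrow> complex) set set"
  where "X \<equiv> segre sA sB sC"

abbreviation secants :: "nat \<Rightarrow> ('a \<times> 'b \<times> 'c \<Rightarrow> complex) set set"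
  where "secants r \<equiv> \<Union>{proj_span (set ps) | ps. length ps = r \<and> set ps \<subseteq> X}"

text \<open>A vector in the span combines generators of the \<open>r\<close> lines; each coefficient
  is absorbed into the factor on \<open>A\<close>.\<close>

lemma span_points_eq_sum:
  assumes "length ps = r" "set ps \<subseteq> X" "T \<in> lspan (\<Union>(set ps))"
  shows "\<exists>\<phi> \<psi> \<chi>. (\<forall>l<r. \<phi> l \<in> dual sA \<and> \<psi> l \<in> dual sB \<and> \<chi> l \<in> dual sC)
    \<and> T = (\<Sum>l<r. tprod (\<phi> l) (\<psi> l) (\<chi> l))"
proof -
  have "\<exists>\<phi> \<psi> \<chi>. \<phi> \<in> dual sA \<and> \<psi> \<in> dual sB \<and> \<chi> \<in> dual sC \<and> ps ! l = lspan {tprod \<phi> \<psi> \<chi>}"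
    if "l < r" for l
    using assms(1,2) nth_mem[of l ps] that unfolding segre_def by blast
  then obtain \<phi> \<psi> \<chi> where ps: "\<And>l. l < r \<Longrightarrow> \<phi> l \<in> dual sA \<and> \<psi> l \<in> dual sB \<and> \<chi> l \<in> dual sC
      \<and> ps ! l = lspan {tprod (\<phi> l) (\<psi> l) (\<chi> l)}" by metis
  let ?t = "\<lambda>l. tprod (\<phi> l) (\<psi> l) (\<chi> l)"
  let ?W = "range (\<lambda>k. \<Sum>l<r. fscale (k l) (?t l))"
  have W: "fun_space.subspace ?W"
    unfolding fun_space.subspace_def
  proof (intro conjI ballI allI)
    have "0 = (\<Sum>l<r. fscale 0 (?t l))" by (simp add: fun_eq_iff sum_fun_apply fscale_apply)
    then show "0 \<in> ?W" by (rule range_eqI[of _ _ "\<lambda>_. 0"])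
    fix x y assume "x \<in> ?W" "y \<in> ?W"
    then obtain k k' where "x = (\<Sum>l<r. fscale (k l) (?t l))" "y = (\<Sum>l<r. fscale (k' l) (?t l))" by blast
    then have "x + y = (\<Sum>l<r. fscale (k l + k' l) (?t l))"
      by (simp only: sum.distrib fun_space.scale_left_distrib)
    then show "x + y \<in> ?W" by (rule range_eqI[of _ _ "\<lambda>l. k l + k' l"])
  next
    fix c x assume "x \<in> ?W"
    then obtain k where "x = (\<Sum>l<r. fscale (k l) (?t l))" by blast
    then have "fscale c x = (\<Sum>l<r. fscale (c * k l) (?t l))"
      by (simp only: fun_space.scale_sum_right fun_space.scale_scale)
    then show "fscale c x \<in> ?W" by (rule range_eqI[of _ _ "\<lambda>l. c * k l"])
  qed
  have t: "?t l \<in> ?W" if "l < r" for l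
  proof (rule range_eqI[of _ _ "\<lambda>i. if i = l then 1 else 0"])
    have "(\<Sum>i<r. fscale (if i = l then 1 else 0) (?t i)) = (\<Sum>i<r. if i = l then ?t i else 0)"
      by (intro sum.cong) (auto simp: fun_eq_iff fscale_apply)
    also have "\<dots> = ?t l" using that by simp
    finally show "?t l = (\<Sum>i<r. fscale (if i = l then 1 else 0) (?t i))" by (rule sym)
  qed
  have "\<Union>(set ps) \<subseteq> ?W"
  proof clarify
    fix S x assume "S \<in> set ps" "x \<in> S"
    then obtain l where "l < r" "S = ps ! l" using assms(1) by (auto simp: in_set_conv_nth)
    then show "x \<in> ?W"
      using ps[of l] \<open>x \<in> S\<close> fun_space.span_minimal[OF _ W, of "{?t l}"] t by auto
  qed
  then have "T \<in> ?W" using assms(3) fun_space.span_minimal[OF _ W] by blast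
  then obtain k where T: "T = (\<Sum>l<r. tprod (fscale (k l) (\<phi> l)) (\<psi> l) (\<chi> l))"
    unfolding tprod_fscale(1) by blast
  show ?thesis
  proof (intro exI conjI allI impI)
    show "T = (\<Sum>l<r. tprod (fscale (k l) (\<phi> l)) (\<psi> l) (\<chi> l))" by (rule T)
  qed (use ps fun_space.subspace_scale[OF subspace_dual[OF A.vs]] in auto)
qed

lemma tprod_basis_nonzero: "\<alpha> 0 \<noteq> 0" "\<beta> 0 \<noteq> 0" "\<gamma> 0 \<noteq> 0" "tprod (\<alpha> 0) (\<beta> 0) (\<gamma> 0) \<noteq> 0"
proof -
  have *: "\<alpha> 0 (a 0) = 1" "\<beta> 0 (b 0) = 1" "\<gamma> 0 (c 0) = 1"
    by (simp_all add: A.coord_basis B.coord_basis C.coord_basis)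
  then show "\<alpha> 0 \<noteq> 0" "\<beta> 0 \<noteq> 0" "\<gamma> 0 \<noteq> 0" by (metis zero_fun_apply zero_neq_one)+
  have "tprod (\<alpha> 0) (\<beta> 0) (\<gamma> 0) (a 0, b 0, c 0) = 1" using * by (simp add: tprod_def)
  then show "tprod (\<alpha> 0) (\<beta> 0) (\<gamma> 0) \<noteq> 0" by (metis zero_fun_apply zero_neq_one)
qed

lemma sum_in_secants:
  assumes "r > 0" "\<And>l. l < r \<Longrightarrow> \<phi> l \<in> dual sA \<and> \<psi> l \<in> dual sB \<and> \<chi> l \<in> dual sC"
    and T: "T = (\<Sum>l<r. tprod (\<phi> l) (\<psi> l) (\<chi> l))" "T \<noteq> 0"
  shows "lspan {T} \<in> secants r"
proof -
  \<comment> \<open>A secant space is spanned by a list of \<open>r\<close> genuine points of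
    \<open>X\<close>; a summand with a zero factor defines no point and is replaced by a fixed
    one.\<close>
  define p where "p l = (if \<phi> l = 0 \<or> \<psi> l = 0 \<or> \<chi> l = 0
    then lspan {tprod (\<alpha> 0) (\<beta> 0) (\<gamma> 0)} else lspan {tprod (\<phi> l) (\<psi> l) (\<chi> l)})" for l
  have "p l \<in> X" if "l < r" for l
  proof (cases "\<phi> l = 0 \<or> \<psi> l = 0 \<or> \<chi> l = 0")
    case True
    have "\<alpha> 0 \<in> dual sA - {0}" "\<beta> 0 \<in> dual sB - {0}" "\<gamma> 0 \<in> dual sC - {0}"
      using tprod_basis_nonzero A.coord_dual B.coord_dual C.coord_dual by auto
    then show ?thesis using True unfolding p_def segre_def by auto
  next
    case False
    then show ?thesis using assms(2)[OF that] unfolding p_def segre_def by auto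
  qed
  then have ps: "length (map p [0..<r]) = r" "set (map p [0..<r]) \<subseteq> X" by auto
  have "tprod (\<phi> l) (\<psi> l) (\<chi> l) \<in> lspan (\<Union>(set (map p [0..<r])))" if "l < r" for l
  proof (cases "\<phi> l = 0 \<or> \<psi> l = 0 \<or> \<chi> l = 0")
    case True
    then have "tprod (\<phi> l) (\<psi> l) (\<chi> l) = 0" by (auto simp: fun_eq_iff tprod_def)
    then show ?thesis by (metis fun_space.span_zero)
  next
    case False
    then have "tprod (\<phi> l) (\<psi> l) (\<chi> l) \<in> p l" by (auto simp: p_def fun_space.span_base)
    then show ?thesis using that by (intro fun_space.span_base) auto
  qed
  then have "T \<in> lspan (\<Union>(set (map p [0..<r])))"
    unfolding T(1) by (intro fun_space.span_sum) auto
  then have "lspan {T} \<in> proj_span (set (map p [0..<r]))"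
    using T(2) unfolding proj_span_def proj_def by blast
  then show ?thesis using ps by blast
qed

lemma vanishes_on_secants_iff:
  assumes "r > 0"
  shows "vanishes_on f (secants r) \<longleftrightarrow> vanishes_on_sums r f"
proof
  assume f: "vanishes_on f (secants r)"
  show "vanishes_on_sums r f"
    unfolding vanishes_on_sums_def
  proof (intro allI impI)
    fix \<phi> :: "nat \<Rightarrow> 'a \<Rightarrow> complex" and \<psi> :: "nat \<Rightarrow> 'b \<Rightarrow> complex" and \<chi> :: "nat \<Rightarrow> 'c \<Rightarrow> complex"
    assume duals: "\<forall>l<r. \<phi> l \<in> dual sA \<and> \<psi> l \<in> dual sB \<and> \<chi> l \<in> dual sC"
    let ?T = "\<Sum>l<r. tprod (\<phi> l) (\<psi> l) (\<chi> l)"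
    show "f ?T = 0"
    proof (cases "?T = 0")
      case False
      then have "lspan {?T} \<in> secants r"
        using sum_in_secants[OF assms _ refl] duals by blast
      moreover have "?T \<in> lspan {?T}" by (simp add: fun_space.span_base)
      ultimately show ?thesis using f unfolding vanishes_on_def by blast
    next
      case True
      \<comment> \<open>The zero tensor lies on every projective point, so it is enough to exhibit
        one point of the secant set.\<close>
      let ?p = "lspan {tprod (\<alpha> 0) (\<beta> 0) (\<gamma> 0)}"
      let ?\<phi> = "\<lambda>l :: nat. if l = 0 then \<alpha> 0 else 0"
      have "(\<Sum>l<r. tprod (?\<phi> l) (\<beta> 0) (\<gamma> 0)) = (\<Sum>l<r. if l = 0 then tprod (\<alpha> 0) (\<beta> 0) (\<gamma> 0) else 0)"
        by (intro sum.cong) (auto simp: tprod_def fun_eq_iff)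
      then have "tprod (\<alpha> 0) (\<beta> 0) (\<gamma> 0) = (\<Sum>l<r. tprod (?\<phi> l) (\<beta> 0) (\<gamma> 0))" using assms by simp
      moreover have "?\<phi> l \<in> dual sA \<and> \<beta> 0 \<in> dual sB \<and> \<gamma> 0 \<in> dual sC" for l
        using A.coord_dual B.coord_dual C.coord_dual fun_space.subspace_0[OF subspace_dual[OF A.vs]] by auto
      ultimately have "?p \<in> secants r"
        using tprod_basis_nonzero(4) sum_in_secants[OF assms, of ?\<phi> "\<lambda>_. \<beta> 0" "\<lambda>_. \<gamma> 0"] by blast
      moreover have "?T \<in> ?p" unfolding True by (rule fun_space.span_zero)
      ultimately show ?thesis using f unfolding vanishes_on_def by blast
    qed
  qed
next
  assume f: "vanishes_on_sums r f"
  show "vanishes_on f (secants r)"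
    unfolding vanishes_on_def
  proof (intro ballI)
    fix p T assume "p \<in> secants r" "T \<in> p"
    then obtain ps v where ps: "length ps = r" "set ps \<subseteq> X" and v: "v \<in> lspan (\<Union>(set ps))" "p = lspan {v}"
      unfolding proj_span_def proj_def by blast
    have "lspan {v} \<subseteq> lspan (\<Union>(set ps))"
      using v(1) by (intro fun_space.span_minimal fun_space.subspace_span) simp
    then have "T \<in> lspan (\<Union>(set ps))" using v(2) \<open>T \<in> p\<close> by blast
    then show "f T = 0"
      using span_points_eq_sum[OF ps] f unfolding vanishes_on_sums_def by blast
  qed
qed

lemma secants_subset_proj: "secants r \<subseteq> proj V"
proof
  fix p assume "p \<in> secants r"
  then obtain ps v where ps: "set ps \<subseteq> X" and v: "v \<in> lspan (\<Union>(set ps))" "v \<noteq> 0" "p = lspan {v}"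
    unfolding proj_span_def proj_def by blast
  have "S \<subseteq> V" if S: "S \<in> X" for S
  proof -
    obtain \<phi> \<psi> \<chi> where "\<phi> \<in> dual sA" "\<psi> \<in> dual sB" "\<chi> \<in> dual sC" "S = lspan {tprod \<phi> \<psi> \<chi>}"
      using S unfolding segre_def by blast
    then show ?thesis using tprod_in_V subspace_V fun_space.span_minimal[of "{tprod \<phi> \<psi> \<chi>}" V] by simp
  qed
  then have "lspan (\<Union>(set ps)) \<subseteq> V"
    using ps subspace_V by (intro fun_space.span_minimal) blast+
  then show "p \<in> proj V" using v unfolding proj_def by blast
qed

text \<open>The zero set of the single form \<open>f\<close> in \<open>proj V\<close> is Zariski
  closed, so once it contains the secant points it contains their closure.\<close>

lemma vanishes_on_secant_variety_iff:
  assumes "r > 0" "f \<in> sym_power V d"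
  shows "vanishes_on f (secant_variety V r X) \<longleftrightarrow> vanishes_on_sums r f"
proof
  assume "vanishes_on f (secant_variety V r X)"
  then have "vanishes_on f (secants r)"
    using hull_subset[of "secants r" "zariski_closed V"] unfolding vanishes_on_def secant_variety_def by blast
  then show "vanishes_on_sums r f" using vanishes_on_secants_iff[OF assms(1)] by blast
next
  assume "vanishes_on_sums r f"
  then have f: "vanishes_on f (secants r)" using vanishes_on_secants_iff[OF assms(1)] by blast
  let ?Y = "{p \<in> proj V. \<forall>g\<in>{f}. vanishes_on g {p}}"
  have "zariski_closed V ?Y"
    unfolding zariski_closed_def using assms(2) by (intro exI[of _ "{f}"]) auto
  moreover have "secants r \<subseteq> ?Y"
    using f secants_subset_proj[of r] unfolding vanishes_on_def by blast
  ultimately have "secant_variety V r X \<subseteq> ?Y"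
    unfolding secant_variety_def by (intro hull_minimal)
  then show "vanishes_on f (secant_variety V r X)" unfolding vanishes_on_def by blast
qed

text \<open>Each equation of a closed set containing the secants vanishes on sums of four
  decomposable tensors, hence is 0, and the closed set is everything.\<close>

lemma secant_variety_4: "secant_variety V 4 X = proj V"
proof
  have "zariski_closed V (proj V)"
    unfolding zariski_closed_def by (intro exI[of _ "{}"]) auto
  then show "secant_variety V 4 X \<subseteq> proj V"
    unfolding secant_variety_def using secants_subset_proj by (intro hull_minimal)
  have "proj V \<subseteq> Y" if Y: "zariski_closed V Y" "secants 4 \<subseteq> Y" for Y
  proof -
    obtain F where F: "F \<subseteq> (\<Union>d. sym_power V d)" "Y = {p \<in> proj V. \<forall>f\<in>F. vanishes_on f {p}}"
      using Y(1) unfolding zariski_closed_def by blast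
    have "f = 0" if f: "f \<in> F" for f
    proof -
      have "vanishes_on f (secants 4)" using f F(2) Y(2) unfolding vanishes_on_def by blast
      then have "vanishes_on_sums 4 f" using vanishes_on_secants_iff[of 4 f] by simp
      moreover obtain d where "f \<in> sym_power V d" using f F(1) by blast
      ultimately show ?thesis using vanishes_on_sums_4 by blast
    qed
    then have "f T = 0" if "f \<in> F" for f T using that by (metis zero_fun_apply)
    then show ?thesis using F(2) by (auto simp: vanishes_on_def)
  qed
  then show "proj V \<subseteq> secant_variety V 4 X"
    unfolding secant_variety_def hull_def by blast
qed

text \<open>The coordinate vectors of the three forms \<open>\<chi> l\<close> have a common nonzero
  annihilator \<open>v\<close> in dimension 4, and \<open>v\<close> is a linear relation between the
  rows of the matrix of the tensor.\<close>

lemma minor_vanishes_on_sums_3: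
  assumes "increasing y"
  shows "vanishes_on_sums 3 (minor y)"
  unfolding vanishes_on_sums_def
proof (intro allI impI)
  fix \<phi> :: "nat \<Rightarrow> 'a \<Rightarrow> complex" and \<psi> :: "nat \<Rightarrow> 'b \<Rightarrow> complex" and \<chi> :: "nat \<Rightarrow> 'c \<Rightarrow> complex"
  assume duals: "\<forall>l<3. \<phi> l \<in> dual sA \<and> \<psi> l \<in> dual sB \<and> \<chi> l \<in> dual sC"
  let ?T = "\<Sum>l<3. tprod (\<phi> l) (\<psi> l) (\<chi> l)"
  have "?T \<in> V" using duals tprod_in_V subspace_V by (auto intro!: fun_space.subspace_sum)
  \<comment> \<open>A zero row makes the 3 by 4 system square and singular.\<close>
  define M where "M = mat 4 4 (\<lambda>(l, r). if l = 3 then 0 else \<chi> l (c r))"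
  have M: "M \<in> carrier_mat 4 4" by (simp add: M_def)
  have "unit_vec 4 3 \<noteq> (0\<^sub>v 4 :: complex vec)"
    by (rule unit_vec_nonzero) simp
  moreover have "M\<^sup>T *\<^sub>v unit_vec 4 3 = 0\<^sub>v 4"
    by (intro eq_vecI) (auto simp: M_def scalar_prod_right_unit)
  ultimately have "det M\<^sup>T = 0"
    using det_0_iff_vec_prod_zero[of "M\<^sup>T" 4] M by (metis transpose_carrier_mat unit_vec_carrier)
  then have "det M = 0" using det_transpose[OF M] by simp
  then obtain v where v: "v \<in> carrier_vec 4" "v \<noteq> 0\<^sub>v 4" "M *\<^sub>v v = 0\<^sub>v 4"
    using det_0_iff_vec_prod_zero[OF M] by blast
  then obtain r0 where r0: "r0 < 4" "v $ r0 \<noteq> 0"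
    by (metis carrier_vecD eq_vecI index_zero_vec)
  have rel: "(\<Sum>r<4. v $ r * \<chi> l (c r)) = 0" if "l < 3" for l
  proof -
    have "(M *\<^sub>v v) $ l = 0" using v(3) that by simp
    then show ?thesis
      using that v(1) by (simp add: M_def scalar_prod_def atLeast0LessThan mult.commute)
  qed
  have "(\<Sum>r<4. v $ r * crd ?T (r, j)) = 0" if "j < 6" for j
  proof -
    have "(\<Sum>r<4. v $ r * crd ?T (r, j)) =
      (\<Sum>r<4. \<Sum>l<3. (\<phi> l (a (j div 3)) * \<psi> l (b (j mod 3))) * (v $ r * \<chi> l (c r)))"
      by (simp add: crd_sum crd_tprod sum_distrib_left mult_ac)
    also have "\<dots> = (\<Sum>l<3. (\<phi> l (a (j div 3)) * \<psi> l (b (j mod 3))) * (\<Sum>r<4. v $ r * \<chi> l (c r)))"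
      by (subst sum.swap) (simp add: sum_distrib_left)
    also have "\<dots> = 0" using rel by simp
    finally show ?thesis .
  qed
  then have "minor y (tens (crd ?T)) = 0"
    using assms r0 by (intro minor_tens_eq_0[of y r0 "\<lambda>r. v $ r"]) (auto simp: increasing_def)
  then show "minor y ?T = 0" using tens_crd[OF \<open>?T \<in> V\<close>] by simp
qed

lemma ideal_part_eq: "ideal_part V (secant_variety V 3 X) d = minor_ideal d"
proof
  show "ideal_part V (secant_variety V 3 X) d \<subseteq> minor_ideal d"
    using vanishes_on_secant_variety_iff[of 3] vanishes_on_low_rank vanishing_in_minor_ideal
    unfolding ideal_part_def by auto
  have "fun_space.subspace {f \<in> sym_power V d. vanishes_on_sums 3 f}"
    using subspace_sym_power[of d] unfolding fun_space.subspace_def vanishes_on_sums_def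
    by (auto simp: fscale_apply)
  moreover have "mono \<nu> * minor y \<in> {f \<in> sym_power V d. vanishes_on_sums 3 f}"
    if "size \<nu> + 4 = d" "set_mset \<nu> \<subseteq> box" "increasing y" for \<nu> y
    using that mono_mult_minor_in_sym_power[of \<nu> y] minor_vanishes_on_sums_3[of y]
    by (auto simp: increasing_def vanishes_on_sums_def)
  ultimately have "minor_ideal d \<subseteq> {f \<in> sym_power V d. vanishes_on_sums 3 f}"
    unfolding minor_ideal_def by (intro fun_space.span_minimal) auto
  then show "minor_ideal d \<subseteq> ideal_part V (secant_variety V 3 X) d"
    using vanishes_on_secant_variety_iff[of 3] unfolding ideal_part_def by auto
qed

section \<open>The fifteen maximal minors and generation in degree 4\<close>

lemma minor_cong: "(\<And>i. i < 4 \<Longrightarrow> y i = z i) \<Longrightarrow> minor y = minor z"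
  unfolding minor_def by (auto simp: fun_eq_iff permutes_less_4 intro!: sum.cong prod.cong)

abbreviation minors :: "(('a \<times> 'b \<times> 'c \<Rightarrow> complex) \<Rightarrow> complex) set"
  where "minors \<equiv> (\<lambda>l. minor ((!) l)) ` column_sets"

lemma minor_ideal_4: "minor_ideal 4 = lspan minors"
proof -
  have "mono {#} * minor y = minor y" for y
    by (auto simp: fun_eq_iff mono_def minor_def)
  then have "{mono \<nu> * minor y |\<nu> y. size \<nu> + 4 = 4 \<and> set_mset \<nu> \<subseteq> box \<and> increasing y} = minor ` {y. increasing y}"
    by auto
  also have "\<dots> = minors"
  proof (intro equalityI subsetI)
    fix f assume "f \<in> minor ` {y. increasing y}"
    then obtain y where y: "f = minor y" "increasing y" by blast
    have "f = minor ((!) (map y [0..<4]))" unfolding y(1) by (intro minor_cong) simp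
    then show "f \<in> minors" using increasing_column_set[OF y(2)] by blast
  qed (use column_sets_props(4) in blast)
  finally show ?thesis by (simp add: minor_ideal_def)
qed

text \<open>The test matrix is the identity in the columns \<open>l'\<close> and 0 elsewhere. A
  Leibniz term with columns from \<open>l\<close> is nonzero only if it matches \<open>l'\<close>
  row by row, which forces \<open>l = l'\<close> and the identity permutation.\<close>

lemma minor_unit_matrix:
  assumes "l \<in> column_sets" "l' \<in> column_sets"
  shows "minor ((!) l) (tens (\<lambda>(r, j). if l' ! r = j then 1 else 0)) = (if l = l' then 1 else 0)"
proof -
  note l = column_sets_props[OF assms(1)] and l' = column_sets_props[OF assms(2)]
  let ?P = "{\<sigma>. \<sigma> permutes {..<4 :: nat}}"
  have "crd (tens (\<lambda>(r, j). if l' ! r = j then 1 else 0)) (r, l ! \<sigma> r) = (if l' ! r = l ! \<sigma> r then 1 else 0)"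
    if "\<sigma> \<in> ?P" "r < 4" for \<sigma> r
  proof -
    have "l ! \<sigma> r \<in> set l"
      using that l(1) permutes_less_4[of \<sigma> r] by (intro nth_mem) auto
    then have "l ! \<sigma> r < 6" using l(3) by auto
    then show ?thesis using that by (subst crd_tens) (auto simp: box_def)
  qed
  then have eq: "minor ((!) l) (tens (\<lambda>(r, j). if l' ! r = j then 1 else 0)) =
      (\<Sum>\<sigma>\<in>?P. of_int (sign \<sigma>) * (\<Prod>r<4. if l' ! r = l ! \<sigma> r then 1 else 0))"
    unfolding minor_def if_P[OF tens_in_V] by (intro sum.cong prod.cong arg_cong2[of _ _ _ _ "(*)"] refl) auto
  have zero: "(\<Prod>r<4. if l' ! r = l ! \<sigma> r then 1 else 0 :: complex) = 0"
    if \<sigma>: "\<sigma> \<in> ?P" "l \<noteq> l' \<or> \<sigma> \<noteq> id" for \<sigma>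
  proof -
    have "\<exists>r<4. l' ! r \<noteq> l ! \<sigma> r"
    proof (cases "l = l'")
      case True
      then obtain r where "\<sigma> r \<noteq> r" using \<sigma>(2) by (auto simp: fun_eq_iff)
      moreover from this have "r < 4" using \<sigma>(1) permutes_not_in[of \<sigma> "{..<4}" r] by auto
      ultimately show ?thesis
        using True l \<sigma>(1) permutes_less_4[of \<sigma> r] by (metis mem_Collect_eq nth_eq_iff_index_eq)
    next
      case False
      then obtain x where "x \<in> set l'" "x \<notin> set l" using column_sets_separated[of l' l] assms by blast
      then obtain r where "r < 4" "l' ! r = x" using l'(1) by (metis in_set_conv_nth)
      then show ?thesis using \<open>x \<notin> set l\<close> l(1) \<sigma>(1) permutes_less_4[of \<sigma> r] by (metis mem_Collect_eq nth_mem)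
    qed
    then show ?thesis by (auto intro!: prod_zero)
  qed
  show ?thesis
  proof (cases "l = l'")
    case False
    have "(\<Sum>\<sigma>\<in>?P. of_int (sign \<sigma>) * (\<Prod>r<4. if l' ! r = l ! \<sigma> r then 1 else 0)) = (0 :: complex)"
    proof (intro sum.neutral ballI)
      fix \<sigma> assume "\<sigma> \<in> ?P"
      then have "(\<Prod>r<4. if l' ! r = l ! \<sigma> r then 1 else 0 :: complex) = 0" using zero False by blast
      then show "of_int (sign \<sigma>) * (\<Prod>r<4. if l' ! r = l ! \<sigma> r then 1 else 0 :: complex) = 0"
        by (simp only: mult_zero_right)
    qed
    then show ?thesis unfolding eq using False by simp
  next
    case True
    have "(\<Sum>\<sigma>\<in>?P. of_int (sign \<sigma>) * (\<Prod>r<4. if l' ! r = l ! \<sigma> r then 1 else 0)) =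
      (\<Sum>\<sigma>\<in>?P. if \<sigma> = id then 1 else 0 :: complex)"
      using True zero by (intro sum.cong) (auto simp: sign_id)
    then show ?thesis unfolding eq using True by (simp add: finite_permutations permutes_id)
  qed
qed

lemma independent_minors: "fun_space.independent minors"
  and inj_minors: "inj_on (\<lambda>l. minor ((!) l)) column_sets"
  using independent_if_dual_points[of column_sets "\<lambda>l. minor ((!) l)"
      "\<lambda>l'. tens (\<lambda>(r, j). if l' ! r = j then 1 else 0)"] minor_unit_matrix
  by (auto simp: column_sets_def)

lemma card_minors: "card minors = 15"
  by (simp add: card_image[OF inj_minors] card_column_sets)

lemma dim_minor_ideal_4: "fun_space.dim (minor_ideal 4) = 15"
  unfolding minor_ideal_4 using fun_space.dim_span_eq_card_independent[OF independent_minors] card_minors by simp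

text \<open>The pieces \<open>minor_ideal d\<close> are spanned by monomial multiples of minors by
  definition; as they are the pieces of the vanishing ideal, only bilinearity of the product
  remains.\<close>

lemma generated_ideal_eq:
  "generated_ideal V (minor_ideal 4) = homogeneous_ideal V (secant_variety V 3 X)"
proof
  have minor: "minor y \<in> minor_ideal 4" if "increasing y" for y
  proof -
    have "mono {#} * minor y = minor y" by (auto simp: fun_eq_iff mono_def minor_def)
    moreover have "mono {#} * minor y \<in> minor_ideal 4"
      unfolding minor_ideal_def using that
      by (intro fun_space.span_base CollectI exI[of _ "{#}"] exI[of _ y]) simp
    ultimately show ?thesis by (simp only:)
  qed
  have "g * f \<in> lspan (\<Union>d. minor_ideal d)" if "g \<in> sym_algebra V" "f \<in> minor_ideal 4" for g f
  proof (rule span_mult)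
    show "g \<in> lspan {mono \<mu> |\<mu>. set_mset \<mu> \<subseteq> box}" using that(1) by (simp add: sym_algebra_eq)
    show "f \<in> lspan minors" using that(2) by (simp add: minor_ideal_4)
    fix x y assume "x \<in> {mono \<mu> |\<mu>. set_mset \<mu> \<subseteq> box}" "y \<in> minors"
    then obtain \<mu> l where "x = mono \<mu>" "set_mset \<mu> \<subseteq> box" "y = minor ((!) l)" "increasing ((!) l)"
      using column_sets_props(4) by blast
    then have "x * y \<in> minor_ideal (size \<mu> + 4)"
      unfolding minor_ideal_def by (intro fun_space.span_base) blast
    then show "x * y \<in> lspan (\<Union>d. minor_ideal d)" by (intro fun_space.span_base) blast
  qed
  then show "generated_ideal V (minor_ideal 4) \<subseteq> homogeneous_ideal V (secant_variety V 3 X)"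
    unfolding generated_ideal_def homogeneous_ideal_def ideal_part_eq
    by (intro fun_space.span_minimal fun_space.subspace_span) blast
  have "minor_ideal d \<subseteq> generated_ideal V (minor_ideal 4)" for d
    unfolding minor_ideal_def[of d]
  proof (rule fun_space.span_minimal)
    show "fun_space.subspace (generated_ideal V (minor_ideal 4))"
      by (simp add: generated_ideal_def fun_space.subspace_span)
    show "{mono \<nu> * minor y |\<nu> y. size \<nu> + 4 = d \<and> set_mset \<nu> \<subseteq> box \<and> increasing y}
        \<subseteq> generated_ideal V (minor_ideal 4)"
    proof clarify
      fix \<nu> y assume \<nu>: "set_mset \<nu> \<subseteq> box" and y: "increasing y"
      have "mono \<nu> \<in> sym_algebra V"
        unfolding sym_algebra_eq using \<nu> by (intro fun_space.span_base) blast
      then show "mono \<nu> * minor y \<in> generated_ideal V (minor_ideal 4)"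
        unfolding generated_ideal_def using minor[OF y] by (intro fun_space.span_base) blast
    qed
  qed
  then show "homogeneous_ideal V (secant_variety V 3 X) \<subseteq> generated_ideal V (minor_ideal 4)"
    unfolding homogeneous_ideal_def ideal_part_eq
    by (intro fun_space.span_minimal) (auto simp: generated_ideal_def fun_space.subspace_span)
qed

end

section \<open>Young symmetrizers of degree 4\<close>

lemma fun_linear_iff:
  "Vector_Spaces.linear fscale fscale F \<longleftrightarrow>
    (\<forall>x y. F (x + y) = F x + F y) \<and> (\<forall>k x. F (fscale k x) = fscale k (F x))"
  by (auto simp: Vector_Spaces.linear_iff fun_space.vector_space_axioms)

lemma linear_image_span:
  assumes "Vector_Spaces.linear fscale fscale F"
  shows "F ` lspan S = lspan (F ` S)"
  using module_hom.span_image[OF Vector_Spaces.linear.axioms(3)[OF assms]] by simp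

text \<open>Trilinearity, used one factor at a time: with the other two arguments fixed, the
  admissible values of one argument form a subspace.\<close>

lemma tensor3_span:
  "tensor3 (lspan S) (lspan S') (lspan S'') =
    lspan {tprod f g h |f g h. f \<in> S \<and> g \<in> S' \<and> h \<in> S''}" (is "_ = lspan ?B")
proof
  have zero: "tprod 0 g h = 0" "tprod f 0 h = 0" "tprod f g 0 = 0" for f :: "'a \<Rightarrow> complex" and g :: "'b \<Rightarrow> complex" and h :: "'c \<Rightarrow> complex"
    by (simp_all add: tprod_def fun_eq_iff)
  have sub: "fun_space.subspace {f. tprod f g h \<in> lspan ?B}"
    "fun_space.subspace {g. tprod f g h \<in> lspan ?B}"
    "fun_space.subspace {h. tprod f g h \<in> lspan ?B}" for f g h
    unfolding fun_space.subspace_def mem_Collect_eq tprod_add tprod_fscale zero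
    using fun_space.span_add[of _ ?B] fun_space.span_scale[of _ ?B] fun_space.span_zero[of ?B] by blast+
  have "lspan S \<subseteq> {f. tprod f g h \<in> lspan ?B}" if "g \<in> S'" "h \<in> S''" for g h
    using that by (intro fun_space.span_minimal sub) (blast intro: fun_space.span_base)
  then have "lspan S' \<subseteq> {g. tprod f g h \<in> lspan ?B}" if "f \<in> lspan S" "h \<in> S''" for f h
    using that by (intro fun_space.span_minimal sub) blast
  then have "lspan S'' \<subseteq> {h. tprod f g h \<in> lspan ?B}" if "f \<in> lspan S" "g \<in> lspan S'" for f g
    using that by (intro fun_space.span_minimal sub) blast
  then show "tensor3 (lspan S) (lspan S') (lspan S'') \<subseteq> lspan ?B"
    unfolding tensor3_def by (intro fun_space.span_minimal fun_space.subspace_span) blast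
  show "lspan ?B \<subseteq> tensor3 (lspan S) (lspan S') (lspan S'')"
    unfolding tensor3_def by (rule fun_space.span_mono) (blast intro: fun_space.span_base)
qed

text \<open>Decomposable tensors of degree 4 in the encoding of \<open>tensor_power\<close>,
  including its value 0 as soon as one of the four arguments is not linear.\<close>

definition pure :: "(complex \<Rightarrow> 'v \<Rightarrow> 'v::ab_group_add) \<Rightarrow> (nat \<Rightarrow> 'v) \<Rightarrow> (nat \<Rightarrow> 'v \<Rightarrow> complex) \<Rightarrow> complex"
  where "pure s v = (\<lambda>\<phi>. if \<forall>i<4. \<phi> i \<in> dual s then \<Prod>i<4. \<phi> i (v i) else 0)"

abbreviation pr :: "(complex \<Rightarrow> 'v \<Rightarrow> 'v::ab_group_add) \<Rightarrow> 'v \<Rightarrow> 'v \<Rightarrow> 'v \<Rightarrow> 'v \<Rightarrow> (nat \<Rightarrow> 'v \<Rightarrow> complex) \<Rightarrow> complex"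
  where "pr s v0 v1 v2 v3 \<equiv> pure s ((!) [v0, v1, v2, v3])"

lemma lessThan_4: "{..<4} = {0, 1, 2, 3 :: nat}"
  by auto

lemma all_less_4: "(\<forall>i<4. P i) \<longleftrightarrow> P 0 \<and> P 1 \<and> P 2 \<and> P (3 :: nat)"
  using lessThan_4 by (metis insertCI insertE lessThan_iff singletonD)

lemma pure_cong: "(\<And>i. i < 4 \<Longrightarrow> v i = w i) \<Longrightarrow> pure s v = pure s w"
  unfolding pure_def by (auto simp: fun_eq_iff intro!: prod.cong)

lemma pure_eq_pr: "pure s v = pr s (v 0) (v 1) (v 2) (v 3)"
  by (rule pure_cong) (auto simp: less_Suc_eq numeral_eq_Suc)

lemma pr_apply: "pr s v0 v1 v2 v3 \<phi> =
  (if \<phi> 0 \<in> dual s \<and> \<phi> 1 \<in> dual s \<and> \<phi> 2 \<in> dual s \<and> \<phi> 3 \<in> dual s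
   then \<phi> 0 v0 * \<phi> 1 v1 * \<phi> 2 v2 * \<phi> 3 v3 else 0)"
  unfolding pure_def all_less_4 by (simp add: lessThan_4 numeral_2_eq_2 numeral_3_eq_3)

lemma tensor_power_4: "tensor_power s 4 = lspan (range (pure s))"
  by (simp add: tensor_power_def pure_def)

lemma linear_young_symmetrizer: "Vector_Spaces.linear fscale fscale (young_symmetrizer \<pi>)"
  unfolding fun_linear_iff young_symmetrizer_def
  by (auto simp: fun_eq_iff fscale_apply sum.distrib sum_distrib_left algebra_simps)

lemma schur_eq_span:
  "sum_list \<pi> = 4 \<Longrightarrow> schur \<pi> s = lspan (young_symmetrizer \<pi> ` range (pure s))"
  unfolding schur_def by (simp add: tensor_power_4 linear_image_span[OF linear_young_symmetrizer])

lemma (in coord_space) span_pure: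
  "lspan (range (pure s)) = lspan {pr s (e i0) (e i1) (e i2) (e i3) |i0 i1 i2 i3. i0 < n \<and> i1 < n \<and> i2 < n \<and> i3 < n}"
    (is "_ = lspan ?B")
proof
  have "pure s v \<in> lspan ?B" for v
  proof -
    let ?G = "PiE {..<4} (\<lambda>_. {..<n}) :: (nat \<Rightarrow> nat) set"
    have "pure s v \<phi> = (\<Sum>g\<in>?G. fscale (\<Prod>i<4. \<epsilon> (g i) (v i)) (pure s (\<lambda>i. e (g i)))) \<phi>" for \<phi>
    proof (cases "\<forall>i<4. \<phi> i \<in> dual s")
      case True
      have "(\<Prod>i<4. \<phi> i (v i)) = (\<Prod>i<4. \<Sum>l<n. \<epsilon> l (v i) * \<phi> i (e l))"
        using True by (intro prod.cong refl dual_expansion) auto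
      also have "\<dots> = (\<Sum>g\<in>?G. \<Prod>i<4. \<epsilon> (g i) (v i) * \<phi> i (e (g i)))"
        by (subst prod_sum_PiE) auto
      finally show ?thesis
        using True by (simp add: pure_def sum_fun_apply fscale_apply prod.distrib)
    next
      case False
      then have "pure s w \<phi> = 0" for w by (simp only: pure_def if_False)
      then show ?thesis by (simp add: sum_fun_apply fscale_apply)
    qed
    then have eq: "pure s v = (\<Sum>g\<in>?G. fscale (\<Prod>i<4. \<epsilon> (g i) (v i)) (pure s (\<lambda>i. e (g i))))" by blast
    have "pure s (\<lambda>i. e (g i)) \<in> ?B" if "g \<in> ?G" for g
    proof -
      have "g 0 < n" "g 1 < n" "g 2 < n" "g 3 < n" using that by (auto simp: PiE_iff)
      then show ?thesis by (subst pure_eq_pr) blast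
    qed
    then show ?thesis unfolding eq by (intro fun_space.span_sum fun_space.span_scale fun_space.span_base)
  qed
  then show "lspan (range (pure s)) \<subseteq> lspan ?B"
    by (intro fun_space.span_minimal fun_space.subspace_span) blast
  show "lspan ?B \<subseteq> lspan (range (pure s))"
    by (rule fun_space.span_mono) blast
qed

lemma (in coord_space) schur_eq_span_basis:
  assumes "sum_list \<pi> = 4"
  shows "schur \<pi> s = lspan {young_symmetrizer \<pi> (pr s (e i0) (e i1) (e i2) (e i3)) |i0 i1 i2 i3.
    i0 < n \<and> i1 < n \<and> i2 < n \<and> i3 < n}"
proof -
  let ?B = "{pr s (e i0) (e i1) (e i2) (e i3) |i0 i1 i2 i3. i0 < n \<and> i1 < n \<and> i2 < n \<and> i3 < n}"
  have "schur \<pi> s = young_symmetrizer \<pi> ` lspan (range (pure s))"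
    by (rule trans[OF schur_eq_span[OF assms] linear_image_span[OF linear_young_symmetrizer, symmetric]])
  also have "\<dots> = young_symmetrizer \<pi> ` lspan ?B"
    by (rule arg_cong[OF span_pure])
  also have "\<dots> = lspan (young_symmetrizer \<pi> ` ?B)"
    by (rule linear_image_span[OF linear_young_symmetrizer])
  also have "young_symmetrizer \<pi> ` ?B = {young_symmetrizer \<pi> (pr s (e i0) (e i1) (e i2) (e i3)) |i0 i1 i2 i3.
    i0 < n \<and> i1 < n \<and> i2 < n \<and> i3 < n}" by blast
  finally show ?thesis .
qed

text \<open>Every permutation of four letters is uniquely a product of possibly trivial
  transpositions moving 0, 1 and 2 upwards; this makes sums over the group computable by
  rewriting.\<close>

lemma sum_permutes_4: "(\<Sum>p | p permutes {..<4}. f p) =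
  (\<Sum>b\<in>{0, 1, 2, 3}. \<Sum>c\<in>{1, 2, 3}. \<Sum>d\<in>{2, 3 :: nat}. f (transpose 0 b \<circ> (transpose 1 c \<circ> transpose 2 d)))"
proof -
  have 3: "{p. p permutes {3 :: nat}} = {id}" by (auto simp: permutes_sing)
  have "(\<Sum>p | p permutes {2, 3}. g p) = (\<Sum>d\<in>{2, 3 :: nat}. g (transpose 2 d))" for g :: "_ \<Rightarrow> 'a"
    by (subst sum_over_permutations_insert) (simp_all add: 3)
  moreover have "(\<Sum>p | p permutes {1, 2, 3}. g p) = (\<Sum>c\<in>{1, 2, 3 :: nat}. \<Sum>p | p permutes {2, 3}. g (transpose 1 c \<circ> p))" for g :: "_ \<Rightarrow> 'a"
    by (rule sum_over_permutations_insert) auto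
  moreover have "(\<Sum>p | p permutes {0, 1, 2, 3}. g p) = (\<Sum>b\<in>{0, 1, 2, 3 :: nat}. \<Sum>p | p permutes {1, 2, 3}. g (transpose 0 b \<circ> p))" for g :: "_ \<Rightarrow> 'a"
    by (rule sum_over_permutations_insert) auto
  ultimately show ?thesis by (simp only: lessThan_4)
qed

lemma young_pure_not_dual:
  assumes "sum_list \<pi> = 4" "\<not> (\<forall>i<4. \<phi> i \<in> dual s)"
  shows "young_symmetrizer \<pi> (pure s v) \<phi> = 0"
  unfolding young_symmetrizer_def
proof (intro sum.neutral ballI)
  fix p q assume "p \<in> row_group \<pi>" "q \<in> col_group \<pi>"
  then have pq: "p \<circ> q permutes {..<4}"
    using assms(1) by (auto simp: row_group_def col_group_def permutes_compose)
  have "\<not> (\<forall>i<4. (\<phi> \<circ> (p \<circ> q)) i \<in> dual s)"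
  proof
    assume all: "\<forall>i<4. (\<phi> \<circ> (p \<circ> q)) i \<in> dual s"
    have "\<phi> i \<in> dual s" if "i < 4" for i
    proof -
      obtain j where j: "i = (p \<circ> q) j" using permutes_surj[OF pq] by blast
      then have "j < 4" using permutes_in_image[OF pq, of j] \<open>i < 4\<close> by simp
      then show ?thesis using all j by simp
    qed
    then show False using assms(2) by blast
  qed
  then have "pure s v (\<phi> \<circ> (p \<circ> q)) = 0" by (simp only: pure_def if_False)
  then show "of_int (sign q) * pure s v (\<phi> \<circ> (p \<circ> q)) = 0" by simp
qed

text \<open>An explicit combination \<open>r\<close> of decomposable tensors has to be compared at
  linear forms only; elsewhere both sides are 0, since permuting the places does not affect whether
  all four arguments are linear.\<close>

lemma young_eqI:
  fixes s :: "complex \<Rightarrow> 'v \<Rightarrow> 'v::ab_group_add"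
  assumes "sum_list \<pi> = 4"
    and dual: "\<And>\<phi>. \<phi> 0 \<in> dual s \<Longrightarrow> \<phi> 1 \<in> dual s \<Longrightarrow> \<phi> 2 \<in> dual s \<Longrightarrow> \<phi> 3 \<in> dual s \<Longrightarrow>
      young_symmetrizer \<pi> (pr s v0 v1 v2 v3) \<phi> = r \<phi>"
    and other: "\<And>\<phi>. (\<And>w0 w1 w2 w3. pr s w0 w1 w2 w3 \<phi> = 0) \<Longrightarrow> r \<phi> = 0"
  shows "young_symmetrizer \<pi> (pr s v0 v1 v2 v3) = r"
proof
  fix \<phi> :: "nat \<Rightarrow> 'v \<Rightarrow> complex"
  show "young_symmetrizer \<pi> (pr s v0 v1 v2 v3) \<phi> = r \<phi>"
  proof (cases "\<phi> 0 \<in> dual s \<and> \<phi> 1 \<in> dual s \<and> \<phi> 2 \<in> dual s \<and> \<phi> 3 \<in> dual s")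
    case True
    then show ?thesis using dual by blast
  next
    case False
    then have "young_symmetrizer \<pi> (pr s v0 v1 v2 v3) \<phi> = 0"
      by (intro young_pure_not_dual assms(1)) (simp add: all_less_4 del: One_nat_def)
    moreover have "r \<phi> = 0" using False by (intro other) (auto simp: pr_apply)
    ultimately show ?thesis by simp
  qed
qed

section \<open>Canonical tableaux and explicit Young symmetrizers\<close>

lemma row_of_Cons:
  assumes "i < x + sum_list \<pi>"
  shows "row_of (x # \<pi>) i = (if i < x then 0 else Suc (row_of \<pi> (i - x)))"
proof (cases "i < x")
  case True
  then show ?thesis unfolding row_of_def by (simp add: Least_eq_0)
next
  case False
  have "(LEAST r. i < sum_list (take (Suc r) (x # \<pi>))) = Suc (LEAST r. i < sum_list (take (Suc (Suc r)) (x # \<pi>)))"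
    using assms False by (intro Least_Suc[of _ "length \<pi>"]) auto
  moreover have "i < sum_list (take (Suc (Suc r)) (x # \<pi>)) \<longleftrightarrow> i - x < sum_list (take (Suc r) \<pi>)" for r
    using False by auto
  ultimately show ?thesis using False by (simp add: row_of_def)
qed

text \<open>The row group is cut out of the full symmetric group by conditions on the four places,
  so that \<open>sum_permutes_4\<close> can enumerate it.\<close>

lemma sum_row_group:
  assumes "sum_list \<pi> = 4"
  shows "(\<Sum>p\<in>row_group \<pi>. f p) = (\<Sum>p | p permutes {..<4}. if
    row_of \<pi> (p 0) = row_of \<pi> 0 \<and> row_of \<pi> (p 1) = row_of \<pi> 1 \<and> row_of \<pi> (p 2) = row_of \<pi> 2 \<and> row_of \<pi> (p 3) = row_of \<pi> 3
    then f p else 0)"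
  by (subst sum.inter_filter[symmetric])
    (auto simp: finite_permutations row_group_def assms all_less_4 intro!: sum.cong)

lemma sum_col_group:
  assumes "sum_list \<pi> = 4"
  shows "(\<Sum>p\<in>col_group \<pi>. f p) = (\<Sum>p | p permutes {..<4}. if
    col_of \<pi> (p 0) = col_of \<pi> 0 \<and> col_of \<pi> (p 1) = col_of \<pi> 1 \<and> col_of \<pi> (p 2) = col_of \<pi> 2 \<and> col_of \<pi> (p 3) = col_of \<pi> 3
    then f p else 0)"
  by (subst sum.inter_filter[symmetric])
    (auto simp: finite_permutations col_group_def assms all_less_4 intro!: sum.cong)

lemma row_col_31:
  "row_of [3, 1] 0 = 0" "row_of [3, 1] 1 = 0" "row_of [3, 1] 2 = 0" "row_of [3, 1] 3 = 1"
  "col_of [3, 1] 0 = 0" "col_of [3, 1] 1 = 1" "col_of [3, 1] 2 = 2" "col_of [3, 1] 3 = 0"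
  by (simp_all add: col_of_def row_of_Cons)

lemma row_col_211:
  "row_of [2, 1, 1] 0 = 0" "row_of [2, 1, 1] 1 = 0" "row_of [2, 1, 1] 2 = 1" "row_of [2, 1, 1] 3 = 2"
  "col_of [2, 1, 1] 0 = 0" "col_of [2, 1, 1] 1 = 1" "col_of [2, 1, 1] 2 = 0" "col_of [2, 1, 1] 3 = 0"
  by (simp_all add: col_of_def row_of_Cons numeral_2_eq_2)

lemma row_col_22:
  "row_of [2, 2] 0 = 0" "row_of [2, 2] 1 = 0" "row_of [2, 2] 2 = 1" "row_of [2, 2] 3 = 1"
  "col_of [2, 2] 0 = 0" "col_of [2, 2] 1 = 1" "col_of [2, 2] 2 = 0" "col_of [2, 2] 3 = 1"
  by (simp_all add: col_of_def row_of_Cons numeral_2_eq_2)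

lemma row_col_1111:
  "row_of [1, 1, 1, 1] 0 = 0" "row_of [1, 1, 1, 1] 1 = 1" "row_of [1, 1, 1, 1] 2 = 2" "row_of [1, 1, 1, 1] 3 = 3"
  "col_of [1, 1, 1, 1] 0 = 0" "col_of [1, 1, 1, 1] 1 = 0" "col_of [1, 1, 1, 1] 2 = 0" "col_of [1, 1, 1, 1] 3 = 0"
  by (simp_all add: col_of_def row_of_Cons numeral_2_eq_2 numeral_3_eq_3)

lemmas perm_simps = sign_compose sign_swap_id permutation_swap_id permutation_compose

lemma row_group_31: "(\<Sum>p\<in>row_group [3, 1]. f p) =
  f (id) + f (transpose 1 2) + f (transpose 0 1) + f (transpose 0 1 \<circ> transpose 1 2) + f (transpose 0 2 \<circ> transpose 1 2) + f (transpose 0 2)"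
  by (subst sum_row_group) (simp_all add: sum_permutes_4 row_col_31 add_ac del: One_nat_def)

lemma col_group_31: "(\<Sum>p\<in>col_group [3, 1]. f p) =
  f (id) + f (transpose 0 3)"
  by (subst sum_col_group) (simp_all add: sum_permutes_4 row_col_31 add_ac del: One_nat_def)

text \<open>Twelve terms: six row permutations times two column permutations, the latter with
  sign.\<close>

lemma young_31:
  fixes s :: "complex \<Rightarrow> 'v \<Rightarrow> 'v::ab_group_add"
  shows "young_symmetrizer [3, 1] (pr s v0 v1 v2 v3) =
    pr s v0 v1 v2 v3 + pr s v0 v2 v1 v3 + pr s v1 v0 v2 v3 + pr s v2 v0 v1 v3 + pr s v1 v2 v0 v3
    + pr s v2 v1 v0 v3 - pr s v3 v1 v2 v0 - pr s v3 v2 v1 v0 - pr s v1 v3 v2 v0 - pr s v2 v3 v1 v0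
    - pr s v1 v2 v3 v0 - pr s v2 v1 v3 v0"
  by (rule young_eqI, simp)
    (simp_all add: young_symmetrizer_def row_group_31 col_group_31 perm_simps pr_apply mult_ac del: One_nat_def)

lemma row_group_211: "(\<Sum>p\<in>row_group [2, 1, 1]. f p) =
  f (id) + f (transpose 0 1)"
  by (subst sum_row_group) (simp_all add: sum_permutes_4 row_col_211 add_ac del: One_nat_def)

lemma col_group_211: "(\<Sum>p\<in>col_group [2, 1, 1]. f p) =
  f (id) + f (transpose 2 3) + f (transpose 0 2) + f (transpose 0 2 \<circ> transpose 2 3) + f (transpose 0 3 \<circ> transpose 2 3) + f (transpose 0 3)"
  by (subst sum_col_group) (simp_all add: sum_permutes_4 row_col_211 add_ac del: One_nat_def)

lemma young_211:
  fixes s :: "complex \<Rightarrow> 'v \<Rightarrow> 'v::ab_group_add"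
  shows "young_symmetrizer [2, 1, 1] (pr s v0 v1 v2 v3) =
    pr s v0 v1 v2 v3 + pr s v3 v1 v0 v2 + pr s v2 v1 v3 v0 + pr s v1 v0 v2 v3 + pr s v1 v3 v0 v2
    + pr s v1 v2 v3 v0 - pr s v0 v1 v3 v2 - pr s v2 v1 v0 v3 - pr s v3 v1 v2 v0 - pr s v1 v0 v3 v2
    - pr s v1 v2 v0 v3 - pr s v1 v3 v2 v0"
  by (rule young_eqI, simp)
    (simp_all add: young_symmetrizer_def row_group_211 col_group_211 perm_simps pr_apply mult_ac del: One_nat_def)

lemma row_group_22: "(\<Sum>p\<in>row_group [2, 2]. f p) =
  f (id) + f (transpose 2 3) + f (transpose 0 1) + f (transpose 0 1 \<circ> transpose 2 3)"
  by (subst sum_row_group) (simp_all add: sum_permutes_4 row_col_22 add_ac del: One_nat_def)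

lemma col_group_22: "(\<Sum>p\<in>col_group [2, 2]. f p) =
  f (id) + f (transpose 1 3) + f (transpose 0 2) + f (transpose 0 2 \<circ> transpose 1 3)"
  by (subst sum_col_group) (simp_all add: sum_permutes_4 row_col_22 add_ac del: One_nat_def)

lemma young_22:
  fixes s :: "complex \<Rightarrow> 'v \<Rightarrow> 'v::ab_group_add"
  shows "young_symmetrizer [2, 2] (pr s v0 v1 v2 v3) =
    pr s v0 v1 v2 v3 + pr s v2 v3 v0 v1 + pr s v0 v1 v3 v2 + pr s v2 v3 v1 v0 + pr s v1 v0 v2 v3
    + pr s v3 v2 v0 v1 + pr s v1 v0 v3 v2 + pr s v3 v2 v1 v0 - pr s v0 v3 v2 v1 - pr s v2 v1 v0 v3
    - pr s v0 v3 v1 v2 - pr s v2 v1 v3 v0 - pr s v3 v0 v2 v1 - pr s v1 v2 v0 v3 - pr s v3 v0 v1 v2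
    - pr s v1 v2 v3 v0"
  by (rule young_eqI, simp)
    (simp_all add: young_symmetrizer_def row_group_22 col_group_22 perm_simps pr_apply mult_ac del: One_nat_def)

lemma pure_permute:
  assumes \<sigma>: "\<sigma> permutes {..<4}"
  shows "pure s v (\<phi> \<circ> \<sigma>) = pure s (v \<circ> inv_into UNIV \<sigma>) \<phi>"
proof -
  let ?\<iota> = "inv_into UNIV \<sigma>"
  have \<iota>: "?\<iota> permutes {..<4}" using permutes_inv[OF \<sigma>] .
  have "(\<forall>i<4. (\<phi> \<circ> \<sigma>) i \<in> dual s) \<longleftrightarrow> (\<forall>i<4. \<phi> i \<in> dual s)"
  proof
    assume all: "\<forall>i<4. (\<phi> \<circ> \<sigma>) i \<in> dual s"
    show "\<forall>i<4. \<phi> i \<in> dual s"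
    proof (intro allI impI)
      fix i :: nat assume "i < 4"
      then have "(\<phi> \<circ> \<sigma>) (?\<iota> i) \<in> dual s" using all permutes_less_4[OF \<iota>] by blast
      then show "\<phi> i \<in> dual s" by (simp add: permutes_inverses[OF \<sigma>])
    qed
  qed (use permutes_less_4[OF \<sigma>] in auto)
  moreover have "(\<Prod>i<4. (\<phi> \<circ> \<sigma>) i (v i)) = (\<Prod>i<4. \<phi> i (v (?\<iota> i)))"
    by (subst prod.permute[OF \<iota>]) (simp add: permutes_inverses[OF \<sigma>])
  ultimately show ?thesis by (simp only: pure_def o_apply)
qed

lemma young_1111:
  "young_symmetrizer [1, 1, 1, 1] t = (\<lambda>\<phi>. \<Sum>q | q permutes {..<4}. of_int (sign q) * t (\<phi> \<circ> q))"
proof -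
  have less: "i = 0 \<or> i = 1 \<or> i = 2 \<or> i = 3" if "i < 4" for i :: nat using that by auto
  have row: "(\<Sum>p\<in>row_group [1, 1, 1, 1]. f p) = (f id :: complex)" for f
    by (subst sum_row_group) (simp_all add: sum_permutes_4 row_col_1111 del: One_nat_def)
  have "col_of [1, 1, 1, 1] i = 0" if "i < 4" for i
    using less[OF that] row_col_1111 by metis
  then have "col_group [1, 1, 1, 1] = {q. q permutes {..<4}}"
    unfolding col_group_def by (auto simp: permutes_less_4 simp del: One_nat_def)
  then show ?thesis by (simp add: young_symmetrizer_def row del: One_nat_def)
qed

lemma young_1111_transpose:
  assumes "i < 4" "j < 4" "i \<noteq> j"
  shows "young_symmetrizer [1, 1, 1, 1] (pure s (v \<circ> transpose i j)) = - young_symmetrizer [1, 1, 1, 1] (pure s v)"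
proof
  fix \<phi>
  let ?t = "transpose i j"
  have t: "?t permutes {..<4}" using assms by (intro permutes_swap_id) auto
  have "young_symmetrizer [1, 1, 1, 1] (pure s (v \<circ> ?t)) \<phi> =
      (\<Sum>q | q permutes {..<4}. of_int (sign (q \<circ> ?t)) * pure s (v \<circ> ?t) (\<phi> \<circ> (q \<circ> ?t)))"
    unfolding young_1111 by (rule sum_permutations_compose_right[OF t])
  also have "\<dots> = (\<Sum>q | q permutes {..<4}. - (of_int (sign q) * pure s v (\<phi> \<circ> q)))"
  proof (intro sum.cong refl)
    fix q assume "q \<in> {q. q permutes {..<4 :: nat}}"
    then have "permutation q" using permutation_permutes by blast
    then have "sign (q \<circ> ?t) = - sign q"
      using assms(3) by (simp add: sign_compose sign_swap_id permutation_swap_id)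
    moreover have "pure s (v \<circ> ?t) (\<phi> \<circ> (q \<circ> ?t)) = pure s v (\<phi> \<circ> q)"
      using pure_permute[OF t, of s "v \<circ> ?t" "\<phi> \<circ> q"] by (simp add: comp_assoc)
    ultimately show "of_int (sign (q \<circ> ?t)) * pure s (v \<circ> ?t) (\<phi> \<circ> (q \<circ> ?t)) = - (of_int (sign q) * pure s v (\<phi> \<circ> q))"
      by simp
  qed
  finally show "young_symmetrizer [1, 1, 1, 1] (pure s (v \<circ> ?t)) \<phi> = (- young_symmetrizer [1, 1, 1, 1] (pure s v)) \<phi>"
    by (simp add: young_1111 sum_negf del: One_nat_def)
qed

lemma young_1111_swap:
  "young_symmetrizer [1, 1, 1, 1] (pr s v1 v0 v2 v3) = - young_symmetrizer [1, 1, 1, 1] (pr s v0 v1 v2 v3)"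
  "young_symmetrizer [1, 1, 1, 1] (pr s v0 v2 v1 v3) = - young_symmetrizer [1, 1, 1, 1] (pr s v0 v1 v2 v3)"
  "young_symmetrizer [1, 1, 1, 1] (pr s v0 v1 v3 v2) = - young_symmetrizer [1, 1, 1, 1] (pr s v0 v1 v2 v3)"
proof -
  have "pr s v1 v0 v2 v3 = pure s ((!) [v0, v1, v2, v3] \<circ> transpose 0 1)"
    "pr s v0 v2 v1 v3 = pure s ((!) [v0, v1, v2, v3] \<circ> transpose 1 2)"
    "pr s v0 v1 v3 v2 = pure s ((!) [v0, v1, v2, v3] \<circ> transpose 2 3)"
    by (subst pure_eq_pr[of s "_ \<circ> _"], simp)+
  then show
    "young_symmetrizer [1, 1, 1, 1] (pr s v1 v0 v2 v3) = - young_symmetrizer [1, 1, 1, 1] (pr s v0 v1 v2 v3)"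
    "young_symmetrizer [1, 1, 1, 1] (pr s v0 v2 v1 v3) = - young_symmetrizer [1, 1, 1, 1] (pr s v0 v1 v2 v3)"
    "young_symmetrizer [1, 1, 1, 1] (pr s v0 v1 v3 v2) = - young_symmetrizer [1, 1, 1, 1] (pr s v0 v1 v2 v3)"
    by (simp_all only: young_1111_transpose)
qed

text \<open>The symmetrizer antisymmetrizes its argument along the columns before it symmetrizes
  along the rows, whence the signs and zeros here and for the next two shapes. Exchanging columns of
  equal length is a row permutation that normalizes the column group, whence the invariance.\<close>

lemma young_31_symmetry:
  "young_symmetrizer [3, 1] (pr s v3 v1 v2 v0) = - young_symmetrizer [3, 1] (pr s v0 v1 v2 v3)"
  "young_symmetrizer [3, 1] (pr s v0 v2 v1 v3) = young_symmetrizer [3, 1] (pr s v0 v1 v2 v3)"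
  "young_symmetrizer [3, 1] (pr s v0 v1 v2 v0) = 0"
  unfolding young_31 by (simp_all add: algebra_simps)

lemma young_211_symmetry:
  "young_symmetrizer [2, 1, 1] (pr s v2 v1 v0 v3) = - young_symmetrizer [2, 1, 1] (pr s v0 v1 v2 v3)"
  "young_symmetrizer [2, 1, 1] (pr s v0 v1 v3 v2) = - young_symmetrizer [2, 1, 1] (pr s v0 v1 v2 v3)"
  "young_symmetrizer [2, 1, 1] (pr s v0 v1 v0 v3) = 0"
  "young_symmetrizer [2, 1, 1] (pr s v0 v1 v3 v3) = 0"
  unfolding young_211 by (simp_all add: algebra_simps)

lemma young_22_symmetry:
  "young_symmetrizer [2, 2] (pr s v2 v1 v0 v3) = - young_symmetrizer [2, 2] (pr s v0 v1 v2 v3)"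
  "young_symmetrizer [2, 2] (pr s v0 v3 v2 v1) = - young_symmetrizer [2, 2] (pr s v0 v1 v2 v3)"
  "young_symmetrizer [2, 2] (pr s v1 v0 v3 v2) = young_symmetrizer [2, 2] (pr s v0 v1 v2 v3)"
  "young_symmetrizer [2, 2] (pr s v0 v1 v0 v3) = 0"
  "young_symmetrizer [2, 2] (pr s v0 v1 v2 v1) = 0"
  unfolding young_22 by (simp_all add: algebra_simps)

lemma eq_neg_self_function:
  fixes f :: "'x \<Rightarrow> complex"
  assumes "f = - f"
  shows "f = 0"
proof
  fix x
  have "f x = - f x" using fun_cong[OF assms, of x] by simp
  then show "f x = 0 x" by simp
qed

lemma young_1111_symmetry:
  "young_symmetrizer [1, 1, 1, 1] (pr s v0 v0 v2 v3) = 0"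
  "young_symmetrizer [1, 1, 1, 1] (pr s v0 v1 v1 v3) = 0"
  "young_symmetrizer [1, 1, 1, 1] (pr s v0 v1 v2 v2) = 0"
  by (rule eq_neg_self_function, rule young_1111_swap)+

section \<open>Spanning sets of the Schur modules\<close>

context coord_space
begin

definition young :: "nat list \<Rightarrow> nat \<Rightarrow> nat \<Rightarrow> nat \<Rightarrow> nat \<Rightarrow> (nat \<Rightarrow> 'v \<Rightarrow> complex) \<Rightarrow> complex"
  where "young \<pi> i0 i1 i2 i3 = young_symmetrizer \<pi> (pr s (e i0) (e i1) (e i2) (e i3))"

lemma schur_eqI:
  assumes "sum_list \<pi> = 4" and "S \<subseteq> range (\<lambda>v. young_symmetrizer \<pi> (pure s v))"
    and "\<And>i0 i1 i2 i3. i0 < n \<Longrightarrow> i1 < n \<Longrightarrow> i2 < n \<Longrightarrow> i3 < n \<Longrightarrow> young \<pi> i0 i1 i2 i3 \<in> lspan S"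
  shows "schur \<pi> s = lspan S"
proof
  show "schur \<pi> s \<subseteq> lspan S"
    unfolding schur_eq_span_basis[OF assms(1)]
    using assms(3) by (intro fun_space.span_minimal fun_space.subspace_span) (auto simp: young_def)
  show "lspan S \<subseteq> schur \<pi> s"
    unfolding schur_eq_span[OF assms(1)] using assms(2) by (intro fun_space.span_mono) auto
qed

lemma young_in_range: "young \<pi> i0 i1 i2 i3 \<in> range (\<lambda>v. young_symmetrizer \<pi> (pure s v))"
  unfolding young_def by blast

text \<open>The generators are the semistandard fillings by 0 and 1: the column of length two is 0
  over 1, and the other two entries are unordered. Only spanning is proved; independence comes later
  from counting minors.\<close>

lemma schur_31_dim_2:
  assumes "n = 2"
  shows "schur [3, 1] s = lspan {young [3, 1] 0 0 0 1, young [3, 1] 0 0 1 1, young [3, 1] 0 1 1 1}"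
    (is "_ = lspan ?S")
proof (rule schur_eqI)
  have sym: "young [3, 1] 1 i j 0 = - young [3, 1] 0 i j 1" "young [3, 1] 0 1 0 1 = young [3, 1] 0 0 1 1"
    "young [3, 1] i j k i = 0" for i j k
    unfolding young_def by (rule young_31_symmetry)+
  fix i0 i1 i2 i3 assume "i0 < n" "i1 < n" "i2 < n" "i3 < n"
  then have "i0 = 0 \<or> i0 = 1" "i1 = 0 \<or> i1 = 1" "i2 = 0 \<or> i2 = 1" "i3 = 0 \<or> i3 = 1"
    using assms by auto
  then show "young [3, 1] i0 i1 i2 i3 \<in> lspan ?S"
    by (elim disjE) (((simp only: sym neg_equal_0_iff_equal minus_zero minus_minus )?,
      (rule fun_space.span_zero | (rule fun_space.span_neg)?, rule fun_space.span_base, simp))+)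
qed (use young_in_range in auto)

lemma schur_22_dim_2:
  assumes "n = 2"
  shows "schur [2, 2] s = lspan {young [2, 2] 0 0 1 1}" (is "_ = lspan ?S")
proof (rule schur_eqI)
  have sym: "young [2, 2] 1 i 0 j = - young [2, 2] 0 i 1 j" "young [2, 2] i 1 j 0 = - young [2, 2] i 0 j 1"
    "young [2, 2] i j i k = 0" "young [2, 2] i j k j = 0" for i j k
    unfolding young_def by (rule young_22_symmetry)+
  fix i0 i1 i2 i3 assume "i0 < n" "i1 < n" "i2 < n" "i3 < n"
  then have "i0 = 0 \<or> i0 = 1" "i1 = 0 \<or> i1 = 1" "i2 = 0 \<or> i2 = 1" "i3 = 0 \<or> i3 = 1"
    using assms by auto
  then show "young [2, 2] i0 i1 i2 i3 \<in> lspan ?S"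
    by (elim disjE) (((simp only: sym neg_equal_0_iff_equal minus_zero minus_minus )?,
      (rule fun_space.span_zero | (rule fun_space.span_neg)?, rule fun_space.span_base, simp))+)
qed (use young_in_range in auto)

text \<open>In three letters the long column must be 0, 1, 2, so only the second entry of the first
  row is free.\<close>

lemma schur_211_dim_3:
  assumes "n = 3"
  shows "schur [2, 1, 1] s = lspan {young [2, 1, 1] 0 0 1 2, young [2, 1, 1] 0 1 1 2, young [2, 1, 1] 0 2 1 2}"
    (is "_ = lspan ?S")
proof (rule schur_eqI)
  have sym: "young [2, 1, 1] i j i k = 0" "young [2, 1, 1] i j k k = 0"
    "young [2, 1, 1] 1 j 0 k = - young [2, 1, 1] 0 j 1 k" "young [2, 1, 1] 2 j 0 k = - young [2, 1, 1] 0 j 2 k"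
    "young [2, 1, 1] 2 j 1 k = - young [2, 1, 1] 1 j 2 k"
    "young [2, 1, 1] i j 1 0 = - young [2, 1, 1] i j 0 1" "young [2, 1, 1] i j 2 0 = - young [2, 1, 1] i j 0 2"
    "young [2, 1, 1] i j 2 1 = - young [2, 1, 1] i j 1 2" for i j k
    unfolding young_def by (rule young_211_symmetry)+
  fix i0 i1 i2 i3 assume "i0 < n" "i1 < n" "i2 < n" "i3 < n"
  then have "i0 = 0 \<or> i0 = 1 \<or> i0 = 2" "i1 = 0 \<or> i1 = 1 \<or> i1 = 2" "i2 = 0 \<or> i2 = 1 \<or> i2 = 2" "i3 = 0 \<or> i3 = 1 \<or> i3 = 2"
    using assms by auto
  then show "young [2, 1, 1] i0 i1 i2 i3 \<in> lspan ?S"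
    by (elim disjE) (((simp only: sym neg_equal_0_iff_equal minus_zero minus_minus )?,
      (rule fun_space.span_zero | (rule fun_space.span_neg)?, rule fun_space.span_base, simp))+)
qed (use young_in_range in auto)

text \<open>Each column is one of the three 2-element sets of letters, and the order of the columns
  is immaterial, which leaves 6 fillings.\<close>

lemma schur_22_dim_3:
  assumes "n = 3"
  shows "schur [2, 2] s = lspan {young [2, 2] 0 0 1 1, young [2, 2] 0 0 1 2, young [2, 2] 0 1 1 2,
    young [2, 2] 0 0 2 2, young [2, 2] 0 1 2 2, young [2, 2] 1 1 2 2}" (is "_ = lspan ?S")
proof (rule schur_eqI)
  have sym: "young [2, 2] i j i k = 0" "young [2, 2] i j k j = 0"
    "young [2, 2] 1 j 0 k = - young [2, 2] 0 j 1 k" "young [2, 2] 2 j 0 k = - young [2, 2] 0 j 2 k"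
    "young [2, 2] 2 j 1 k = - young [2, 2] 1 j 2 k"
    "young [2, 2] i 1 j 0 = - young [2, 2] i 0 j 1" "young [2, 2] i 2 j 0 = - young [2, 2] i 0 j 2"
    "young [2, 2] i 2 j 1 = - young [2, 2] i 1 j 2"
    "young [2, 2] 0 0 2 1 = young [2, 2] 0 0 1 2" "young [2, 2] 1 0 2 1 = young [2, 2] 0 1 1 2"
    "young [2, 2] 1 0 2 2 = young [2, 2] 0 1 2 2" for i j k
    unfolding young_def by (rule young_22_symmetry)+
  fix i0 i1 i2 i3 assume "i0 < n" "i1 < n" "i2 < n" "i3 < n"
  then have "i0 = 0 \<or> i0 = 1 \<or> i0 = 2" "i1 = 0 \<or> i1 = 1 \<or> i1 = 2" "i2 = 0 \<or> i2 = 1 \<or> i2 = 2" "i3 = 0 \<or> i3 = 1 \<or> i3 = 2"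
    using assms by auto
  then show "young [2, 2] i0 i1 i2 i3 \<in> lspan ?S"
    by (elim disjE) (((simp only: sym neg_equal_0_iff_equal minus_zero minus_minus )?,
      (rule fun_space.span_zero | (rule fun_space.span_neg)?, rule fun_space.span_base, simp))+)
qed (use young_in_range in auto)

lemma schur_1111_dim_4:
  assumes "n = 4"
  shows "schur [1, 1, 1, 1] s = lspan {young [1, 1, 1, 1] 0 1 2 3}" (is "_ = lspan ?S")
proof (rule schur_eqI)
  let ?y = "young [1, 1, 1, 1]"
  have sym: "?y i i j k = 0" "?y i j j k = 0" "?y i j k k = 0"
    "?y 1 0 i j = - ?y 0 1 i j" "?y i 1 0 j = - ?y i 0 1 j" "?y i j 1 0 = - ?y i j 0 1"
    "?y 2 0 i j = - ?y 0 2 i j" "?y i 2 0 j = - ?y i 0 2 j" "?y i j 2 0 = - ?y i j 0 2"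
    "?y 2 1 i j = - ?y 1 2 i j" "?y i 2 1 j = - ?y i 1 2 j" "?y i j 2 1 = - ?y i j 1 2"
    "?y 3 0 i j = - ?y 0 3 i j" "?y i 3 0 j = - ?y i 0 3 j" "?y i j 3 0 = - ?y i j 0 3"
    "?y 3 1 i j = - ?y 1 3 i j" "?y i 3 1 j = - ?y i 1 3 j" "?y i j 3 1 = - ?y i j 1 3"
    "?y 3 2 i j = - ?y 2 3 i j" "?y i 3 2 j = - ?y i 2 3 j" "?y i j 3 2 = - ?y i j 2 3"
    for i j k
    unfolding young_def by (rule young_1111_symmetry young_1111_swap)+
  fix i0 i1 i2 i3 assume "i0 < n" "i1 < n" "i2 < n" "i3 < n"
  then have "i0 = 0 \<or> i0 = 1 \<or> i0 = 2 \<or> i0 = 3" "i1 = 0 \<or> i1 = 1 \<or> i1 = 2 \<or> i1 = 3"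
    "i2 = 0 \<or> i2 = 1 \<or> i2 = 2 \<or> i2 = 3" "i3 = 0 \<or> i3 = 1 \<or> i3 = 2 \<or> i3 = 3"
    using assms by auto
  then show "?y i0 i1 i2 i3 \<in> lspan ?S"
    by (elim disjE) (((simp only: sym neg_equal_0_iff_equal minus_zero minus_minus )?,
      (rule fun_space.span_zero | (rule fun_space.span_neg)?, rule fun_space.span_base, simp))+)
qed (use young_in_range in auto)

end

section \<open>Equivariant contraction of tensors to polynomials\<close>

lemma (in coord_space) dual_comp:
  assumes "Vector_Spaces.linear s s g" "\<phi> \<in> dual s"
  shows "\<phi> \<circ> g \<in> dual s"
  using assms(1) by (intro dualI[OF vs]) (simp_all add: Vector_Spaces.linear_iff dual_add[OF assms(2)] dual_scale[OF assms(2)])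

lemma GL_D: "g \<in> GL s \<Longrightarrow> Vector_Spaces.linear s s g" "g \<in> GL s \<Longrightarrow> bij g"
  by (auto simp: GL_def)

lemma GL_inverse:
  assumes "g \<in> GL s"
  obtains h where "h \<in> GL s" "g \<circ> h = id" "h \<circ> g = id"
proof -
  obtain h where h: "\<And>x. g (h x) = x" "\<And>x. h (g x) = x"
    using GL_D(2)[OF assms] by (metis bij_iff)
  have lin: "vector_space s" "\<And>u v. g (u + v) = g u + g v" "\<And>k v. g (s k v) = s k (g v)"
    using GL_D(1)[OF assms] by (auto simp: Vector_Spaces.linear_iff)
  have "h (u + v) = h u + h v" for u v by (metis h lin(2))
  moreover have "h (s k v) = s k (h v)" for k v by (metis h lin(3))
  ultimately have "Vector_Spaces.linear s s h" using lin(1) by (simp add: Vector_Spaces.linear_iff)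
  moreover have "bij h" using h by (metis bijI' )
  ultimately show thesis using that[of h] h by (auto simp: GL_def fun_eq_iff)
qed

definition act_power :: "('v \<Rightarrow> 'v) \<Rightarrow> ((nat \<Rightarrow> 'v \<Rightarrow> complex) \<Rightarrow> complex) \<Rightarrow> (nat \<Rightarrow> 'v \<Rightarrow> complex) \<Rightarrow> complex"
  where "act_power g t \<phi> = t (\<lambda>i. \<phi> i \<circ> g)"

lemma act_tensor_tprod:
  "act_tensor (g, h, k) (tprod t t' t'') = tprod (act_power g t) (act_power h t') (act_power k t'')"
  by (auto simp: act_tensor_def tprod_def act_power_def fun_eq_iff)

lemma linear_act_tensor: "Vector_Spaces.linear fscale fscale (act_tensor g)"
  unfolding fun_linear_iff by (cases g) (auto simp: act_tensor_def fun_eq_iff fscale_apply)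

lemma linear_act_power: "Vector_Spaces.linear fscale fscale (act_power g)"
  unfolding fun_linear_iff by (auto simp: act_power_def fun_eq_iff fscale_apply)

lemma young_symmetrizer_act_power:
  "act_power g (young_symmetrizer \<pi> t) = young_symmetrizer \<pi> (act_power g t)"
  by (simp add: fun_eq_iff act_power_def young_symmetrizer_def comp_def)

text \<open>Invertibility matters: the encoding gives 0 at non-linear arguments, and
  \<open>\<phi> \<circ> g\<close> must be linear exactly when \<open>\<phi>\<close> is.\<close>

lemma (in coord_space) act_power_pure:
  assumes "g \<in> GL s"
  shows "act_power g (pure s v) = pure s (g \<circ> v)"
proof -
  obtain h where h: "h \<in> GL s" "g \<circ> h = id" "h \<circ> g = id" using GL_inverse[OF assms] .
  have "\<phi> \<circ> g \<in> dual s \<longleftrightarrow> \<phi> \<in> dual s" for \<phi>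
  proof
    assume "\<phi> \<circ> g \<in> dual s"
    then have "(\<phi> \<circ> g) \<circ> h \<in> dual s" by (rule dual_comp[OF GL_D(1)[OF h(1)]])
    then show "\<phi> \<in> dual s" by (simp add: comp_assoc h)
  qed (use dual_comp[OF GL_D(1)[OF assms]] in blast)
  then show ?thesis by (intro ext) (simp only: act_power_def pure_def comp_apply)
qed

lemma (in coord_space) schur_act_power:
  assumes "sum_list \<pi> = 4" "g \<in> GL s" "t \<in> schur \<pi> s"
  shows "act_power g t \<in> schur \<pi> s"
proof -
  have "act_power g ` young_symmetrizer \<pi> ` range (pure s) \<subseteq> young_symmetrizer \<pi> ` range (pure s)"
    by (auto simp: young_symmetrizer_act_power act_power_pure[OF assms(2)])
  then have "act_power g ` schur \<pi> s \<subseteq> schur \<pi> s"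
    unfolding schur_eq_span[OF assms(1)] linear_image_span[OF linear_act_power] by (rule fun_space.span_mono)
  then show ?thesis using assms(3) by blast
qed

text \<open>Brings the Schur modules into the domain on which the contraction is equivariant;
  permuting the places of a decomposable tensor gives a decomposable tensor.\<close>

lemma (in coord_space) schur_subset_span_pure:
  assumes "sum_list \<pi> = 4"
  shows "schur \<pi> s \<subseteq> lspan (range (pure s))"
proof -
  have "young_symmetrizer \<pi> (pure s v) \<in> lspan (range (pure s))" for v
  proof -
    have "young_symmetrizer \<pi> (pure s v) = (\<Sum>p\<in>row_group \<pi>. \<Sum>q\<in>col_group \<pi>.
        fscale (of_int (sign q)) (pure s (v \<circ> inv_into UNIV (p \<circ> q))))"
    proof
      fix \<phi>
      have "pure s v (\<phi> \<circ> (p \<circ> q)) = pure s (v \<circ> inv_into UNIV (p \<circ> q)) \<phi>"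
        if "p \<in> row_group \<pi>" "q \<in> col_group \<pi>" for p q
        using that assms by (intro pure_permute permutes_compose) (auto simp: row_group_def col_group_def)
      then show "young_symmetrizer \<pi> (pure s v) \<phi> = (\<Sum>p\<in>row_group \<pi>. \<Sum>q\<in>col_group \<pi>.
        fscale (of_int (sign q)) (pure s (v \<circ> inv_into UNIV (p \<circ> q)))) \<phi>"
        unfolding young_symmetrizer_def sum_fun_apply fscale_apply by (intro sum.cong refl) simp
    qed
    then show ?thesis
      by (simp only:) (intro fun_space.span_sum fun_space.span_scale fun_space.span_base rangeI)
  qed
  then show ?thesis
    unfolding schur_eq_span[OF assms] by (intro fun_space.span_minimal fun_space.subspace_span) blast
qed

context tensor_coords
begin

lemma V_expansion:
  assumes "T \<in> V"
  shows "T (u, v, w) = (\<Sum>i<2. \<Sum>j<3. \<Sum>k<4. \<alpha> i u * \<beta> j v * \<gamma> k w * T (a i, b j, c k))"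
proof -
  define F where "F k i j = \<alpha> i u * \<beta> j v * \<gamma> k w * T (a i, b j, c k)" for k i j
  have "T (u, v, w) = tens (crd T) (u, v, w)" by (simp add: tens_crd[OF assms])
  also have "\<dots> = (\<Sum>k<4. \<Sum>j<6. F k (j div 3) (j mod 3))"
    by (simp add: tens_def sum_fun_apply fscale_apply box_def sum.cartesian_product crd_def
        tprod_def basis_tensor_def F_def mult_ac split_beta)
  also have "\<dots> = (\<Sum>k<4. \<Sum>i<2. \<Sum>j<3. F k i j)"
    by (simp only: sum_div_mod_3)
  also have "\<dots> = (\<Sum>i<2. \<Sum>k<4. \<Sum>j<3. F k i j)"
    by (rule sum.swap)
  also have "\<dots> = (\<Sum>i<2. \<Sum>j<3. \<Sum>k<4. F k i j)"
    by (intro sum.cong refl sum.swap)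
  also have "\<dots> = (\<Sum>i<2. \<Sum>j<3. \<Sum>k<4. \<alpha> i u * \<beta> j v * \<gamma> k w * T (a i, b j, c k))"
    by (simp only: F_def)
  finally show ?thesis .
qed

text \<open>
  The product of the \<open>a\<^sub>s \<otimes> b\<^sub>s \<otimes> c\<^sub>s\<close>, preceded by a permutation of the places in the
  power of \<open>B\<close>. The permutation is needed: the canonical tableaux of two of the factors have the first
  two places in one row, so that without it the image of their product with an alternating tensor is 0.
\<close>

definition contract ::
    "((nat \<Rightarrow> 'a \<Rightarrow> complex) \<times> (nat \<Rightarrow> 'b \<Rightarrow> complex) \<times> (nat \<Rightarrow> 'c \<Rightarrow> complex) \<Rightarrow> complex)
      \<Rightarrow> ('a \<times> 'b \<times> 'c \<Rightarrow> complex) \<Rightarrow> complex"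
  where "contract t T = (if T \<in> V then
    \<Sum>i\<in>PiE {..<4} (\<lambda>_. {..<2}). \<Sum>j\<in>PiE {..<4} (\<lambda>_. {..<3}). \<Sum>k\<in>PiE {..<4} (\<lambda>_. {..<4}).
      t (\<lambda>s. \<alpha> (i s), \<lambda>s. \<beta> (j (transpose 1 3 s)), \<lambda>s. \<gamma> (k s)) * (\<Prod>s<4. T (a (i s), b (j s), c (k s))) else 0)"

lemma linear_contract: "Vector_Spaces.linear fscale fscale contract"
  unfolding fun_linear_iff
  by (auto simp: contract_def fun_eq_iff fscale_apply algebra_simps sum.distrib sum_distrib_left)

lemmas contract_add = fun_linear_iff[THEN iffD1, OF linear_contract, THEN conjunct1, rule_format]
  and contract_fscale = fun_linear_iff[THEN iffD1, OF linear_contract, THEN conjunct2, rule_format]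

text \<open>On decomposable tensors the coordinate sum collapses to a product of values of
  \<open>T\<close> that no longer involves the bases; equivariance is read off from this
  form.\<close>

lemma contract_pure:
  "contract (tprod (pure sA x) (pure sB y) (pure sC z)) T =
    (if T \<in> V then \<Prod>s<4. T (x s, y (transpose 1 3 s), z s) else 0)"
proof (cases "T \<in> V")
  case True
  let ?t = "transpose 1 (3 :: nat)"
  have t: "?t permutes {..<4}" by (intro permutes_swap_id) auto
  have PiE_less: "i s < m" if "i \<in> PiE {..<4} (\<lambda>_. {..<m})" "s < 4" for i :: "nat \<Rightarrow> nat" and m s
    using PiE_mem[OF that(1), of s] that(2) by simp
  have "(\<Prod>s<4. T (x s, y (?t s), z s)) =
    (\<Prod>s<4. \<Sum>i<2. \<Sum>j<3. \<Sum>k<4. \<alpha> i (x s) * \<beta> j (y (?t s)) * \<gamma> k (z s) * T (a i, b j, c k))"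
    by (intro prod.cong refl V_expansion True)
  also have "\<dots> = (\<Sum>i\<in>PiE {..<4} (\<lambda>_. {..<2}). \<Sum>j\<in>PiE {..<4} (\<lambda>_. {..<3}). \<Sum>k\<in>PiE {..<4} (\<lambda>_. {..<4}).
      \<Prod>s<4. \<alpha> (i s) (x s) * \<beta> (j s) (y (?t s)) * \<gamma> (k s) (z s) * T (a (i s), b (j s), c (k s)))"
    by (simp only: prod_sum_PiE finite_lessThan)
  also have "\<dots> = contract (tprod (pure sA x) (pure sB y) (pure sC z)) T"
    unfolding contract_def if_P[OF True]
  proof (intro sum.cong refl)
    fix i j k :: "nat \<Rightarrow> nat"
    assume i: "i \<in> PiE {..<4} (\<lambda>_. {..<2})" and j: "j \<in> PiE {..<4} (\<lambda>_. {..<3})" and k: "k \<in> PiE {..<4} (\<lambda>_. {..<4})"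
    have "(\<Prod>s<4. \<beta> (j s) (y (?t s))) = (\<Prod>s<4. \<beta> (j (?t s)) (y s))"
      by (subst prod.permute[OF t]) simp
    moreover have "pure sA x (\<lambda>s. \<alpha> (i s)) = (\<Prod>s<4. \<alpha> (i s) (x s))"
      "pure sB y (\<lambda>s. \<beta> (j (?t s))) = (\<Prod>s<4. \<beta> (j (?t s)) (y s))"
      "pure sC z (\<lambda>s. \<gamma> (k s)) = (\<Prod>s<4. \<gamma> (k s) (z s))"
      unfolding pure_def using PiE_less[OF i] PiE_less[OF j] PiE_less[OF k] permutes_less_4[OF t]
        A.coord_dual B.coord_dual C.coord_dual
      by (intro if_P allI impI; blast)+
    ultimately show "(\<Prod>s<4. \<alpha> (i s) (x s) * \<beta> (j s) (y (?t s)) * \<gamma> (k s) (z s) * T (a (i s), b (j s), c (k s))) =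
      tprod (pure sA x) (pure sB y) (pure sC z) (\<lambda>s. \<alpha> (i s), \<lambda>s. \<beta> (j (?t s)), \<lambda>s. \<gamma> (k s)) *
      (\<Prod>s<4. T (a (i s), b (j s), c (k s)))"
      by (simp only: prod.distrib tprod_def split_conv)
  qed
  finally show ?thesis using True by simp
qed (simp add: contract_def)

section \<open>Equivariance of the contraction\<close>

lemma act_V:
  assumes "T \<in> V" "Vector_Spaces.linear sA sA g" "Vector_Spaces.linear sB sB h" "Vector_Spaces.linear sC sC k"
  shows "(\<lambda>(u, v, w). T (g u, h v, k w)) \<in> V"
  using assms(1) unfolding tensor_space_def tensor3_def
proof (induction rule: fun_space.span_induct_alt)
  case base
  have "(\<lambda>(u, v, w). (0 :: 'a \<times> 'b \<times> 'c \<Rightarrow> complex) (g u, h v, k w)) = 0" by (simp add: fun_eq_iff)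
  then show ?case by (metis fun_space.span_zero)
next
  case (step r S T)
  then obtain \<phi> \<psi> \<chi> where S: "S = tprod \<phi> \<psi> \<chi>" "\<phi> \<in> dual sA" "\<psi> \<in> dual sB" "\<chi> \<in> dual sC" by blast
  have "(\<lambda>(u, v, w). (fscale r S + T) (g u, h v, k w)) =
      fscale r (tprod (\<phi> \<circ> g) (\<psi> \<circ> h) (\<chi> \<circ> k)) + (\<lambda>(u, v, w). T (g u, h v, k w))"
    by (simp add: fun_eq_iff S(1) tprod_def fscale_apply)
  moreover have "tprod (\<phi> \<circ> g) (\<psi> \<circ> h) (\<chi> \<circ> k) \<in> lspan {tprod \<phi> \<psi> \<chi> |\<phi> \<psi> \<chi>. \<phi> \<in> dual sA \<and> \<psi> \<in> dual sB \<and> \<chi> \<in> dual sC}"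
    using S assms A.dual_comp B.dual_comp C.dual_comp by (intro fun_space.span_base) blast
  ultimately show ?case
    by (simp only:) (intro fun_space.span_add fun_space.span_scale step.IH)
qed

text \<open>Polynomials are 0 outside \<open>V\<close>, so equivariance requires membership in
  \<open>V\<close> to be preserved in both directions; the converse applies \<open>act_V\<close> to
  the inverse group elements.\<close>

lemma act_V_iff:
  assumes "(g, h, k) \<in> GL3 sA sB sC"
  shows "(\<lambda>(u, v, w). T (g u, h v, k w)) \<in> V \<longleftrightarrow> T \<in> V"
proof
  have G: "g \<in> GL sA" "h \<in> GL sB" "k \<in> GL sC" using assms by (auto simp: GL3_def)
  show "(\<lambda>(u, v, w). T (g u, h v, k w)) \<in> V" if "T \<in> V"
    using that GL_D(1)[OF G(1)] GL_D(1)[OF G(2)] GL_D(1)[OF G(3)] by (rule act_V)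
  obtain g' h' k' where inv: "g' \<in> GL sA" "g \<circ> g' = id" "h' \<in> GL sB" "h \<circ> h' = id" "k' \<in> GL sC" "k \<circ> k' = id"
    using GL_inverse[OF G(1)] GL_inverse[OF G(2)] GL_inverse[OF G(3)] by metis
  assume "(\<lambda>(u, v, w). T (g u, h v, k w)) \<in> V"
  then have "(\<lambda>(u, v, w). (\<lambda>(u, v, w). T (g u, h v, k w)) (g' u, h' v, k' w)) \<in> V"
    using GL_D(1)[OF inv(1)] GL_D(1)[OF inv(3)] GL_D(1)[OF inv(5)] by (rule act_V)
  moreover have "g (g' u) = u" "h (h' v) = v" "k (k' w) = w" for u v w
    using inv(2,4,6) by (metis comp_apply id_apply)+
  ultimately show "T \<in> V" by simp
qed

text \<open>Restricted to spans of decomposable tensors: \<open>contract\<close> reads its argument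
  only at coordinate forms, and a general function has no multilinearity relating these values to
  those at the transformed forms.\<close>

lemma contract_equivariant:
  assumes "G \<in> GL3 sA sB sC"
    and "x \<in> tensor3 (lspan (range (pure sA))) (lspan (range (pure sB))) (lspan (range (pure sC)))"
  shows "contract (act_tensor G x) = act_sym G (contract x)"
proof -
  obtain g h k where G: "G = (g, h, k)" "g \<in> GL sA" "h \<in> GL sB" "k \<in> GL sC"
    using assms(1) by (auto simp: GL3_def)
  show ?thesis
    using assms(2) unfolding tensor3_span
  proof (induction rule: fun_space.span_induct_alt)
    case base
    have "contract (act_tensor G 0) T = act_sym G (contract 0) T" for T
      by (simp add: G(1) act_tensor_def act_sym_def contract_def)
    then show ?case by blast
  next
    case (step r t t')
    then obtain x y z where t: "t = tprod (pure sA x) (pure sB y) (pure sC z)" by blast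
    have "contract (act_tensor G t) = act_sym G (contract t)"
    proof
      fix T
      show "contract (act_tensor G t) T = act_sym G (contract t) T"
        using act_V_iff[of g h k T] assms(1)
        by (simp add: t G(1) act_tensor_tprod A.act_power_pure[OF G(2)] B.act_power_pure[OF G(3)]
            C.act_power_pure[OF G(4)] contract_pure act_sym_def)
    qed
    moreover have "act_tensor G (fscale r t + t') = fscale r (act_tensor G t) + act_tensor G t'"
      using linear_act_tensor[of G] unfolding fun_linear_iff by metis
    moreover have "act_sym G (contract (fscale r t + t')) = fscale r (act_sym G (contract t)) + act_sym G (contract t')"
      unfolding contract_add contract_fscale by (simp add: G(1) act_sym_def fun_eq_iff fscale_apply)
    ultimately show ?case
      using step.IH by (simp only: contract_add contract_fscale)
  qed
qed

text \<open>The conditions other than injectivity and degree follow from equivariance and from the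
  stability of the Schur modules under the group.\<close>

lemma is_schur_submodule_contract:
  assumes "sum_list \<pi> = 4" "sum_list \<mu> = 4" "sum_list \<nu> = 4"
  defines "N \<equiv> tensor3 (schur \<pi> sA) (schur \<mu> sB) (schur \<nu> sC)"
  assumes "inj_on contract N" "contract ` N \<subseteq> sym_power V 4"
  shows "is_schur_submodule sA sB sC 4 \<pi> \<mu> \<nu> (contract ` N)"
proof -
  have N: "N = lspan {tprod f g h |f g h. f \<in> schur \<pi> sA \<and> g \<in> schur \<mu> sB \<and> h \<in> schur \<nu> sC}"
    by (simp add: N_def tensor3_def)
  have "N \<subseteq> tensor3 (lspan (range (pure sA))) (lspan (range (pure sB))) (lspan (range (pure sC)))"
    unfolding N_def tensor3_def
    using A.schur_subset_span_pure[OF assms(1)] B.schur_subset_span_pure[OF assms(2)] C.schur_subset_span_pure[OF assms(3)]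
    by (intro fun_space.span_mono) blast
  then have equiv: "contract (act_tensor G x) = act_sym G (contract x)" if "G \<in> GL3 sA sB sC" "x \<in> N" for G x
    using that contract_equivariant by blast
  have closed: "act_tensor G x \<in> N" if "G \<in> GL3 sA sB sC" "x \<in> N" for G x
  proof -
    obtain g h k where G: "G = (g, h, k)" "g \<in> GL sA" "h \<in> GL sB" "k \<in> GL sC"
      using \<open>G \<in> GL3 sA sB sC\<close> by (auto simp: GL3_def)
    have "act_tensor G ` N \<subseteq> N"
      unfolding N linear_image_span[OF linear_act_tensor]
    proof (rule fun_space.span_mono, clarify)
      fix f1 f2 f3 assume "f1 \<in> schur \<pi> sA" "f2 \<in> schur \<mu> sB" "f3 \<in> schur \<nu> sC"
      then show "\<exists>f g h. act_tensor G (tprod f1 f2 f3) = tprod f g h \<and> f \<in> schur \<pi> sA \<and> g \<in> schur \<mu> sB \<and> h \<in> schur \<nu> sC"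
        unfolding G(1) act_tensor_tprod using A.schur_act_power[OF assms(1) G(2)] B.schur_act_power[OF assms(2) G(3)]
          C.schur_act_power[OF assms(3) G(4)] by blast
    qed
    then show ?thesis using \<open>x \<in> N\<close> by blast
  qed
  have "fun_space.subspace (contract ` N)"
    unfolding N linear_image_span[OF linear_contract] by (rule fun_space.subspace_span)
  moreover have "act_sym G ` contract ` N \<subseteq> contract ` N" if "G \<in> GL3 sA sB sC" for G
      proof clarify
    fix x assume "x \<in> N"
    then have "act_sym G (contract x) = contract (act_tensor G x)" "act_tensor G x \<in> N"
      using equiv[OF that] closed[OF that] by simp_all
    then show "act_sym G (contract x) \<in> contract ` N" by blast
  qed
  moreover have "equivariant_iso (GL3 sA sB sC) act_tensor N act_sym (contract ` N) contract"
    unfolding equivariant_iso_def using assms(5) equiv by (auto simp: bij_betw_def contract_add contract_fscale)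
  ultimately show ?thesis
    using assms(6) unfolding is_schur_submodule_def N_def by blast
qed

end

section \<open>The image of the contraction\<close>

context coord_space
begin

definition word :: "nat \<Rightarrow> nat \<Rightarrow> nat \<Rightarrow> nat \<Rightarrow> (nat \<Rightarrow> 'v \<Rightarrow> complex) \<Rightarrow> complex"
  where "word i0 i1 i2 i3 = pr s (e i0) (e i1) (e i2) (e i3)"

text \<open>The terms of the symmetrizer collected by equal words, so that contracting a product of
  two symmetrized tensors becomes a finite sum over pairs of words.\<close>

lemma young_31_words:
  "young [3, 1] 0 0 0 1 = fscale 6 (word 0 0 0 1) + fscale (-2) (word 0 0 1 0) + fscale (-2) (word 0 1 0 0) + fscale (-2) (word 1 0 0 0)"
  "young [3, 1] 0 0 1 1 = fscale 2 (word 0 0 1 1) + fscale 2 (word 0 1 0 1) + fscale (-2) (word 0 1 1 0) + fscale 2 (word 1 0 0 1) + fscale (-2) (word 1 0 1 0) + fscale (-2) (word 1 1 0 0)"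
  "young [3, 1] 0 1 1 1 = fscale 2 (word 0 1 1 1) + fscale 2 (word 1 0 1 1) + fscale 2 (word 1 1 0 1) + fscale (-6) (word 1 1 1 0)"
  unfolding young_def word_def young_31 by (simp_all add: fun_eq_iff fscale_apply)

lemma young_211_words:
  "young [2, 1, 1] 0 0 1 2 = fscale 2 (word 0 0 1 2) + fscale (-2) (word 0 0 2 1) + fscale (-1) (word 0 1 0 2) + fscale 1 (word 0 1 2 0) + fscale 1 (word 0 2 0 1) + fscale (-1) (word 0 2 1 0) + fscale (-1) (word 1 0 0 2) + fscale 1 (word 1 0 2 0) + fscale 1 (word 2 0 0 1) + fscale (-1) (word 2 0 1 0)"
  "young [2, 1, 1] 0 1 1 2 = fscale 1 (word 0 1 1 2) + fscale (-1) (word 0 1 2 1) + fscale 1 (word 1 0 1 2) + fscale (-1) (word 1 0 2 1) + fscale (-2) (word 1 1 0 2) + fscale 2 (word 1 1 2 0) + fscale 1 (word 1 2 0 1) + fscale (-1) (word 1 2 1 0) + fscale 1 (word 2 1 0 1) + fscale (-1) (word 2 1 1 0)"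
  "young [2, 1, 1] 0 2 1 2 = fscale 1 (word 0 2 1 2) + fscale (-1) (word 0 2 2 1) + fscale (-1) (word 1 2 0 2) + fscale 1 (word 1 2 2 0) + fscale 1 (word 2 0 1 2) + fscale (-1) (word 2 0 2 1) + fscale (-1) (word 2 1 0 2) + fscale 1 (word 2 1 2 0) + fscale 2 (word 2 2 0 1) + fscale (-2) (word 2 2 1 0)"
  unfolding young_def word_def young_211 by (simp_all add: fun_eq_iff fscale_apply)

lemma young_22_words:
  "young [2, 2] 0 0 1 1 = fscale 4 (word 0 0 1 1) + fscale (-2) (word 0 1 0 1) + fscale (-2) (word 0 1 1 0) + fscale (-2) (word 1 0 0 1) + fscale (-2) (word 1 0 1 0) + fscale 4 (word 1 1 0 0)"
  "young [2, 2] 0 0 1 2 = fscale 2 (word 0 0 1 2) + fscale 2 (word 0 0 2 1) + fscale (-1) (word 0 1 0 2) + fscale (-1) (word 0 1 2 0) + fscale (-1) (word 0 2 0 1) + fscale (-1) (word 0 2 1 0) + fscale (-1) (word 1 0 0 2) + fscale (-1) (word 1 0 2 0) + fscale 2 (word 1 2 0 0) + fscale (-1) (word 2 0 0 1) + fscale (-1) (word 2 0 1 0) + fscale 2 (word 2 1 0 0)"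
  "young [2, 2] 0 0 2 2 = fscale 4 (word 0 0 2 2) + fscale (-2) (word 0 2 0 2) + fscale (-2) (word 0 2 2 0) + fscale (-2) (word 2 0 0 2) + fscale (-2) (word 2 0 2 0) + fscale 4 (word 2 2 0 0)"
  "young [2, 2] 0 1 1 2 = fscale 1 (word 0 1 1 2) + fscale 1 (word 0 1 2 1) + fscale (-2) (word 0 2 1 1) + fscale 1 (word 1 0 1 2) + fscale 1 (word 1 0 2 1) + fscale (-2) (word 1 1 0 2) + fscale (-2) (word 1 1 2 0) + fscale 1 (word 1 2 0 1) + fscale 1 (word 1 2 1 0) + fscale (-2) (word 2 0 1 1) + fscale 1 (word 2 1 0 1) + fscale 1 (word 2 1 1 0)"
  "young [2, 2] 0 1 2 2 = fscale 2 (word 0 1 2 2) + fscale (-1) (word 0 2 1 2) + fscale (-1) (word 0 2 2 1) + fscale 2 (word 1 0 2 2) + fscale (-1) (word 1 2 0 2) + fscale (-1) (word 1 2 2 0) + fscale (-1) (word 2 0 1 2) + fscale (-1) (word 2 0 2 1) + fscale (-1) (word 2 1 0 2) + fscale (-1) (word 2 1 2 0) + fscale 2 (word 2 2 0 1) + fscale 2 (word 2 2 1 0)"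
  "young [2, 2] 1 1 2 2 = fscale 4 (word 1 1 2 2) + fscale (-2) (word 1 2 1 2) + fscale (-2) (word 1 2 2 1) + fscale (-2) (word 2 1 1 2) + fscale (-2) (word 2 1 2 1) + fscale 4 (word 2 2 1 1)"
  unfolding young_def word_def young_22 by (simp_all add: fun_eq_iff fscale_apply)

end

section \<open>Minors as contractions\<close>

context tensor_coords
begin

abbreviation mn :: "nat \<Rightarrow> nat \<Rightarrow> nat \<Rightarrow> nat \<Rightarrow> ('a \<times> 'b \<times> 'c \<Rightarrow> complex) \<Rightarrow> complex"
  where "mn p0 p1 p2 p3 \<equiv> minor ((!) [p0, p1, p2, p3])"

lemma minor_transpose:
  assumes "i < 4" "j < 4" "i \<noteq> j"
  shows "minor (y \<circ> transpose i j) = - minor y"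
proof
  fix T
  let ?t = "transpose i j"
  have t: "?t permutes {..<4}" using assms by (intro permutes_swap_id) auto
  have "(\<Sum>\<sigma> | \<sigma> permutes {..<4}. of_int (sign \<sigma>) * (\<Prod>r<4. crd T (r, (y \<circ> ?t) (\<sigma> r)))) =
      (\<Sum>\<sigma> | \<sigma> permutes {..<4}. of_int (sign (?t \<circ> \<sigma>)) * (\<Prod>r<4. crd T (r, (y \<circ> ?t) ((?t \<circ> \<sigma>) r))))"
    by (rule setum_permutations_compose_left[OF t])
  also have "\<dots> = (\<Sum>\<sigma> | \<sigma> permutes {..<4}. - (of_int (sign \<sigma>) * (\<Prod>r<4. crd T (r, y (\<sigma> r)))))"
  proof (intro sum.cong refl)
    fix \<sigma> assume "\<sigma> \<in> {\<sigma>. \<sigma> permutes {..<4 :: nat}}"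
    then have "permutation \<sigma>" using permutation_permutes by blast
    then have "sign (?t \<circ> \<sigma>) = - sign \<sigma>"
      using assms(3) by (simp add: sign_compose sign_swap_id permutation_swap_id)
    then show "of_int (sign (?t \<circ> \<sigma>)) * (\<Prod>r<4. crd T (r, (y \<circ> ?t) ((?t \<circ> \<sigma>) r))) =
        - (of_int (sign \<sigma>) * (\<Prod>r<4. crd T (r, y (\<sigma> r))))" by simp
  qed
  finally show "minor (y \<circ> ?t) T = (- minor y) T"
    by (simp add: minor_def sum_negf)
qed

lemma mn_swap:
  "mn p1 p0 p2 p3 = - mn p0 p1 p2 p3" "mn p0 p2 p1 p3 = - mn p0 p1 p2 p3" "mn p0 p1 p3 p2 = - mn p0 p1 p2 p3"
proof -
  have less: "i = 0 \<or> i = 1 \<or> i = 2 \<or> i = 3" if "i < 4" for i :: nat using that by auto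
  have "mn p1 p0 p2 p3 = minor ((!) [p0, p1, p2, p3] \<circ> transpose 0 1)"
    "mn p0 p2 p1 p3 = minor ((!) [p0, p1, p2, p3] \<circ> transpose 1 2)"
    "mn p0 p1 p3 p2 = minor ((!) [p0, p1, p2, p3] \<circ> transpose 2 3)"
    by (rule minor_cong, drule less, auto)+
  then show "mn p1 p0 p2 p3 = - mn p0 p1 p2 p3" "mn p0 p2 p1 p3 = - mn p0 p1 p2 p3"
    "mn p0 p1 p3 p2 = - mn p0 p1 p2 p3"
    by (simp_all only: minor_transpose)
qed

text \<open>The guards orient the swaps, so that rewriting sorts the columns and terminates.\<close>

lemma mn_sort:
  "p1 < p0 \<Longrightarrow> mn p0 p1 p2 p3 = - mn p1 p0 p2 p3"
  "p2 < p1 \<Longrightarrow> mn p0 p1 p2 p3 = - mn p0 p2 p1 p3"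
  "p3 < p2 \<Longrightarrow> mn p0 p1 p2 p3 = - mn p0 p1 p3 p2"
  by (rule mn_swap)+

lemma mn_repeated: "mn p p q r = 0" "mn q p p r = 0" "mn q r p p = 0"
  by (rule eq_neg_self_function, rule mn_swap)+

abbreviation W :: "(nat \<Rightarrow> 'c \<Rightarrow> complex) \<Rightarrow> complex"
  where "W \<equiv> C.young [1, 1, 1, 1] 0 1 2 3"

text \<open>The alternating factor \<open>W\<close> turns the product into the Leibniz sum of a
  determinant whose column at a place is given by the letters of \<open>A\<close> and
  \<open>B\<close> there. The indices \<open>j1\<close> and \<open>j3\<close> are exchanged by the
  transposition built into \<open>contract\<close>.\<close>

lemma contract_words:
  assumes i: "i0 < 2" "i1 < 2" "i2 < 2" "i3 < 2" and j: "j0 < 3" "j1 < 3" "j2 < 3" "j3 < 3"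
  shows "contract (tprod (A.word i0 i1 i2 i3) (B.word j0 j1 j2 j3) W) =
    mn (3 * i0 + j0) (3 * i1 + j3) (3 * i2 + j2) (3 * i3 + j1)"
proof
  fix T
  let ?t = "transpose 1 (3 :: nat)" and ?P = "{q. q permutes {..<4 :: nat}}"
  let ?x = "(!) [a i0, a i1, a i2, a i3]" and ?y = "(!) [b j0, b j1, b j2, b j3]" and ?z = "(!) [c 0, c 1, c 2, c 3]"
  let ?m = "(!) [3 * i0 + j0, 3 * i1 + j3, 3 * i2 + j2, 3 * i3 + j1]"
  have "W = (\<Sum>q\<in>?P. fscale (of_int (sign q)) (pure sC (?z \<circ> inv_into UNIV q)))"
    unfolding C.young_def young_1111 by (auto simp: fun_eq_iff sum_fun_apply fscale_apply pure_permute intro!: sum.cong)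
  then have "contract (tprod (A.word i0 i1 i2 i3) (B.word j0 j1 j2 j3) W) =
      contract (tprod (pure sA ?x) (pure sB ?y) (\<Sum>q\<in>?P. fscale (of_int (sign q)) (pure sC (?z \<circ> inv_into UNIV q))))"
    by (simp only: A.word_def B.word_def)
  also have "\<dots> = (\<Sum>q\<in>?P. fscale (of_int (sign q)) (contract (tprod (pure sA ?x) (pure sB ?y) (pure sC (?z \<circ> inv_into UNIV q)))))"
  proof -
    have "finite ?P" by (simp add: finite_permutations)
    then show ?thesis
    proof (induction rule: finite_induct)
      case empty
      have "contract (tprod (pure sA ?x) (pure sB ?y) 0) = 0"
        by (simp add: contract_def tprod_def fun_eq_iff)
      then show ?case by (simp only: sum.empty)
    next
      case (insert q P)
      show ?case
        unfolding sum.insert[OF insert.hyps] tprod_add contract_add tprod_fscale contract_fscale insert.IH ..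
    qed
  qed
  finally have contr: "contract (tprod (A.word i0 i1 i2 i3) (B.word j0 j1 j2 j3) W) T =
      (\<Sum>q\<in>?P. of_int (sign q) * contract (tprod (pure sA ?x) (pure sB ?y) (pure sC (?z \<circ> inv_into UNIV q))) T)"
    by (simp only: sum_fun_apply fscale_apply)
  show "contract (tprod (A.word i0 i1 i2 i3) (B.word j0 j1 j2 j3) W) T =
      mn (3 * i0 + j0) (3 * i1 + j3) (3 * i2 + j2) (3 * i3 + j1) T"
  proof (cases "T \<in> V")
    case True
    have "T (?x p, ?y (?t p), ?z r) = crd T (r, ?m p)" if "p < 4" "r < 4" for p r
    proof -
      have "p = 0 \<or> p = 1 \<or> p = 2 \<or> p = 3" "r = 0 \<or> r = 1 \<or> r = 2 \<or> r = 3" using that by auto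
      then have "?z r = c r" "(?x p, ?y (?t p)) = (a (?m p div 3), b (?m p mod 3))"
        using i j by (auto simp del: One_nat_def)
      then show ?thesis by (simp add: crd_def)
    qed
    then have "contract (tprod (pure sA ?x) (pure sB ?y) (pure sC (?z \<circ> inv_into UNIV q))) T = (\<Prod>r<4. crd T (r, ?m (q r)))"
      if "q \<in> ?P" for q
    proof -
      assume eq: "\<And>p r. p < 4 \<Longrightarrow> r < 4 \<Longrightarrow> T (?x p, ?y (?t p), ?z r) = crd T (r, ?m p)"
      have q: "q permutes {..<4}" using that by simp
      have "contract (tprod (pure sA ?x) (pure sB ?y) (pure sC (?z \<circ> inv_into UNIV q))) T =
          (\<Prod>s<4. T (?x s, ?y (?t s), ?z (inv_into UNIV q s)))"
        using True by (simp only: contract_pure if_True comp_apply)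
      also have "\<dots> = (\<Prod>r<4. T (?x (q r), ?y (?t (q r)), ?z r))"
        by (subst prod.permute[OF q]) (simp only: comp_def permutes_inverses(2)[OF q])
      also have "\<dots> = (\<Prod>r<4. crd T (r, ?m (q r)))"
        using eq permutes_less_4[OF q] by (intro prod.cong refl) blast
      finally show ?thesis .
    qed
    then show ?thesis unfolding contr minor_def if_P[OF True] by (intro sum.cong refl) simp
  qed (simp add: contract_def minor_def)
qed

abbreviation c1 :: "nat \<Rightarrow> nat \<Rightarrow> nat \<Rightarrow> ('a \<times> 'b \<times> 'c \<Rightarrow> complex) \<Rightarrow> complex"
  where "c1 i i' j \<equiv> contract (tprod (A.young [3, 1] 0 i i' 1) (B.young [2, 1, 1] 0 j 1 2) W)"

abbreviation c2 :: "nat \<Rightarrow> nat \<Rightarrow> nat \<Rightarrow> nat \<Rightarrow> ('a \<times> 'b \<times> 'c \<Rightarrow> complex) \<Rightarrow> complex"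
  where "c2 j0 j1 j2 j3 \<equiv> contract (tprod (A.young [2, 2] 0 0 1 1) (B.young [2, 2] j0 j1 j2 j3) W)"

text \<open>A product of tableaux is a weight vector, so only minors with the same letters of
  \<open>A\<close> and \<open>B\<close> occur. The pairs 0135 and 0234, 0145 and 1234, 0245 and 1235
  share their letters; there this module gives the difference and the next one the sum.\<close>

lemma contract_31_211:
  "c1 0 0 0 =
    fscale (-64) (mn 0 1 2 3)"
  "c1 0 0 1 =
    fscale (-64) (mn 0 1 2 4)"
  "c1 0 0 2 =
    fscale (-64) (mn 0 1 2 5)"
  "c1 0 1 0 =
    fscale 32 (mn 0 1 3 5) + fscale (-32) (mn 0 2 3 4)"
  "c1 0 1 1 =
    fscale 32 (mn 0 1 4 5) + fscale (-32) (mn 1 2 3 4)"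
  "c1 0 1 2 =
    fscale 32 (mn 0 2 4 5) + fscale (-32) (mn 1 2 3 5)"
  "c1 1 1 0 =
    fscale (-64) (mn 0 3 4 5)"
  "c1 1 1 1 =
    fscale (-64) (mn 1 3 4 5)"
  "c1 1 1 2 =
    fscale (-64) (mn 2 3 4 5)"
  unfolding A.young_31_words B.young_211_words tprod_add tprod_fscale contract_add contract_fscale
  by (simp_all add: contract_words mn_sort mn_repeated fun_eq_iff fscale_apply del: One_nat_def flip: numeral_2_eq_2)

lemma contract_22_22:
  "c2 0 0 1 1 =
    fscale (-144) (mn 0 1 3 4)"
  "c2 0 0 1 2 =
    fscale (-72) (mn 0 1 3 5) + fscale (-72) (mn 0 2 3 4)"
  "c2 0 1 1 2 =
    fscale (-72) (mn 0 1 4 5) + fscale (-72) (mn 1 2 3 4)"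
  "c2 0 0 2 2 =
    fscale (-144) (mn 0 2 3 5)"
  "c2 0 1 2 2 =
    fscale (-72) (mn 0 2 4 5) + fscale (-72) (mn 1 2 3 5)"
  "c2 1 1 2 2 =
    fscale (-144) (mn 1 2 4 5)"
  unfolding A.young_22_words B.young_22_words tprod_add tprod_fscale contract_add contract_fscale
  by (simp_all add: contract_words mn_sort mn_repeated fun_eq_iff fscale_apply del: One_nat_def flip: numeral_2_eq_2)

lemma mn_in_minor_ideal: "[p0, p1, p2, p3] \<in> column_sets \<Longrightarrow> mn p0 p1 p2 p3 \<in> minor_ideal 4"
  unfolding minor_ideal_4 by (intro fun_space.span_base) blast

text \<open>Half sums and half differences in the two-dimensional weight spaces, as 64 = 2 * 32 and
  144 = 2 * 72; in the one-dimensional ones the coefficient is inverted.\<close>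

lemma mn_eq_contract:
  "mn 0 1 2 3 = fscale (-1 / 64) (c1 0 0 0)"
  "mn 0 1 2 4 = fscale (-1 / 64) (c1 0 0 1)"
  "mn 0 1 2 5 = fscale (-1 / 64) (c1 0 0 2)"
  "mn 0 1 3 4 = fscale (-1 / 144) (c2 0 0 1 1)"
  "mn 0 1 3 5 = fscale (1 / 64) (c1 0 1 0) + fscale (-1 / 144) (c2 0 0 1 2)"
  "mn 0 1 4 5 = fscale (1 / 64) (c1 0 1 1) + fscale (-1 / 144) (c2 0 1 1 2)"
  "mn 0 2 3 4 = fscale (-1 / 64) (c1 0 1 0) + fscale (-1 / 144) (c2 0 0 1 2)"
  "mn 0 2 3 5 = fscale (-1 / 144) (c2 0 0 2 2)"
  "mn 0 2 4 5 = fscale (1 / 64) (c1 0 1 2) + fscale (-1 / 144) (c2 0 1 2 2)"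
  "mn 0 3 4 5 = fscale (-1 / 64) (c1 1 1 0)"
  "mn 1 2 3 4 = fscale (-1 / 64) (c1 0 1 1) + fscale (-1 / 144) (c2 0 1 1 2)"
  "mn 1 2 3 5 = fscale (-1 / 64) (c1 0 1 2) + fscale (-1 / 144) (c2 0 1 2 2)"
  "mn 1 2 4 5 = fscale (-1 / 144) (c2 1 1 2 2)"
  "mn 1 3 4 5 = fscale (-1 / 64) (c1 1 1 1)"
  "mn 2 3 4 5 = fscale (-1 / 64) (c1 1 1 2)"
  unfolding contract_31_211 contract_22_22 by (simp_all add: fun_eq_iff fscale_apply field_simps)

lemma ideal_decomposition:
  "\<exists>M\<^sub>1 M\<^sub>2. is_schur_submodule sA sB sC 4 [3, 1] [2, 1, 1] [1, 1, 1, 1] M\<^sub>1 \<and>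
    is_schur_submodule sA sB sC 4 [2, 2] [2, 2] [1, 1, 1, 1] M\<^sub>2 \<and>
    is_direct_sum (minor_ideal 4) M\<^sub>1 M\<^sub>2 \<and> fun_space.dim M\<^sub>2 = 6"
proof -
  define S1 where "S1 = {A.young [3, 1] 0 0 0 1, A.young [3, 1] 0 0 1 1, A.young [3, 1] 0 1 1 1}"
  define S1' where "S1' = {B.young [2, 1, 1] 0 0 1 2, B.young [2, 1, 1] 0 1 1 2, B.young [2, 1, 1] 0 2 1 2}"
  define S2 where "S2 = {A.young [2, 2] 0 0 1 1}"
  define S2' where "S2' = {B.young [2, 2] 0 0 1 1, B.young [2, 2] 0 0 1 2, B.young [2, 2] 0 1 1 2,
    B.young [2, 2] 0 0 2 2, B.young [2, 2] 0 1 2 2, B.young [2, 2] 1 1 2 2}"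
  define B1 where "B1 = (\<lambda>(f, g). tprod f g W) ` (S1 \<times> S1')"
  define B2 where "B2 = (\<lambda>(f, g). tprod f g W) ` (S2 \<times> S2')"
  define E1 where "E1 = contract ` B1"
  define E2 where "E2 = contract ` B2"
  let ?N1 = "tensor3 (schur [3, 1] sA) (schur [2, 1, 1] sB) (schur [1, 1, 1, 1] sC)"
  let ?N2 = "tensor3 (schur [2, 2] sA) (schur [2, 2] sB) (schur [1, 1, 1, 1] sC)"
  have "{tprod f g h |f g h. f \<in> S \<and> g \<in> S' \<and> h \<in> {W}} = (\<lambda>(f, g). tprod f g W) ` (S \<times> S')" for S S'
    by auto
  then have N: "tensor3 (lspan S) (lspan S') (lspan {W}) =
      lspan ((\<lambda>(f, g). tprod f g W) ` (S \<times> S'))" for S S'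
    unfolding tensor3_span by (rule arg_cong)
  have N1: "?N1 = lspan B1" and N2: "?N2 = lspan B2"
    unfolding A.schur_31_dim_2[OF refl] A.schur_22_dim_2[OF refl] B.schur_211_dim_3[OF refl]
      B.schur_22_dim_3[OF refl] C.schur_1111_dim_4[OF refl] B1_def B2_def S1_def S1'_def S2_def S2'_def
    by (rule N)+
  have fin: "finite S1" "finite S1'" "finite S2" "finite S2'"
    by (simp_all add: S1_def S1'_def S2_def S2'_def)
  then have finB: "finite B1" "finite B2" and finE: "finite E1" "finite E2"
    by (simp_all add: B1_def B2_def E1_def E2_def)
  have "card S1 \<le> 3" "card S1' \<le> 3" "card S2 \<le> 1" "card S2' \<le> 6"
    unfolding S1_def S1'_def S2_def S2'_def by (auto intro!: order_trans[OF card_insert_le_m1])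
  then have "card S1 * card S1' \<le> 3 * 3" "card S2 * card S2' \<le> 1 * 6" by (intro mult_mono; simp)+
  then have cardB: "card B1 \<le> 9" "card B2 \<le> 6"
    using card_image_le[of "S1 \<times> S1'" "\<lambda>(f, g). tprod f g W"] card_image_le[of "S2 \<times> S2'" "\<lambda>(f, g). tprod f g W"] fin
    by (simp_all add: B1_def B2_def card_cartesian_product)
  have cardE_le: "card E1 \<le> card B1" "card E2 \<le> card B2"
    unfolding E1_def E2_def using finB by (simp_all add: card_image_le)
  have E1: "contract (tprod f g W) \<in> E1" if "f \<in> S1" "g \<in> S1'" for f g
    using that by (auto simp: E1_def B1_def)
  have E2: "contract (tprod f g W) \<in> E2" if "f \<in> S2" "g \<in> S2'" for f g
    using that by (auto simp: E2_def B2_def)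
  have cols: "[0, 1, 2, 3] \<in> column_sets" "[0, 1, 2, 4] \<in> column_sets"
    "[0, 1, 2, 5] \<in> column_sets" "[0, 1, 3, 4] \<in> column_sets"
    "[0, 1, 3, 5] \<in> column_sets" "[0, 1, 4, 5] \<in> column_sets"
    "[0, 2, 3, 4] \<in> column_sets" "[0, 2, 3, 5] \<in> column_sets"
    "[0, 2, 4, 5] \<in> column_sets" "[0, 3, 4, 5] \<in> column_sets"
    "[1, 2, 3, 4] \<in> column_sets" "[1, 2, 3, 5] \<in> column_sets"
    "[1, 2, 4, 5] \<in> column_sets" "[1, 3, 4, 5] \<in> column_sets"
    "[2, 3, 4, 5] \<in> column_sets"
    by (simp_all add: column_sets_def)
  have sub: "E1 \<union> E2 \<subseteq> minor_ideal 4"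
  proof -
    have ideal: "fun_space.subspace (minor_ideal 4)" by (simp add: minor_ideal_def fun_space.subspace_span)
    have mem: "c1 0 0 0 \<in> minor_ideal 4" "c1 0 0 1 \<in> minor_ideal 4" "c1 0 0 2 \<in> minor_ideal 4"
    "c1 0 1 0 \<in> minor_ideal 4" "c1 0 1 1 \<in> minor_ideal 4" "c1 0 1 2 \<in> minor_ideal 4"
    "c1 1 1 0 \<in> minor_ideal 4" "c1 1 1 1 \<in> minor_ideal 4" "c1 1 1 2 \<in> minor_ideal 4"
    "c2 0 0 1 1 \<in> minor_ideal 4" "c2 0 0 1 2 \<in> minor_ideal 4"
    "c2 0 1 1 2 \<in> minor_ideal 4" "c2 0 0 2 2 \<in> minor_ideal 4"
    "c2 0 1 2 2 \<in> minor_ideal 4" "c2 1 1 2 2 \<in> minor_ideal 4"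
      by (subst contract_31_211 contract_22_22, intro fun_space.subspace_add[OF ideal]
          fun_space.subspace_scale[OF ideal] cols[THEN mn_in_minor_ideal])+
    have "contract (tprod f g W) \<in> minor_ideal 4" if "f \<in> S1" "g \<in> S1'" for f g
      using that unfolding S1_def S1'_def by (elim insertE emptyE) (simp_all only: mem)
    moreover have "contract (tprod f g W) \<in> minor_ideal 4" if "f \<in> S2" "g \<in> S2'" for f g
      using that unfolding S2_def S2'_def by (elim insertE emptyE) (simp_all only: mem)
    ultimately show ?thesis by (auto simp: E1_def E2_def B1_def B2_def)
  qed
  have minors_le: "minors \<subseteq> lspan (E1 \<union> E2)" (is "_ \<subseteq> ?S")
  proof -
    have mem1: "c1 0 0 0 \<in> ?S" "c1 0 0 1 \<in> ?S" "c1 0 0 2 \<in> ?S" "c1 0 1 0 \<in> ?S"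
      "c1 0 1 1 \<in> ?S" "c1 0 1 2 \<in> ?S" "c1 1 1 0 \<in> ?S" "c1 1 1 1 \<in> ?S"
      "c1 1 1 2 \<in> ?S"
      by (rule fun_space.span_base, rule UnI1, rule E1, simp add: S1_def, simp add: S1'_def)+
    have mem2: "c2 0 0 1 1 \<in> ?S" "c2 0 0 1 2 \<in> ?S" "c2 0 1 1 2 \<in> ?S" "c2 0 0 2 2 \<in> ?S"
      "c2 0 1 2 2 \<in> ?S" "c2 1 1 2 2 \<in> ?S"
      by (rule fun_space.span_base, rule UnI2, rule E2, simp add: S2_def, simp add: S2'_def)+
    have mem: "mn 0 1 2 3 \<in> ?S" "mn 0 1 2 4 \<in> ?S" "mn 0 1 2 5 \<in> ?S" "mn 0 1 3 4 \<in> ?S"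
      "mn 0 1 3 5 \<in> ?S" "mn 0 1 4 5 \<in> ?S" "mn 0 2 3 4 \<in> ?S" "mn 0 2 3 5 \<in> ?S"
      "mn 0 2 4 5 \<in> ?S" "mn 0 3 4 5 \<in> ?S" "mn 1 2 3 4 \<in> ?S" "mn 1 2 3 5 \<in> ?S"
      "mn 1 2 4 5 \<in> ?S" "mn 1 3 4 5 \<in> ?S" "mn 2 3 4 5 \<in> ?S"
      by (subst mn_eq_contract, intro fun_space.span_add fun_space.span_scale mem1 mem2)+
    show ?thesis
      unfolding column_sets_def image_insert image_empty insert_subset by (intro conjI mem empty_subsetI)
  qed
  have card_le: "card (E1 \<union> E2) \<le> 15"
    using card_Un_le[of E1 E2] cardE_le cardB by linarith
  have ind: "fun_space.independent (E1 \<union> E2)"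
  proof (rule independent_if_span_contains[OF _ independent_minors minors_le])
    show "finite (E1 \<union> E2)" using finE by simp
    show "card (E1 \<union> E2) \<le> card minors" unfolding card_minors by (rule card_le)
  qed
  \<comment> \<open>The chain \<open>15 \<le> card (E1 \<union> E2) \<le> card E1 + card E2 \<le>
    card B1 + card B2 \<le> 9 + 6\<close> consists of equalities, which gives the exact sizes,
    disjointness, and injectivity on the generators.\<close>
  have "15 \<le> card (E1 \<union> E2)"
    using fun_space.independent_span_bound[OF _ independent_minors minors_le] finE unfolding card_minors by blast
  moreover have "card (E1 \<union> E2) + card (E1 \<inter> E2) = card E1 + card E2"
    using card_Un_Int[OF finE] by simp
  ultimately have card: "card E1 = 9" "card E2 = 6" "card B1 = 9" "card B2 = 6" and "card (E1 \<inter> E2) = 0"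
    using cardE_le cardB by linarith+
  then have disj: "E1 \<inter> E2 = {}" using finE by simp
  have ind12: "fun_space.independent E1" "fun_space.independent E2"
    using fun_space.independent_mono[OF ind] by blast+
  have "inj_on contract B1" "inj_on contract B2"
    using card finB unfolding E1_def E2_def by (auto intro!: eq_card_imp_inj_on)
  \<comment> \<open>A linear map that is injective on a spanning set with independent image is
    injective on the span.\<close>
  then have inj: "inj_on contract ?N1" "inj_on contract ?N2"
    unfolding N1 N2
    using ind12 module_hom.inj_on_span_independent_image[OF Vector_Spaces.linear.axioms(3)[OF linear_contract]]
    unfolding E1_def E2_def by blast+
  have image: "contract ` ?N1 = lspan E1" "contract ` ?N2 = lspan E2"
    unfolding N1 N2 E1_def E2_def by (rule linear_image_span[OF linear_contract])+
  have ideal: "minor_ideal 4 = lspan (E1 \<union> E2)"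
  proof
    show "minor_ideal 4 \<subseteq> lspan (E1 \<union> E2)"
      unfolding minor_ideal_4 using minors_le by (intro fun_space.span_minimal fun_space.subspace_span)
    show "lspan (E1 \<union> E2) \<subseteq> minor_ideal 4"
      using sub by (intro fun_space.span_minimal) (simp_all add: minor_ideal_def fun_space.subspace_span)
  qed
  have "minor_ideal 4 \<subseteq> sym_power V 4"
    unfolding ideal_part_eq[symmetric] ideal_part_def by blast
  then have sym: "contract ` ?N1 \<subseteq> sym_power V 4" "contract ` ?N2 \<subseteq> sym_power V 4"
    unfolding image ideal using fun_space.span_mono[of E1 "E1 \<union> E2"] fun_space.span_mono[of E2 "E1 \<union> E2"] by auto
  have "is_direct_sum (minor_ideal 4) (lspan E1) (lspan E2)"
    unfolding is_direct_sum_def ideal fun_space.span_Un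
    using span_Int_of_independent_Un[OF finE ind disj] by simp
  moreover have "fun_space.dim (lspan E2) = 6"
    using fun_space.dim_span_eq_card_independent[OF ind12(2)] card by simp
  moreover have "is_schur_submodule sA sB sC 4 [3, 1] [2, 1, 1] [1, 1, 1, 1] (lspan E1)"
    unfolding image(1)[symmetric] using inj(1) sym(1) by (intro is_schur_submodule_contract) simp_all
  moreover have "is_schur_submodule sA sB sC 4 [2, 2] [2, 2] [1, 1, 1, 1] (lspan E2)"
    unfolding image(2)[symmetric] using inj(2) sym(2) by (intro is_schur_submodule_contract) simp_all
  ultimately show ?thesis by blast
qed

end

theorem proposition6p2:
  fixes sA :: "complex \<Rightarrow> 'a \<Rightarrow> 'a::ab_group_add"
    and sB :: "complex \<Rightarrow> 'b \<Rightarrow> 'b::ab_group_add"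
    and sC :: "complex \<Rightarrow> 'c \<Rightarrow> 'c::ab_group_add"
    and V :: "('a \<times> 'b \<times> 'c \<Rightarrow> complex) set"
    and X :: "('a \<times> 'b \<times> 'c \<Rightarrow> complex) set set"
  assumes "vector_space sA" and "vector_space.dim sA (UNIV :: 'a set) = 2"
    and "vector_space sB" and "vector_space.dim sB (UNIV :: 'b set) = 3"
    and "vector_space sC" and "vector_space.dim sC (UNIV :: 'c set) = 4"
  defines "V \<equiv> tensor_space sA sB sC"
    and "X \<equiv> segre sA sB sC"
  shows "(\<exists>M\<^sub>1 M\<^sub>2.
      is_schur_submodule sA sB sC 4 [3, 1] [2, 1, 1] [1, 1, 1, 1] M\<^sub>1 \<and>
      is_schur_submodule sA sB sC 4 [2, 2] [2, 2] [1, 1, 1, 1] M\<^sub>2 \<and>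
      is_direct_sum (ideal_part V (secant_variety V 3 X) 4) M\<^sub>1 M\<^sub>2 \<and>
      fun_space.dim M\<^sub>2 = 6)
    \<and> fun_space.dim (ideal_part V (secant_variety V 3 X) 4) = 15
    \<and> generated_ideal V (ideal_part V (secant_variety V 3 X) 4)
        = homogeneous_ideal V (secant_variety V 3 X)
    \<and> secant_variety V 4 X = proj V"
proof -
  \<comment> \<open>Coordinates enter through arbitrary bases; the statement itself is free of
    them.\<close>
  obtain a \<alpha> where A: "coord_space sA 2 a \<alpha>"
    using coord_space_exists[OF assms(1,2)] by auto
  obtain b \<beta> where B: "coord_space sB 3 b \<beta>"
    using coord_space_exists[OF assms(3,4)] by auto
  obtain c \<gamma> where C: "coord_space sC 4 c \<gamma>"
    using coord_space_exists[OF assms(5,6)] by auto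
  interpret tensor_coords sA a \<alpha> sB b \<beta> sC c \<gamma>
    using A B C by (rule tensor_coords.intro)
  show ?thesis
    unfolding V_def X_def ideal_part_eq
    using ideal_decomposition dim_minor_ideal_4 generated_ideal_eq secant_variety_4 by blast
qed

end
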